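(* Let $d\in\mathbb N$, $d\ge 2$, and $s\in(0,1)$. (a) For $\delta\in[0,\frac12]$, the function $u_\delta:\mathbb R^d\to\mathbb R$, $u_\delta(x)=|x|^{1-\delta}\,\frac{x_1}{|x|}$, satisfies, for all $t\in(0,1)$ and $q\in(1,\infty)$, $$u_\delta\in W^{t,q}_{\mathrm{loc}}(B_1(0))\quad\text{if and only if}\quad 1-\delta>t-\frac dq .$$ (b) For $\epsilon\in[0,\frac12]$, the matrix-valued coefficient $\mathbb A_{s,\epsilon}(x)=\left(1-\frac{1+2s}{2}\epsilon\right)\mathrm{Id}+\frac{d+2s}{2}\epsilon\,\widehat x\otimes\widehat x$ has the following properties: (i) it is uniformly elliptic with eigenvalues in the range $\left[1-\frac{1+2s}{2}\epsilon,\,1+\frac{d-1}{2}\epsilon\right]\subset\left[\frac14,\,1+\frac{d-1}{4}\right]$; (ii) $\|\log\mathbb A_{s,\epsilon}\|_{L^\infty(\mathbb R^d)}\le\frac{1+d+4s}{2}\,\epsilon$, where $\log$ is the matrix logarithm and matrices are measured in the spectral norm. (c) There exists $\delta_0=\delta_0(d,s)\in[0,\frac12]$ and a constant $C(d,s)$ such that for every $\epsilon\in[0,\frac12]$ there exists $\delta\in[0,\delta_0]$ with $\epsilon\le C(d,s)\,\delta$ such that $(-\Delta_{\mathbb A_{s,\epsilon}})^su_\delta(x)=0$ as a function on $B_1(0)$. The relation between $\epsilon$ and $\delta$ is $$\epsilon=\frac{2(d-2s+2-\delta)\,\delta}{(d-1)s(d-2s+2)-2(d-1)\dfrac{\Gamma\left(\frac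 d2\right)\Gamma(s+1)\Gamma\left(\frac d2-s-\frac\delta2+2\right)\Gamma\left(1+\frac\delta2\right)}{\Gamma\left(\frac d2-s\right)\Gamma\left(\frac d2-\frac\delta2+1\right)\Gamma\left(\frac\delta2+s\right)}} .$$
   Context: For $x\in\mathbb R^d\setminus\{0\}$ write $\widehat x=x/|x|$, and $(\widehat x\otimes\widehat x)_{ij}=\widehat x_i\widehat x_j$. Define $$\kappa_{d,s}=\frac{2^{2s-1}\Gamma(\frac d2+s)}{\pi^{d/2}|\Gamma(-s)|},\qquad k_{s,\epsilon}(x,y)=|x-y|^{-d-2s}\left\langle\tfrac{\mathbb A_{s,\epsilon}(x)+\mathbb A_{s,\epsilon}(y)}{2}\,\widehat{x-y},\widehat{x-y}\right\rangle .$$ The nonlocal operator applied to $u_\delta$ is the function, defined for $x\in B_1(0)\setminus\{0\}$ (where the limit exists), $$(-\Delta_{\mathbb A_{s,\epsilon}})^su_\delta(x)=2\kappa_{d,s}\lim_{R\to\infty}\int_{\frac1R\le|h|\le R}k_{s,\epsilon}(x,x+h)\,\bigl(u_\delta(x)-u_\delta(x+h)\bigr)\,dh .$$ $W^{t,q}$ denotes the fractional (Sobolev–Slobodeckij) Sobolev space, and $B_1(0)$ is the open unit ball of $\mathbb R^d$. *)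

theory Defs
  imports "HOL-Probability.Essential_Supremum"
begin

text \<open>Throughout, \<open>\<real>\<^sup>d\<close> is \<open>real ^ 'n\<close> with \<open>d = CARD('n)\<close>, and \<open>x / |x|\<close> is the
  library's \<open>sgn x\<close> (with \<open>sgn 0 = 0\<close>).\<close>

subsection \<open>Fractional Sobolev spaces\<close>

text \<open>Sobolev--Slobodeckij space: finite \<open>L\<^sup>q\<close> norm and finite Gagliardo seminorm.  The
  integrand of the seminorm is \<open>0\<close> on the diagonal, which is a null set.\<close>

definition frac_sobolev :: "real \<Rightarrow> real \<Rightarrow> 'a::euclidean_space set \<Rightarrow> ('a \<Rightarrow> real) set" where
  "frac_sobolev t q V = {u. u \<in> borel_measurable (lebesgue_on V) \<and>
     (\<integral>\<^sup>+x\<in>V. ennreal (\<bar>u x\<bar> powr q) \<partial>lebesgue) < \<infinity> \<and>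
     (\<integral>\<^sup>+p\<in>V \<times> V. ennreal (\<bar>u (fst p) - u (snd p)\<bar> powr q /
         norm (fst p - snd p) powr (real DIM('a) + t * q)) \<partial>lebesgue) < \<infinity>}"

definition frac_sobolev_loc :: "real \<Rightarrow> real \<Rightarrow> 'a::euclidean_space set \<Rightarrow> ('a \<Rightarrow> real) set" where
  "frac_sobolev_loc t q U =
     {u. \<forall>V. open V \<and> compact (closure V) \<and> closure V \<subseteq> U \<longrightarrow> u \<in> frac_sobolev t q V}"

subsection \<open>Matrices\<close>

text \<open>Only used for symmetric matrices, all of whose eigenvalues are real.\<close>

definition eigenvalues :: "real ^ 'n ^ 'n \<Rightarrow> real set" where
  "eigenvalues M = {l. \<exists>v. v \<noteq> 0 \<and> M *v v = l *\<^sub>R v}"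

definition uniformly_elliptic_on :: "(real ^ 'n) set \<Rightarrow> (real ^ 'n \<Rightarrow> real ^ 'n ^ 'n) \<Rightarrow> bool" where
  "uniformly_elliptic_on S A \<longleftrightarrow>
     (\<exists>l L. 0 < l \<and> l \<le> L \<and>
       (\<forall>x\<in>S. transpose (A x) = A x \<and>
         (\<forall>v. l * (norm v)\<^sup>2 \<le> (A x *v v) \<bullet> v \<and> (A x *v v) \<bullet> v \<le> L * (norm v)\<^sup>2)))"

definition spectral_norm :: "real ^ 'n ^ 'n \<Rightarrow> real" where
  "spectral_norm M = onorm ((*v) M)"

text \<open>The type \<open>real ^ 'n ^ 'n\<close> carries the componentwise product, so the power and the
  exponential of the type classes are not the ones of matrices.\<close>

primrec matrix_power :: "real ^ 'n ^ 'n \<Rightarrow> nat \<Rightarrow> real ^ 'n ^ 'n" where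
  "matrix_power M 0 = mat 1"
| "matrix_power M (Suc k) = M ** matrix_power M k"

definition matrix_exp :: "real ^ 'n ^ 'n \<Rightarrow> real ^ 'n ^ 'n" where
  "matrix_exp M = (\<Sum>k. (1 / fact k) *\<^sub>R matrix_power M k)"

text \<open>The logarithm of a symmetric positive definite matrix is its unique symmetric preimage
  under the exponential; elsewhere the value is unspecified.\<close>

definition matrix_log :: "real ^ 'n ^ 'n \<Rightarrow> real ^ 'n ^ 'n" where
  "matrix_log M = (THE L. transpose L = L \<and> matrix_exp L = M)"

subsection \<open>The nonlocal operator\<close>

definition kappa :: "nat \<Rightarrow> real \<Rightarrow> real" where
  "kappa d s = 2 powr (2 * s - 1) * Gamma (real d / 2 + s) / (pi powr (real d / 2) * \<bar>Gamma (- s)\<bar>)"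

definition kernel :: "(real ^ 'n \<Rightarrow> real ^ 'n ^ 'n) \<Rightarrow> real \<Rightarrow> real ^ 'n \<Rightarrow> real ^ 'n \<Rightarrow> real" where
  "kernel A s x y = norm (x - y) powr (- real CARD('n) - 2 * s) *
     ((((1 / 2) *\<^sub>R (A x + A y)) *v sgn (x - y)) \<bullet> sgn (x - y))"

definition nonlocal_integrand ::
    "(real ^ 'n \<Rightarrow> real ^ 'n ^ 'n) \<Rightarrow> real \<Rightarrow> (real ^ 'n \<Rightarrow> real) \<Rightarrow> real ^ 'n \<Rightarrow> real ^ 'n \<Rightarrow> real" where
  "nonlocal_integrand A s u x h = kernel A s x (x + h) * (u x - u (x + h))"

definition truncated_integral ::
    "(real ^ 'n \<Rightarrow> real ^ 'n ^ 'n) \<Rightarrow> real \<Rightarrow> (real ^ 'n \<Rightarrow> real) \<Rightarrow> real ^ 'n \<Rightarrow> real \<Rightarrow> real" where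
  "truncated_integral A s u x R =
     (LINT h:{h. 1 / R \<le> norm h \<and> norm h \<le> R}|lborel. nonlocal_integrand A s u x h)"

text \<open>The operator is defined at \<open>x\<close> if the truncated integrals exist and converge.\<close>

definition nonlocal_op_exists ::
    "(real ^ 'n \<Rightarrow> real ^ 'n ^ 'n) \<Rightarrow> real \<Rightarrow> (real ^ 'n \<Rightarrow> real) \<Rightarrow> real ^ 'n \<Rightarrow> bool" where
  "nonlocal_op_exists A s u x \<longleftrightarrow>
     (\<forall>R>0. set_integrable lborel {h. 1 / R \<le> norm h \<and> norm h \<le> R} (nonlocal_integrand A s u x)) \<and>
     (\<exists>l. (truncated_integral A s u x \<longlongrightarrow> l) at_top)"

definition nonlocal_op ::
    "(real ^ 'n \<Rightarrow> real ^ 'n ^ 'n) \<Rightarrow> real \<Rightarrow> (real ^ 'n \<Rightarrow> real) \<Rightarrow> real ^ 'n \<Rightarrow> real" where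
  "nonlocal_op A s u x = 2 * kappa CARD('n) s * Lim at_top (truncated_integral A s u x)"

subsection \<open>The solutions and the coefficients\<close>

text \<open>An arbitrary coordinate \<open>i\<close> takes the role of the first one, as the index type \<open>'n\<close>
  has no distinguished element.\<close>

definition u_sol :: "'n::finite \<Rightarrow> real \<Rightarrow> real ^ 'n \<Rightarrow> real" where
  "u_sol i \<delta> x = norm x powr (1 - \<delta>) * (x $ i / norm x)"

definition A_coeff :: "real \<Rightarrow> real \<Rightarrow> real ^ 'n \<Rightarrow> real ^ 'n ^ 'n" where
  "A_coeff s \<epsilon> x = (1 - (1 + 2 * s) / 2 * \<epsilon>) *\<^sub>R mat 1 +
     ((real CARD('n) + 2 * s) / 2 * \<epsilon>) *\<^sub>R (\<chi> i j. sgn x $ i * sgn x $ j)"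

definition eps_denominator :: "nat \<Rightarrow> real \<Rightarrow> real \<Rightarrow> real" where
  "eps_denominator d s \<delta> =
     (real d - 1) * s * (real d - 2 * s + 2) -
     2 * (real d - 1) *
       ((Gamma (real d / 2) * Gamma (s + 1) * Gamma (real d / 2 - s - \<delta> / 2 + 2) * Gamma (1 + \<delta> / 2)) /
        (Gamma (real d / 2 - s) * Gamma (real d / 2 - \<delta> / 2 + 1) * Gamma (\<delta> / 2 + s)))"

end

theory Submission
  imports Defs "HOL-Probability.Distributions"
begin

text \<open>Part (a) follows from homogeneity: the Gagliardo integrand is homogeneous on
  \<open>\<real>\<^sup>d \<times> \<real>\<^sup>d\<close>, so its integrals over dyadic shells form a geometric series.  In part (b) a symmetric
  logarithm is determined because each of its eigenvectors is an eigenvector of the coefficient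
  and the eigenvectors of a symmetric matrix span the space.

  For part (c), symmetrising \<open>h \<mapsto> -h\<close> makes the integrand absolutely integrable, and scaling reduces
  to \<open>|x| = 1\<close>.  Writing \<open>|h|\<^bsup>-d-2s-2\<^esup>\<close> as a Gamma integral of Gaussians \<open>exp (-t |h|\<^sup>2)\<close>, and the
  negative powers of \<open>|x + h|\<close> likewise, leaves Gaussian moments with centre \<open>(1 - n) x\<close> for
  \<open>0 < n < 1\<close>.  An integration by parts in \<open>n\<close> cancels the divergent terms; the remaining integrals
  over \<open>t\<close> are quotients of Gamma functions, and their sum is a multiple of
  \<open>2 (d - 2s + 2 - \<delta>) \<delta> - \<epsilon> eps_denominator d s \<delta>\<close>.  A suitable \<open>\<delta>\<close> exists by the intermediate value
  theorem, since the denominator is decreasing in \<open>\<delta>\<close> by concavity of the Digamma function.\<close>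

subsection \<open>Homogeneous functions and the Gagliardo seminorm\<close>

text \<open>Two obstacles shape part (c). First, the integral converges only conditionally: near h =
  0 a first difference is of order |h| against |h|^(-d-2s), too singular if s \<ge> 1/2, and for
  large h the growth |h|^(1-\<delta>) of u is too fast if 2s \<le> 1-\<delta>. Symmetrising leaves a
  second difference near 0 and, u being odd, a difference of u at two points 2|x| apart at infinity.
  Second, the coefficient depends on the direction of x + h as well. Multiplying the weight by
  |h|^2, hence the exponent -d-2s-2, leaves for |x| = 1 and y = x + h a polynomial in y plus a
  multiple of (x . y)^2 / |y|^2. Together with u only the powers |y|^(-2), |y|^(-\<delta>) and
  |y|^(-\<delta>-2) occur, all of them negative. The Gamma integral for |y|^(-\<delta>) requires
  \<delta> > 0; the remaining case \<epsilon> = \<delta> = 0 is a linear function and the identity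
  matrix.\<close>

lemma nn_integral_scaleR_lborel:
  fixes f :: "'a::euclidean_space \<Rightarrow> ennreal"
  assumes [measurable]: "f \<in> borel_measurable borel" and c: "c > 0"
  shows "(\<integral>\<^sup>+x. f x \<partial>lborel) = ennreal (c ^ DIM('a)) * (\<integral>\<^sup>+x. f (c *\<^sub>R x) \<partial>lborel)"
  using c
  by (subst lborel_affine[of c "0::'a"])
     (simp_all add: nn_integral_density nn_integral_distr nn_integral_cmult)

lemma nn_integral_homogeneous_scale:
  fixes f :: "'a::euclidean_space \<Rightarrow> ennreal"
  assumes [measurable]: "f \<in> borel_measurable borel"
    and hom: "\<And>c x. c > 0 \<Longrightarrow> f (c *\<^sub>R x) = ennreal (c powr e) * f x" and c: "c > 0"
  shows "(\<integral>\<^sup>+x\<in>{x. c * a \<le> norm x \<and> norm x < c * b}. f x \<partial>lborel) =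
     ennreal (c powr (e + DIM('a))) * (\<integral>\<^sup>+x\<in>{x. a \<le> norm x \<and> norm x < b}. f x \<partial>lborel)"
proof -
  have "(\<integral>\<^sup>+x\<in>{x. c * a \<le> norm x \<and> norm x < c * b}. f x \<partial>lborel) =
     ennreal (c ^ DIM('a)) * (\<integral>\<^sup>+x. f (c *\<^sub>R x) * indicator {x. c * a \<le> norm x \<and> norm x < c * b} (c *\<^sub>R x) \<partial>lborel)"
    by (rule nn_integral_scaleR_lborel) (use c in simp_all)
  also have "(\<integral>\<^sup>+x. f (c *\<^sub>R x) * indicator {x. c * a \<le> norm x \<and> norm x < c * b} (c *\<^sub>R x) \<partial>lborel)
    = (\<integral>\<^sup>+x. ennreal (c powr e) * (f x * indicator {x. a \<le> norm x \<and> norm x < b} x) \<partial>lborel)"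
    by (rule nn_integral_cong) (use c in \<open>auto simp: hom indicator_def\<close>)
  also have "\<dots> = ennreal (c powr e) * (\<integral>\<^sup>+x\<in>{x. a \<le> norm x \<and> norm x < b}. f x \<partial>lborel)"
    by (rule nn_integral_cmult) measurable
  finally show ?thesis
    using c by (simp add: powr_add powr_realpow ennreal_mult mult_ac)
qed

lemma nn_integral_homogeneous_ball:
  fixes f :: "'a::euclidean_space \<Rightarrow> ennreal"
  assumes [measurable]: "f \<in> borel_measurable borel"
    and hom: "\<And>c x. c > 0 \<Longrightarrow> f (c *\<^sub>R x) = ennreal (c powr e) * f x"
  shows "(\<integral>\<^sup>+x\<in>ball 0 1. f x \<partial>lborel) =
     (\<Sum>k. ennreal ((2 powr - (e + DIM('a))) ^ k)) * (\<integral>\<^sup>+x\<in>{x. 1/2 \<le> norm x \<and> norm x < 1}. f x \<partial>lborel)"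
proof -
  \<comment> \<open>Half-open dyadic shells are disjoint and exhaust the ball without the origin,
    which is a null set.\<close>
  define A :: "nat \<Rightarrow> 'a set" where "A k = {x. (1/2)^k * (1/2) \<le> norm x \<and> norm x < (1/2)^k * 1}" for k
  have disj: "disjoint_family A"
  unfolding disjoint_family_on_def
  proof (intro ballI impI)
    have *: "A m \<inter> A n = {}" if "m < n" for m n
    proof -
      have "(1/2::real) ^ n \<le> (1/2) ^ Suc m"
        using that by (intro power_decreasing) auto
      then show ?thesis by (auto simp: A_def)
    qed
    show "A m \<inter> A n = {}" if "m \<noteq> n" for m n
      using *[of m n] *[of n m] that by (cases "m < n") auto
  qed
  have un: "(\<Union>k. A k) = ball 0 1 - {0}"
  proof (intro equalityI subsetI)
    fix x assume "x \<in> (\<Union>k. A k)"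
    then obtain k where k: "x \<in> A k" by blast
    have "(0::real) < (1/2)^k * (1/2)" and "(1/2::real)^k \<le> 1" by (simp_all add: power_le_one)
    with k show "x \<in> ball 0 1 - {0}" by (auto simp: A_def simp del: power_one_over zero_less_mult_iff zero_less_power)
  next
    fix x :: 'a assume x: "x \<in> ball 0 1 - {0}"
    then have "\<exists>k. (1/2::real)^k \<le> norm x"
      using real_arch_pow_inv[of "norm x" "1/2"] by (auto intro: less_imp_le)
    \<comment> \<open>The least k with 2^(-k) \<le> |x| is positive because |x| < 1, and x lies in
      the shell of index k - 1.\<close>
    define k where "k = (LEAST k. (1/2::real)^k \<le> norm x)"
    have k: "(1/2::real)^k \<le> norm x"
      unfolding k_def by (rule LeastI_ex) fact
    have "k \<noteq> 0" using k x by (intro notI) simp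
    then obtain j where j: "k = Suc j" by (cases k) auto
    have "\<not> (1/2::real)^j \<le> norm x"
      using not_less_Least[of j "\<lambda>k. (1/2::real)^k \<le> norm x"] j by (simp add: k_def)
    then have "x \<in> A j" using k j by (auto simp: A_def)
    then show "x \<in> (\<Union>k. A k)" by blast
  qed
  have A_sets [measurable]: "A k \<in> sets borel" for k unfolding A_def by measurable
  have "(\<integral>\<^sup>+x\<in>ball 0 1. f x \<partial>lborel) = (\<integral>\<^sup>+x. f x * indicator (ball 0 1 - {0}) x \<partial>lborel)"
    by (rule nn_integral_cong_AE) (use AE_lborel_singleton[of 0] in \<open>auto elim!: eventually_mono simp: indicator_def\<close>)
  also have "\<dots> = (\<integral>\<^sup>+x. (\<Sum>k. f x * indicator (A k) x) \<partial>lborel)"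
    by (rule nn_integral_cong) (simp add: un[symmetric] suminf_indicator[OF disj])
  also have "\<dots> = (\<Sum>k. \<integral>\<^sup>+x. f x * indicator (A k) x \<partial>lborel)"
    by (rule nn_integral_suminf) measurable
  also have "\<dots> = (\<Sum>k. ennreal ((2 powr - (e + DIM('a))) ^ k) * (\<integral>\<^sup>+x\<in>{x. 1/2 \<le> norm x \<and> norm x < 1}. f x \<partial>lborel))"
  proof (rule suminf_cong)
    fix k
    have "((1/2::real)^k) powr (e + DIM('a)) = (2 powr - (e + DIM('a))) ^ k"
    proof -
      have "((1/2::real)^k) powr (e + DIM('a)) = ((1/2) powr (e + DIM('a))) ^ k"
        by (simp add: powr_realpow[symmetric] powr_powr mult.commute)
      also have "(1/2::real) powr z = 2 powr - z" for z
        by (simp add: powr_minus_divide powr_divide)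
      finally show ?thesis .
    qed
    then show "(\<integral>\<^sup>+x. f x * indicator (A k) x \<partial>lborel) =
       ennreal ((2 powr - (e + DIM('a))) ^ k) * (\<integral>\<^sup>+x\<in>{x. 1/2 \<le> norm x \<and> norm x < 1}. f x \<partial>lborel)"
      unfolding A_def by (subst nn_integral_homogeneous_scale[OF assms]) auto
  qed
  finally show ?thesis by simp
qed

text \<open>Consecutive shells differ by the factor 2^(-(e + dim)), so the geometric series
  converges exactly when e + dim > 0.\<close>

lemma nn_integral_homogeneous_ball_finite:
  fixes f :: "'a::euclidean_space \<Rightarrow> ennreal"
  assumes "f \<in> borel_measurable borel"
    and "\<And>c x. c > 0 \<Longrightarrow> f (c *\<^sub>R x) = ennreal (c powr e) * f x"
    and "e + DIM('a) > 0"
    and "(\<integral>\<^sup>+x\<in>{x. 1/2 \<le> norm x \<and> norm x < 1}. f x \<partial>lborel) < \<infinity>"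
  shows "(\<integral>\<^sup>+x\<in>ball 0 r. f x \<partial>lborel) < \<infinity>"
proof (cases "r > 0")
  case True
  have "(2 powr - (e + DIM('a)) :: real) < 1"
    using assms(3) by (simp add: powr_less_one)
  then have "(\<Sum>k. ennreal ((2 powr - (e + DIM('a))) ^ k)) < \<infinity>"
    by (simp add: suminf_ennreal_eq[OF _ summable_sums[OF summable_geometric]])
  then have 1: "(\<integral>\<^sup>+x\<in>ball 0 1. f x \<partial>lborel) < \<infinity>"
    using assms(4) nn_integral_homogeneous_ball[where f = f and e = e, OF assms(1,2)]
    by (auto simp: ennreal_mult_less_top)
  \<comment> \<open>With lower radius 0 the shells of the scaling identity become balls, which
    carries the result from radius 1 to radius r.\<close>
  have b: "{x::'a. norm x < c} = ball 0 c" for c by auto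
  show ?thesis
    using nn_integral_homogeneous_scale[OF assms(1,2) True, of 0 1] 1
    by (simp add: b ennreal_mult_less_top)
qed (simp add: ball_empty)

text \<open>The ratio of the series is now at least 1. Positive mass of a single shell must be
  assumed, since 0 times an infinite sum is 0.\<close>

lemma nn_integral_homogeneous_ball_infinite:
  fixes f :: "'a::euclidean_space \<Rightarrow> ennreal"
  assumes "f \<in> borel_measurable borel"
    and "\<And>c x. c > 0 \<Longrightarrow> f (c *\<^sub>R x) = ennreal (c powr e) * f x"
    and "e + DIM('a) \<le> 0" and "r > 0"
    and "(\<integral>\<^sup>+x\<in>{x. 1/2 \<le> norm x \<and> norm x < 1}. f x \<partial>lborel) \<noteq> 0"
  shows "(\<integral>\<^sup>+x\<in>ball 0 r. f x \<partial>lborel) = \<infinity>"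
proof -
  have ge: "(2 powr - (e + DIM('a)) :: real) \<ge> 1"
    using assms(3) by (intro ge_one_powr_ge_zero) auto
  have "(\<Sum>k. ennreal ((2 powr - (e + DIM('a))) ^ k)) = \<infinity>"
  proof (rule ccontr)
    assume "\<not> ?thesis"
    then have "(\<Sum>k. ennreal ((2 powr - (e + DIM('a))) ^ k)) \<noteq> top" by simp
    then have "summable (\<lambda>k. (2 powr - (e + DIM('a)) :: real) ^ k)"
      by (rule summable_suminf_not_top[rotated]) simp
    then have "norm (2 powr - (e + DIM('a)) :: real) < 1"
      by (rule summable_geometric_iff[THEN iffD1])
    with ge show False by simp
  qed
  then have 1: "(\<integral>\<^sup>+x\<in>ball 0 1. f x \<partial>lborel) = \<infinity>"
    using assms(5) nn_integral_homogeneous_ball[where f = f and e = e, OF assms(1,2)]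
    by (auto simp: ennreal_mult_eq_top_iff)
  have b: "{x::'a. norm x < c} = ball 0 c" for c by auto
  show ?thesis
    using nn_integral_homogeneous_scale[OF assms(1,2,4), of 0 1] 1 assms(4)
    by (simp add: b ennreal_mult_eq_top_iff)
qed

lemma nn_integral_norm_powr_ball:
  fixes a :: real
  assumes "a + DIM('a::euclidean_space) > 0"
  shows "(\<integral>\<^sup>+x\<in>ball (0::'a) r. ennreal (norm x powr a) \<partial>lborel) < \<infinity>"
proof (rule nn_integral_homogeneous_ball_finite[OF _ _ assms])
  show "ennreal (norm (c *\<^sub>R x) powr a) = ennreal (c powr a) * ennreal (norm x powr a)" if "c > 0" for c and x :: 'a
    using that by (simp add: powr_mult ennreal_mult)
  \<comment> \<open>On the shell |x|^a is monotone in |x|; which end of the shell gives the bound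
    depends on the sign of a.\<close>
  define K :: real where "K = max ((1/2) powr a) 1"
  have "norm x powr a \<le> K" if "1/2 \<le> norm x" "norm x < 1" for x :: 'a
  proof (cases "a \<ge> 0")
    case True
    then have "norm x powr a \<le> 1 powr a" using that by (intro powr_mono2) auto
    then show ?thesis by (simp add: K_def)
  next
    case False
    then have "norm x powr a \<le> (1/2) powr a" using that by (intro powr_mono2') auto
    then show ?thesis by (simp add: K_def)
  qed
  then have "(\<integral>\<^sup>+x\<in>{x. 1/2 \<le> norm x \<and> norm x < 1}. ennreal (norm (x::'a) powr a) \<partial>lborel)
     \<le> (\<integral>\<^sup>+x. ennreal K * indicator (cball (0::'a) 1) x \<partial>lborel)"
    by (intro nn_integral_mono) (auto simp: indicator_def intro!: ennreal_leI)
  also have "\<dots> = ennreal K * emeasure lborel (cball (0::'a) 1)"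
    by (subst nn_integral_cmult_indicator) auto
  also have "\<dots> < \<infinity>"
    using emeasure_bounded_finite[OF bounded_cball[of "0::'a" 1]] by (simp add: ennreal_mult_less_top)
  finally show "(\<integral>\<^sup>+x\<in>{x. 1/2 \<le> norm x \<and> norm x < 1}. ennreal (norm (x::'a) powr a) \<partial>lborel) < \<infinity>" .
qed measurable

lemma nn_integral_translate_lborel:
  fixes f :: "'a::euclidean_space \<Rightarrow> ennreal"
  assumes [measurable]: "f \<in> borel_measurable borel"
  shows "(\<integral>\<^sup>+x. f (c + x) \<partial>lborel) = (\<integral>\<^sup>+x. f x \<partial>lborel)"
  by (subst (2) lborel_distr_plus[of c, symmetric]) (simp add: nn_integral_distr)

section \<open>The functions u: homogeneity and a Lipschitz estimate\<close>

lemma u_sol_alt: "u_sol i \<delta> x = norm x powr (-\<delta>) * x $ i"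
proof (cases "x = 0")
  case False
  then have "norm x powr (1 - \<delta>) = norm x * norm x powr (-\<delta>)"
    by (simp add: powr_diff powr_minus field_simps)
  with False show ?thesis by (simp add: u_sol_def)
qed (simp add: u_sol_def)

lemma u_sol_scale: "c > 0 \<Longrightarrow> u_sol i \<delta> (c *\<^sub>R x) = c powr (1 - \<delta>) * u_sol i \<delta> x"
  by (simp add: u_sol_def powr_mult)

lemma borel_measurable_u_sol [measurable]: "u_sol i \<delta> \<in> borel_measurable borel"
proof -
  have [measurable]: "(\<lambda>x. x $ i) \<in> borel_measurable borel"
    by (intro borel_measurable_continuous_onI continuous_intros)
  show ?thesis unfolding u_sol_def[abs_def] by measurable
qed

text \<open>The gradient of u has size at most (1 + \<delta>) |x|^(-\<delta>), but integrating it
  along the segment from x to y is useless when the segment passes near 0. The elementary argument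
  below sees only the longer of the two vectors, so it stays valid when the other one is 0.\<close>

lemma u_sol_diff_le:
  fixes x y :: "real ^ 'n::finite"
  assumes \<delta>: "0 \<le> \<delta>" "\<delta> \<le> 1"
  shows "\<bar>u_sol i \<delta> x - u_sol i \<delta> y\<bar> \<le> (1 + \<delta>) * norm (x - y) * max (norm x) (norm y) powr (-\<delta>)"
proof -
  have *: "\<bar>u_sol i \<delta> x - u_sol i \<delta> y\<bar> \<le> (1 + \<delta>) * norm (x - y) * norm x powr (-\<delta>)"
    if le: "norm y \<le> norm x" for x y :: "real ^ 'n"
  proof (cases "y = 0")
    case True
    have "\<bar>u_sol i \<delta> x\<bar> \<le> norm x * norm x powr (-\<delta>)"
      using component_le_norm_cart[of x i] by (simp add: u_sol_alt abs_mult mult.commute mult_right_mono)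
    also have "\<dots> \<le> (1 + \<delta>) * (norm x * norm x powr (-\<delta>))"
      using mult_right_mono[of 1 "1 + \<delta>" "norm x * norm x powr (-\<delta>)"] \<delta> by simp
    finally show ?thesis using True by (simp add: u_sol_alt mult_ac)
  next
    case False
    then have ny: "norm y > 0" by simp
    with le have nx: "norm x > 0" by linarith
    \<comment> \<open>Bernoulli's inequality r^\<delta> - 1 \<le> \<delta> (r - 1) for r = |x| /
      |y|, as a weighted mean inequality.\<close>
    have "(norm x / norm y) powr \<delta> * 1 powr (1 - \<delta>) \<le> \<delta> * (norm x / norm y) + (1 - \<delta>) * 1"
      using \<delta> nx ny by (intro Youngs_inequality_0) auto
    then have "norm y * norm x powr (-\<delta>) * ((norm x / norm y) powr \<delta> - 1)
      \<le> norm y * norm x powr (-\<delta>) * (\<delta> * (norm x / norm y - 1))"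
      using nx ny by (intro mult_left_mono) (auto simp: algebra_simps)
    also have "\<dots> = \<delta> * (norm x - norm y) * norm x powr (-\<delta>)"
      using ny by (simp add: field_simps)
    finally have 1: "norm y * (norm y powr (-\<delta>) - norm x powr (-\<delta>)) \<le> \<delta> * (norm x - norm y) * norm x powr (-\<delta>)"
      using nx ny by (simp add: powr_divide powr_minus field_simps)
    have mono: "norm x powr (-\<delta>) \<le> norm y powr (-\<delta>)"
      using \<delta> ny le by (intro powr_mono2') auto
    \<comment> \<open>The power is frozen at the longer vector x; the error is a difference of
      powers times a component of the shorter vector y.\<close>
    have "u_sol i \<delta> x - u_sol i \<delta> y = norm x powr (-\<delta>) * (x - y) $ i + y $ i * (norm x powr (-\<delta>) - norm y powr (-\<delta>))"
      by (simp add: u_sol_alt algebra_simps)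
    also have "\<bar>\<dots>\<bar> \<le> norm x powr (-\<delta>) * \<bar>(x - y) $ i\<bar> + \<bar>y $ i\<bar> * (norm y powr (-\<delta>) - norm x powr (-\<delta>))"
      using mono by (intro abs_triangle_ineq[THEN order_trans]) (simp add: abs_mult)
    also have "\<dots> \<le> norm x powr (-\<delta>) * norm (x - y) + norm y * (norm y powr (-\<delta>) - norm x powr (-\<delta>))"
      using mono by (intro add_mono mult_left_mono mult_right_mono component_le_norm_cart) auto
    also have "\<dots> \<le> norm x powr (-\<delta>) * norm (x - y) + \<delta> * norm (x - y) * norm x powr (-\<delta>)"
      using 1 norm_triangle_ineq2[of x y] \<delta>
      by (intro add_left_mono order_trans[OF 1] mult_right_mono mult_left_mono) auto
    finally show ?thesis by (simp add: algebra_simps)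
  qed
  show ?thesis
  proof (cases "norm y \<le> norm x")
    case True
    then show ?thesis using *[of y x] by (simp add: max_def)
  next
    case False
    then show ?thesis using *[of x y] by (simp add: max_def abs_minus_commute norm_minus_commute)
  qed
qed

definition gagliardo :: "'n::finite \<Rightarrow> real \<Rightarrow> real \<Rightarrow> real \<Rightarrow> (real ^ 'n) \<times> (real ^ 'n) \<Rightarrow> ennreal" where
  "gagliardo i \<delta> t q p = ennreal (\<bar>u_sol i \<delta> (fst p) - u_sol i \<delta> (snd p)\<bar> powr q /
         norm (fst p - snd p) powr (real DIM(real ^ 'n) + t * q))"

lemma borel_measurable_gagliardo [measurable]: "gagliardo i \<delta> t q \<in> borel_measurable borel"
proof -
  have [measurable]: "fst \<in> (borel :: ((real ^ 'n) \<times> (real ^ 'n)) measure) \<rightarrow>\<^sub>M borel" "snd \<in> (borel :: ((real ^ 'n) \<times> (real ^ 'n)) measure) \<rightarrow>\<^sub>M borel"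
    by (intro borel_measurable_continuous_onI continuous_intros)+
  show ?thesis unfolding gagliardo_def[abs_def] by measurable
qed

lemma gagliardo_scale:
  fixes p :: "(real ^ 'n::finite) \<times> (real ^ 'n)"
  assumes "c > 0"
  shows "gagliardo i \<delta> t q (c *\<^sub>R p) = ennreal (c powr ((1 - \<delta>) * q - real DIM(real ^ 'n) - t * q)) * gagliardo i \<delta> t q p"
proof -
  obtain x y where p: "p = (x, y)" by (cases p)
  let ?e = "real DIM(real ^ 'n) + t * q"
  have 1: "\<bar>u_sol i \<delta> (c *\<^sub>R x) - u_sol i \<delta> (c *\<^sub>R y)\<bar> = c powr (1 - \<delta>) * \<bar>u_sol i \<delta> x - u_sol i \<delta> y\<bar>"
    using assms by (simp add: u_sol_scale right_diff_distrib[symmetric] abs_mult)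
  have 2: "norm (c *\<^sub>R x - c *\<^sub>R y) = c * norm (x - y)"
    using assms by (simp add: scaleR_right_diff_distrib[symmetric])
  have "gagliardo i \<delta> t q (c *\<^sub>R p) = ennreal ((c powr (1 - \<delta>) * \<bar>u_sol i \<delta> x - u_sol i \<delta> y\<bar>) powr q / (c * norm (x - y)) powr ?e)"
    by (simp only: gagliardo_def p fst_conv snd_conv scaleR_Pair 1 2)
  also have "(c powr (1 - \<delta>) * \<bar>u_sol i \<delta> x - u_sol i \<delta> y\<bar>) powr q / (c * norm (x - y)) powr ?e
     = c powr ((1 - \<delta>) * q - ?e) * (\<bar>u_sol i \<delta> x - u_sol i \<delta> y\<bar> powr q / norm (x - y) powr ?e)"
    using assms by (simp add: powr_mult powr_powr powr_diff del: powr_diff) (simp add: powr_diff)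
  finally show ?thesis
    by (simp only: gagliardo_def p fst_conv snd_conv diff_diff_eq) (rule ennreal_mult, auto)
qed

text \<open>Away from the origin of the product space one of the two points is at distance at least
  1/4 from 0, so u satisfies a Lipschitz bound with a fixed constant. The integrand is then at most
  a constant times |x - y|^(q(1-t)-d), which is locally integrable because t < 1.\<close>

lemma gagliardo_shell_finite:
  fixes i :: "'n::finite"
  assumes \<delta>: "0 \<le> \<delta>" "\<delta> \<le> 1" and t: "t < 1" and q: "q > 1"
  shows "(\<integral>\<^sup>+p\<in>{p. 1/2 \<le> norm p \<and> norm p < 1}. gagliardo i \<delta> t q p \<partial>lborel) < \<infinity>"
proof -
  let ?d = "real DIM(real ^ 'n)"
  let ?b = "q * (1 - t) - ?d"
  \<comment> \<open>The 2 bounds 1 + \<delta>, and the power bounds max (|x|, |y|)^(-\<delta>) for a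
    maximum of at least 1/4.\<close>
  define K :: real where "K = 2 * (1/4) powr (-\<delta>)"
  have K: "K > 0" by (simp add: K_def)
  have le: "gagliardo i \<delta> t q (x, y) \<le> ennreal (K powr q) * ennreal (norm (x - y) powr ?b)"
    if "1/2 \<le> norm (x, y)" for x y :: "real ^ 'n"
  proof (cases "x = y")
    case True then show ?thesis by (simp add: gagliardo_def)
  next
    case False
    have "max (norm x) (norm y) \<ge> 1/4"
      using that norm_Pair_le[of x y] by (auto simp: max_def)
    then have "max (norm x) (norm y) powr (-\<delta>) \<le> (1/4) powr (-\<delta>)"
      using \<delta> by (intro powr_mono2') auto
    then have "(1 + \<delta>) * norm (x - y) * max (norm x) (norm y) powr (-\<delta>) \<le> 2 * norm (x - y) * (1/4) powr (-\<delta>)"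
      using \<delta> by (intro mult_mono) auto
    with u_sol_diff_le[OF \<delta>, of i x y] have "\<bar>u_sol i \<delta> x - u_sol i \<delta> y\<bar> \<le> K * norm (x - y)"
      by (simp add: K_def mult_ac)
    then have "\<bar>u_sol i \<delta> x - u_sol i \<delta> y\<bar> powr q \<le> (K * norm (x - y)) powr q"
      using q by (intro powr_mono2) auto
    then have "\<bar>u_sol i \<delta> x - u_sol i \<delta> y\<bar> powr q / norm (x - y) powr (?d + t * q) \<le>
       (K powr q * norm (x - y) powr q) / norm (x - y) powr (?d + t * q)"
      using K by (intro divide_right_mono) (auto simp: powr_mult)
    also have "\<dots> = K powr q * norm (x - y) powr ?b"
      using False by (simp add: powr_diff powr_add algebra_simps)
    finally show ?thesis
      by (simp add: gagliardo_def ennreal_mult[symmetric])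
  qed
  have [measurable]: "fst \<in> (borel :: ((real ^ 'n) \<times> (real ^ 'n)) measure) \<rightarrow>\<^sub>M borel" "snd \<in> (borel :: ((real ^ 'n) \<times> (real ^ 'n)) measure) \<rightarrow>\<^sub>M borel"
    by (intro borel_measurable_continuous_onI continuous_intros)+
  \<comment> \<open>For |p| < 1 both |x| < 1 and |y - x| < 2 hold; on this larger set the double
    integral factorises after a translation in y.\<close>
  define G :: "real ^ 'n \<Rightarrow> ennreal" where "G z = ennreal (norm z powr ?b) * indicator (ball 0 2) z" for z
  have [measurable]: "ball (0::real ^ 'n) r \<in> sets borel" for r by simp
  have [measurable]: "G \<in> borel_measurable borel" unfolding G_def[abs_def] by measurable
  define W where "W p = ennreal (norm (snd p - fst p) powr ?b) * indicator (ball 0 2) (snd p - fst p) * indicator (ball 0 1) (fst p)"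
    for p :: "(real ^ 'n) \<times> (real ^ 'n)"
  have W_meas: "W \<in> borel_measurable borel"
  proof -
    have [measurable]: "(\<lambda>p. snd p - fst p) \<in> (borel :: ((real ^ 'n) \<times> (real ^ 'n)) measure) \<rightarrow>\<^sub>M borel"
      by (intro borel_measurable_continuous_onI continuous_intros)
    have "W = (\<lambda>p. G (snd p - fst p) * indicator (ball 0 1) (fst p))"
      by (simp add: W_def G_def fun_eq_iff)
    then show ?thesis by simp
  qed
  have "(\<integral>\<^sup>+p\<in>{p. 1/2 \<le> norm p \<and> norm p < 1}. gagliardo i \<delta> t q p \<partial>lborel)
     \<le> (\<integral>\<^sup>+p. ennreal (K powr q) * (ennreal (norm (snd p - fst p) powr ?b) * indicator (ball 0 2) (snd p - fst p) * indicator (ball 0 1) (fst p)) \<partial>(lborel :: ((real ^ 'n) \<times> (real ^ 'n)) measure))"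
  proof (rule nn_integral_mono)
    fix p :: "(real ^ 'n) \<times> (real ^ 'n)"
    show "gagliardo i \<delta> t q p * indicator {p. 1/2 \<le> norm p \<and> norm p < 1} p \<le>
      ennreal (K powr q) * (ennreal (norm (snd p - fst p) powr ?b) * indicator (ball 0 2) (snd p - fst p) * indicator (ball 0 1) (fst p))"
    proof (cases "1/2 \<le> norm p \<and> norm p < 1")
      case True
      have "norm (fst p) \<le> norm p" "norm (snd p) \<le> norm p"
        using norm_fst_le[of "fst p" "snd p"] norm_snd_le[of "snd p" "fst p"] by simp_all
      then have "fst p \<in> ball 0 1" "snd p - fst p \<in> ball 0 2"
        using True norm_triangle_ineq4[of "snd p" "fst p"] by auto
      with True le[of "fst p" "snd p"] show ?thesis
        by (simp add: norm_minus_commute)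
    qed simp
  qed
  also have "\<dots> = ennreal (K powr q) * (\<integral>\<^sup>+p. W p \<partial>lborel)"
    unfolding W_def[symmetric] by (rule nn_integral_cmult) (simp add: W_meas)
  also have "(\<integral>\<^sup>+p. W p \<partial>lborel) = (\<integral>\<^sup>+x. (\<integral>\<^sup>+y. W (x, y) \<partial>lborel) \<partial>lborel)"
    by (subst lborel_prod[symmetric], subst lborel.nn_integral_fst[symmetric]) (simp_all add: lborel_prod W_meas)
  also have "\<dots> = (\<integral>\<^sup>+x. (\<integral>\<^sup>+y. G y * indicator (ball 0 1) x \<partial>lborel) \<partial>(lborel :: (real ^ 'n) measure))"
  proof (rule nn_integral_cong)
    fix x :: "real ^ 'n"
    show "(\<integral>\<^sup>+y. W (x, y) \<partial>lborel) = (\<integral>\<^sup>+y. G y * indicator (ball 0 1) x \<partial>lborel)"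
      using nn_integral_translate_lborel[of "\<lambda>y. G y * indicator (ball 0 1) x" "- x"]
      by (simp add: W_def G_def)
  qed
  also have "\<dots> = (\<integral>\<^sup>+y\<in>ball (0::real ^ 'n) 2. ennreal (norm y powr ?b) \<partial>lborel) * emeasure lborel (ball (0::real ^ 'n) 1)"
    unfolding G_def[symmetric] by (simp add: nn_integral_multc nn_integral_cmult)
  also have "ennreal (K powr q) * \<dots> < \<infinity>"
  proof -
    have "?b + DIM(real ^ 'n) > 0" using t q by simp
    from nn_integral_norm_powr_ball[OF this, of 2] emeasure_bounded_finite[OF bounded_ball[of "0::real ^ 'n" 1]]
    show ?thesis by (simp add: ennreal_mult_less_top)
  qed
  finally show ?thesis .
qed

text \<open>Where the i-th coordinates of x and y have opposite signs, so do the values of u, and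
  the integrand is positive. This is a nonempty open condition, hence of positive measure.\<close>

lemma gagliardo_shell_nonzero:
  fixes i :: "'n::finite"
  shows "(\<integral>\<^sup>+p\<in>{p. 1/2 \<le> norm p \<and> norm p < 1}. gagliardo i \<delta> t q p \<partial>lborel) \<noteq> 0"
proof
  assume 0: "(\<integral>\<^sup>+p\<in>{p. 1/2 \<le> norm p \<and> norm p < 1}. gagliardo i \<delta> t q p \<partial>lborel) = 0"
  define S :: "((real ^ 'n) \<times> (real ^ 'n)) set" where
    "S = {p. 1/2 < norm p \<and> norm p < 1 \<and> fst p $ i > 0 \<and> snd p $ i < 0}"
  have S_open: "open S"
    unfolding S_def by (intro open_Collect_conj open_Collect_less continuous_intros)
  have "AE p in lborel. gagliardo i \<delta> t q p * indicator {p. 1/2 \<le> norm p \<and> norm p < 1} p = 0"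
    using 0 by (subst (asm) nn_integral_0_iff_AE) measurable
  then have "AE p in lborel. p \<notin> S"
  proof (rule eventually_mono)
    fix p :: "(real ^ 'n) \<times> (real ^ 'n)"
    assume p: "gagliardo i \<delta> t q p * indicator {p. 1/2 \<le> norm p \<and> norm p < 1} p = 0"
    show "p \<notin> S"
    proof
      assume S: "p \<in> S"
      then have "fst p \<noteq> 0" "snd p \<noteq> 0" by (auto simp: S_def)
      then have "norm (fst p) powr (-\<delta>) > 0" "norm (snd p) powr (-\<delta>) > 0" by auto
      moreover have "fst p $ i > 0" "snd p $ i < 0" using S by (auto simp: S_def)
      ultimately have "u_sol i \<delta> (fst p) > 0" "u_sol i \<delta> (snd p) < 0"
        by (simp_all add: u_sol_alt mult_pos_neg)
      moreover have "fst p \<noteq> snd p" using S by (auto simp: S_def)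
      ultimately have "gagliardo i \<delta> t q p > 0"
        by (simp add: gagliardo_def)
      with p S show False by (auto simp: S_def)
    qed
  qed
  then have "S \<in> null_sets lborel"
    using AE_iff_null_sets[of S lborel] S_open by simp
  moreover note S_open
  \<comment> \<open>The pair of half the i-th unit vector and its negative has norm 1 / sqrt 2,
    strictly between 1/2 and 1.\<close>
  moreover have "(\<chi> j. if j = i then 1/2 else 0, \<chi> j. if j = i then -1/2 else 0) \<in> S"
  proof -
    have "(\<chi> j. if j = i then c else 0) = c *\<^sub>R axis i (1::real)" for c :: real
      by (simp add: vec_eq_iff axis_def)
    then have "norm (\<chi> j. if j = i then c else 0) = \<bar>c\<bar>" for c :: real
      by (simp only: norm_scaleR norm_axis_1 mult_1_right)
    moreover have "sqrt 2 < (2::real)" by (rule real_less_lsqrt) auto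
    ultimately show ?thesis
      by (simp add: S_def norm_Pair power_divide real_sqrt_divide)
  qed
  ultimately show False
    using open_not_negligible[of S] by (auto simp: negligible_iff_null_sets null_sets_completionI)
qed

text \<open>Only the seminorm decides, as |u| \<le> 1 on the unit ball. For necessity a single set
  suffices, the ball of radius 1/2; for sufficiency every admissible V satisfies that V \<times> V
  lies in the ball of radius 2 of the product space.\<close>

theorem u_sol_frac_sobolev_loc_iff:
  fixes i :: "'n::finite"
  assumes \<delta>: "0 \<le> \<delta>" "\<delta> \<le> 1" and t: "0 < t" "t < 1" and q: "q > 1"
  shows "u_sol i \<delta> \<in> frac_sobolev_loc t q (ball 0 1) \<longleftrightarrow> 1 - \<delta> > t - real CARD('n) / q"
proof -
  let ?e = "(1 - \<delta>) * q - real DIM(real ^ 'n) - t * q"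
  \<comment> \<open>The degree plus the dimension 2d is (1-\<delta>) q - t q + d; dividing by q
    gives the threshold.\<close>
  have e: "?e + real DIM((real ^ 'n) \<times> (real ^ 'n)) > 0 \<longleftrightarrow> 1 - \<delta> > t - real CARD('n) / q"
    using q by (simp add: field_simps)
  have seminorm: "(\<integral>\<^sup>+p\<in>V \<times> V. ennreal (\<bar>u_sol i \<delta> (fst p) - u_sol i \<delta> (snd p)\<bar> powr q /
         norm (fst p - snd p) powr (real DIM(real ^ 'n) + t * q)) \<partial>lebesgue) = (\<integral>\<^sup>+p\<in>V \<times> V. gagliardo i \<delta> t q p \<partial>lborel)"
    if "open V" for V :: "(real ^ 'n) set"
  proof -
    have [measurable]: "V \<times> V \<in> sets borel" using that by (intro borel_open open_Times)
    show ?thesis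
      unfolding gagliardo_def[symmetric] by (rule nn_integral_completion) measurable
  qed
  show ?thesis
  proof
    assume "u_sol i \<delta> \<in> frac_sobolev_loc t q (ball 0 1)"
    moreover have "closure (ball 0 (1/2)) \<subseteq> (ball 0 1 :: (real ^ 'n) set)" by auto
    ultimately have "u_sol i \<delta> \<in> frac_sobolev t q (ball 0 (1/2))"
      unfolding frac_sobolev_loc_def by (auto simp: compact_closure)
    then have fin: "(\<integral>\<^sup>+p\<in>ball 0 (1/2) \<times> ball 0 (1/2). gagliardo i \<delta> t q p \<partial>lborel) < \<infinity>"
      unfolding frac_sobolev_def seminorm[OF open_ball] mem_Collect_eq by blast
    show "1 - \<delta> > t - real CARD('n) / q"
    proof (rule ccontr)
      assume "\<not> ?thesis"
      then have "?e + real DIM((real ^ 'n) \<times> (real ^ 'n)) \<le> 0" using e by linarith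
      from nn_integral_homogeneous_ball_infinite[OF borel_measurable_gagliardo gagliardo_scale this _ gagliardo_shell_nonzero, of "1/2"]
      have "(\<integral>\<^sup>+p\<in>ball 0 (1/2). gagliardo i \<delta> t q p \<partial>lborel) = \<infinity>" by simp
      \<comment> \<open>A ball of the product space is contained in the product of two balls of the
        same radius, so divergence passes to the latter.\<close>
      moreover have "(\<integral>\<^sup>+p\<in>ball 0 (1/2). gagliardo i \<delta> t q p \<partial>lborel)
          \<le> (\<integral>\<^sup>+p\<in>ball 0 (1/2) \<times> ball 0 (1/2). gagliardo i \<delta> t q p \<partial>lborel)"
      proof (intro nn_integral_mono mult_left_mono)
        fix p :: "(real ^ 'n) \<times> (real ^ 'n)"
        have "norm (fst p) \<le> norm p" "norm (snd p) \<le> norm p"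
          using norm_fst_le[of "fst p" "snd p"] norm_snd_le[of "snd p" "fst p"] by simp_all
        then show "(indicator (ball 0 (1/2)) p :: ennreal) \<le> indicator (ball 0 (1/2) \<times> ball 0 (1/2)) p"
          by (cases p) (auto simp: indicator_def)
      qed simp
      ultimately show False using fin by (simp add: top_unique)
    qed
  next
    assume "1 - \<delta> > t - real CARD('n) / q"
    then have epos: "?e + real DIM((real ^ 'n) \<times> (real ^ 'n)) > 0" using e by blast
    show "u_sol i \<delta> \<in> frac_sobolev_loc t q (ball 0 1)"
      unfolding frac_sobolev_loc_def
    proof (intro CollectI allI impI)
      fix V :: "(real ^ 'n) set"
      assume V: "open V \<and> compact (closure V) \<and> closure V \<subseteq> ball 0 1"
      then have V1: "V \<subseteq> ball 0 1" using closure_subset by blast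
      have [measurable]: "V \<in> sets borel" using V by auto
      have "u_sol i \<delta> \<in> borel_measurable (lebesgue_on V)"
        by (intro measurable_restrict_space1 measurable_completion) simp
      moreover have "(\<integral>\<^sup>+x\<in>V. ennreal (\<bar>u_sol i \<delta> x\<bar> powr q) \<partial>lebesgue) < \<infinity>"
      proof -
        have "(\<integral>\<^sup>+x\<in>V. ennreal (\<bar>u_sol i \<delta> x\<bar> powr q) \<partial>lebesgue) \<le> (\<integral>\<^sup>+x. indicator (ball 0 1) x \<partial>(lebesgue :: (real ^ 'n) measure))"
        proof (rule nn_integral_mono)
          fix x :: "real ^ 'n"
          have "\<bar>u_sol i \<delta> x\<bar> powr q \<le> 1" if "norm x < 1"
          proof -
            have "\<bar>u_sol i \<delta> x\<bar> \<le> (1 + \<delta> * 0) * norm x powr (1 - \<delta>) * 1"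
              unfolding u_sol_def abs_mult using component_le_norm_cart[of x i]
              by (auto intro!: mult_mono simp: divide_le_eq)
            also have "\<dots> \<le> 1"
              using that \<delta> by (auto intro!: powr_le1)
            finally show ?thesis using q by (intro powr_le1) auto
          qed
          then show "ennreal (\<bar>u_sol i \<delta> x\<bar> powr q) * indicator V x \<le> indicator (ball 0 1) x"
            using V1 by (auto simp: indicator_def)
        qed
        also have "\<dots> < \<infinity>"
          using emeasure_bounded_finite[OF bounded_ball[of "0::real ^ 'n" 1]] by simp
        finally show ?thesis .
      qed
      moreover have "(\<integral>\<^sup>+p\<in>V \<times> V. gagliardo i \<delta> t q p \<partial>lborel) < \<infinity>"
      proof -
        have "(\<integral>\<^sup>+p\<in>V \<times> V. gagliardo i \<delta> t q p \<partial>lborel) \<le> (\<integral>\<^sup>+p\<in>ball 0 2. gagliardo i \<delta> t q p \<partial>lborel)"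
        proof (intro nn_integral_mono mult_left_mono)
          fix p :: "(real ^ 'n) \<times> (real ^ 'n)"
          have "norm p < 2" if "p \<in> V \<times> V"
          proof -
            have "fst p \<in> ball 0 1" "snd p \<in> ball 0 1" using that V1 by auto
            then show ?thesis using norm_Pair_le[of "fst p" "snd p"] by simp
          qed
          then show "(indicator (V \<times> V) p :: ennreal) \<le> indicator (ball 0 2) p"
            by (auto simp: indicator_def)
        qed simp
        also have "\<dots> < \<infinity>"
          by (rule nn_integral_homogeneous_ball_finite[OF borel_measurable_gagliardo gagliardo_scale epos
               gagliardo_shell_finite[OF \<delta> t(2) q]])
        finally show ?thesis .
      qed
      ultimately show "u_sol i \<delta> \<in> frac_sobolev t q V"
        using V by (simp add: frac_sobolev_def seminorm[symmetric])
    qed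
  qed
qed

subsection \<open>Ellipticity and logarithm of the coefficient\<close>

definition rank_one :: "real ^ 'n \<Rightarrow> real ^ 'n ^ 'n" where
  "rank_one v = (\<chi> i j. v $ i * v $ j)"

lemma rank_one_mult_vec: "rank_one v *v w = (v \<bullet> w) *\<^sub>R v"
  by (simp add: rank_one_def vec_eq_iff matrix_vector_mult_def inner_vec_def sum_distrib_right mult.assoc)
    (simp add: mult.commute mult.left_commute)

lemma transpose_rank_one: "transpose (rank_one v) = rank_one v"
  by (simp add: rank_one_def transpose_def vec_eq_iff mult.commute)

lemma scaleR_matrix_mult_vec: "(c *\<^sub>R A) *v v = c *\<^sub>R ((A :: real ^ 'n ^ 'm) *v v)"
  by (simp add: scaleR_matrix_vector_assoc)

lemma transpose_add: "transpose (A + B) = transpose A + transpose (B :: real ^ 'n ^ 'm)"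
  and transpose_scaleR: "transpose (c *\<^sub>R A) = c *\<^sub>R transpose (A :: real ^ 'n ^ 'm)"
  by (simp_all add: transpose_def vec_eq_iff)

lemma A_coeff_eq: "A_coeff s \<epsilon> x = (1 - (1 + 2 * s) / 2 * \<epsilon>) *\<^sub>R mat 1 +
     ((real CARD('n) + 2 * s) / 2 * \<epsilon>) *\<^sub>R rank_one (sgn (x :: real ^ 'n))"
  by (simp add: A_coeff_def rank_one_def)

lemma A_coeff_mult_vec: "A_coeff s \<epsilon> x *v v = (1 - (1 + 2 * s) / 2 * \<epsilon>) *\<^sub>R v +
     ((real CARD('n) + 2 * s) / 2 * \<epsilon> * (sgn x \<bullet> v)) *\<^sub>R sgn (x :: real ^ 'n)"
  by (simp add: A_coeff_eq matrix_vector_mult_add_rdistrib scaleR_matrix_mult_vec rank_one_mult_vec)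

lemma A_coeff_quadratic_form: "(A_coeff s \<epsilon> x *v v) \<bullet> v = (1 - (1 + 2 * s) / 2 * \<epsilon>) * (v \<bullet> v) +
     (real CARD('n) + 2 * s) / 2 * \<epsilon> * (sgn (x :: real ^ 'n) \<bullet> v)\<^sup>2"
  by (simp add: A_coeff_mult_vec inner_add_left power2_eq_square)

lemma A_coeff_quadratic_form_bounds:
  fixes x v :: "real ^ 'n::finite"
  assumes "0 < s" "0 \<le> \<epsilon>"
  shows "(1 - (1 + 2 * s) / 2 * \<epsilon>) * (norm v)\<^sup>2 \<le> (A_coeff s \<epsilon> x *v v) \<bullet> v"
    and "(A_coeff s \<epsilon> x *v v) \<bullet> v \<le> (1 + (real CARD('n) - 1) / 2 * \<epsilon>) * (norm v)\<^sup>2"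
proof -
  let ?b = "(real CARD('n) + 2 * s) / 2 * \<epsilon>"
  have b: "?b \<ge> 0" using assms by simp
  have "\<bar>sgn x \<bullet> v\<bar> \<le> norm (sgn x) * norm v" by (rule Cauchy_Schwarz_ineq2)
  \<comment> \<open>\<open>norm (sgn x)\<close> is 0 or 1, so the point x = 0 is covered as
    well.\<close>
  also have "\<dots> \<le> 1 * norm v" by (intro mult_right_mono) (auto simp: norm_sgn)
  finally have "(sgn x \<bullet> v)\<^sup>2 \<le> (norm v)\<^sup>2" by (simp add: abs_le_square_iff[symmetric])
  from mult_left_mono[OF this b] mult_nonneg_nonneg[OF b zero_le_power2[of "sgn x \<bullet> v"]] show
    "(1 - (1 + 2 * s) / 2 * \<epsilon>) * (norm v)\<^sup>2 \<le> (A_coeff s \<epsilon> x *v v) \<bullet> v"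
    "(A_coeff s \<epsilon> x *v v) \<bullet> v \<le> (1 + (real CARD('n) - 1) / 2 * \<epsilon>) * (norm v)\<^sup>2"
    unfolding A_coeff_quadratic_form by (simp_all add: power2_norm_eq_inner algebra_simps diff_divide_distrib add_divide_distrib)
qed

lemma uniformly_elliptic_A_coeff:
  assumes "0 < s" "0 \<le> \<epsilon>" "(1 + 2 * s) / 2 * \<epsilon> < 1"
  shows "uniformly_elliptic_on S (A_coeff s \<epsilon> :: real ^ 'n \<Rightarrow> real ^ 'n ^ 'n::finite)"
  unfolding uniformly_elliptic_on_def
proof (intro exI conjI ballI allI)
  show "0 < 1 - (1 + 2 * s) / 2 * \<epsilon>" using assms by simp
  have "real CARD('n) \<ge> 1" by (simp add: Suc_leI)
  then have "0 \<le> (real CARD('n) - 1) / 2 * \<epsilon>" "0 \<le> (1 + 2 * s) / 2 * \<epsilon>" using assms by auto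
  then show "1 - (1 + 2 * s) / 2 * \<epsilon> \<le> 1 + (real CARD('n) - 1) / 2 * \<epsilon>"
    by linarith
  show "transpose (A_coeff s \<epsilon> x) = A_coeff s \<epsilon> x" for x :: "real ^ 'n"
    by (simp add: A_coeff_eq transpose_add transpose_scaleR transpose_rank_one)
qed (use A_coeff_quadratic_form_bounds assms in auto)

lemma eigenvalues_A_coeff:
  assumes "0 < s" "0 \<le> \<epsilon>"
  shows "eigenvalues (A_coeff s \<epsilon> (x :: real ^ 'n)) \<subseteq>
    {1 - (1 + 2 * s) / 2 * \<epsilon> .. 1 + (real CARD('n::finite) - 1) / 2 * \<epsilon>}"
proof
  fix l assume "l \<in> eigenvalues (A_coeff s \<epsilon> x)"
  then obtain v where v: "v \<noteq> 0" "A_coeff s \<epsilon> x *v v = l *\<^sub>R v"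
    by (auto simp: eigenvalues_def)
  have "(1 - (1 + 2 * s) / 2 * \<epsilon>) * (norm v)\<^sup>2 \<le> l * (norm v)\<^sup>2"
    "l * (norm v)\<^sup>2 \<le> (1 + (real CARD('n) - 1) / 2 * \<epsilon>) * (norm v)\<^sup>2"
    using A_coeff_quadratic_form_bounds[OF assms, where x = x and v = v] v(2) by (simp_all add: power2_norm_eq_inner)
  moreover have "(norm v)\<^sup>2 > 0" using v by simp
  ultimately show "l \<in> {1 - (1 + 2 * s) / 2 * \<epsilon> .. 1 + (real CARD('n) - 1) / 2 * \<epsilon>}"
    by (simp add: mult_le_cancel_right del: zero_less_power2)
qed

text \<open>Maximise the quadratic form of L over the unit sphere of S. At a maximiser w the
  residual r = l w - L w lies in S again, so the first variation in the direction r must vanish, and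
  that variation is a multiple of r . r.\<close>

lemma symmetric_eigenvector_in_invariant_subspace:
  fixes L :: "real ^ 'n ^ 'n"
  assumes L: "transpose L = L" and S: "subspace S" "S \<noteq> {0}" and inv: "\<And>v. v \<in> S \<Longrightarrow> L *v v \<in> S"
  obtains l w where "w \<in> S" "w \<noteq> 0" "L *v w = l *\<^sub>R w"
proof -
  have sym: "(L *v v) \<bullet> w = v \<bullet> (L *v w)" for v w
    using dot_lmul_matrix[of v L w] L by (metis transpose_matrix_vector)
  let ?f = "\<lambda>v. (L *v v) \<bullet> v"
  let ?K = "S \<inter> sphere 0 1"
  from S obtain v where v: "v \<in> S" "v \<noteq> 0" using subspace_0 by blast
  then have "(1 / norm v) *\<^sub>R v \<in> ?K" using S by (simp add: subspace_scale)
  then have "?K \<noteq> {}" by blast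
  moreover have "compact ?K"
    using closed_subspace[OF S(1)] by (simp add: closed_Int_compact)
  moreover have "continuous_on ?K ?f"
    by (intro continuous_intros linear_continuous_on matrix_vector_mul_bounded_linear)
  ultimately obtain w where w: "w \<in> ?K" and max: "\<And>v. v \<in> ?K \<Longrightarrow> ?f v \<le> ?f w"
    using continuous_attains_sup[of ?K ?f] by blast
  define l where "l = ?f w"
  have le: "?f v \<le> l * (v \<bullet> v)" if "v \<in> S" for v
  proof (cases "v = 0")
    case False
    have "(1 / norm v) *\<^sub>R v \<in> ?K" using S that False by (simp add: subspace_scale)
    from max[OF this] have "?f v / (norm v)\<^sup>2 \<le> l"
      by (simp add: l_def matrix_vector_mult_scaleR power2_eq_square)
    then show ?thesis using False by (simp add: divide_le_eq power2_norm_eq_inner)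
  qed simp
  define r where "r = l *\<^sub>R w - L *v w"
  have wS: "w \<in> S" and ww: "w \<bullet> w = 1" using w by (auto simp: dot_square_norm)
  have rS: "r \<in> S" unfolding r_def using S inv wS by (intro subspace_diff subspace_scale)
  define c where "c = l * (r \<bullet> r) - ?f r"
  \<comment> \<open>The form l (v . v) - (L v) . v is nonnegative on S and vanishes at w; this is
    its expansion at w + t r.\<close>
  have key: "0 \<le> 2 * t * (r \<bullet> r) + t\<^sup>2 * c" for t
  proof -
    have "w + t *\<^sub>R r \<in> S" using S wS rS by (intro subspace_add subspace_scale)
    from le[OF this] have "0 \<le> l * ((w + t *\<^sub>R r) \<bullet> (w + t *\<^sub>R r)) - ?f (w + t *\<^sub>R r)" by simp
    also have "\<dots> = (l * (w \<bullet> w) - ?f w) + 2 * t * (l * (w \<bullet> r) - (L *v w) \<bullet> r) + t\<^sup>2 * c"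
      using sym[of r w]
      by (simp add: c_def matrix_vector_right_distrib matrix_vector_mult_scaleR inner_simps
          inner_commute algebra_simps power2_eq_square)
    also have "l * (w \<bullet> r) - (L *v w) \<bullet> r = r \<bullet> r" by (simp add: r_def inner_simps algebra_simps)
    also have "l * (w \<bullet> w) - ?f w = 0" by (simp add: ww l_def)
    finally show ?thesis by simp
  qed
  have "r \<bullet> r = 0"
  proof (rule ccontr)
    assume "r \<bullet> r \<noteq> 0"
    then have p: "r \<bullet> r > 0" by simp
    \<comment> \<open>A negative t this small gives |t c| \<le> r . r, so the linear term 2 t (r .
      r) wins over the quadratic one and the expansion becomes negative.\<close>
    define t where "t = - (r \<bullet> r) / (\<bar>c\<bar> + 1)"
    have t: "t < 0" using p by (simp add: t_def divide_neg_pos)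
    have "t * (2 * (r \<bullet> r) + t * c) \<ge> 0" using key[of t] by (simp add: power2_eq_square algebra_simps)
    then have "2 * (r \<bullet> r) + t * c \<le> 0" using t by (simp add: zero_le_mult_iff)
    moreover have "\<bar>t * c\<bar> \<le> r \<bullet> r"
    proof -
      have "\<bar>t * c\<bar> = (r \<bullet> r) * (\<bar>c\<bar> / (\<bar>c\<bar> + 1))" using p by (simp add: t_def abs_mult)
      also have "\<dots> \<le> (r \<bullet> r) * 1" using p by (intro mult_left_mono) auto
      finally show ?thesis by simp
    qed
    ultimately show False using p by linarith
  qed
  then have "L *v w = l *\<^sub>R w" by (simp add: r_def)
  moreover have "w \<noteq> 0" using ww by auto
  ultimately show ?thesis using that wS by blast
qed

text \<open>The span of the eigenvectors is invariant, hence by symmetry so is its orthogonal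
  complement. A nonzero complement would contain an eigenvector, which would be orthogonal to
  itself.\<close>

lemma span_eigenvectors_symmetric:
  fixes L :: "real ^ 'n ^ 'n"
  assumes L: "transpose L = L"
  shows "span {w. \<exists>l. L *v w = l *\<^sub>R w} = UNIV"
proof (rule ccontr)
  let ?E = "{w. \<exists>l. L *v w = l *\<^sub>R w}"
  let ?S = "{v. \<forall>w\<in>span ?E. orthogonal w v}"
  assume ne: "span ?E \<noteq> UNIV"
  then have "span ?E \<subset> UNIV" by blast
  then obtain a where a: "a \<noteq> 0" "\<And>x. x \<in> span ?E \<Longrightarrow> a \<bullet> x = 0"
    using orthogonal_to_subspace_exists_gen[of ?E UNIV] by (auto simp: orthogonal_def)
  have sym: "(L *v v) \<bullet> w = v \<bullet> (L *v w)" for v w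
    using dot_lmul_matrix[of v L w] L by (metis transpose_matrix_vector)
  have invE: "L *v w \<in> span ?E" if "w \<in> span ?E" for w
    using that
  proof (induction rule: span_induct_alt)
    case base show ?case by (simp add: span_zero)
  next
    case (step c x y)
    then obtain l where "L *v x = l *\<^sub>R x" by blast
    then have "L *v (c *\<^sub>R x + y) = (c * l) *\<^sub>R x + L *v y"
      by (simp add: matrix_vector_right_distrib matrix_vector_mult_scaleR)
    moreover have "x \<in> span ?E" using step by (intro span_base) simp
    ultimately show ?case using step by (simp add: span_add span_scale)
  qed
  obtain l w where w: "w \<in> ?S" "w \<noteq> 0" "L *v w = l *\<^sub>R w"
  proof (rule symmetric_eigenvector_in_invariant_subspace[OF L, of ?S])
    show "subspace ?S" by (rule subspace_orthogonal_to_vectors)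
    show "?S \<noteq> {0}" using a by (auto simp: orthogonal_def inner_commute)
    show "L *v v \<in> ?S" if "v \<in> ?S" for v
      using that invE by (simp add: orthogonal_def sym[symmetric])
  qed blast
  then have "w \<in> span ?E" by (auto intro: span_base)
  with w show False by (auto simp: orthogonal_def)
qed

text \<open>The norm of the type need not satisfy norm (A ** B) \<le> norm A * norm B. As the
  product is bilinear in finite dimension, the inequality holds with some factor K, and the
  exponential series of norm M * K dominates.\<close>

lemma summable_matrix_exp: "summable (\<lambda>k. (1 / fact k) *\<^sub>R matrix_power (M :: real ^ 'n ^ 'n) k)"
proof -
  have bil: "bilinear ((**) :: real ^ 'n ^ 'n \<Rightarrow> real ^ 'n ^ 'n \<Rightarrow> real ^ 'n ^ 'n)"
  proof -
    have "A ** (B + C) = A ** B + A ** C" "(A + B) ** C = A ** C + B ** C"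
      "A ** (c *\<^sub>R B) = c *\<^sub>R (A ** B)" "(c *\<^sub>R A) ** B = c *\<^sub>R (A ** B)"
      for A B C :: "real ^ 'n ^ 'n" and c :: real
      by (simp_all add: matrix_matrix_mult_def vec_eq_iff sum.distrib distrib_left distrib_right
          sum_distrib_left mult.assoc mult.left_commute)
    then show ?thesis by (simp add: bilinear_def linear_iff)
  qed
  have "\<exists>K>0. \<forall>(A :: real ^ 'n ^ 'n) B :: real ^ 'n ^ 'n. norm (A ** B) \<le> norm A * norm B * K"
    by (rule bounded_bilinear.pos_bounded[OF bilinear_conv_bounded_bilinear[THEN iffD1, OF bil]])
  then obtain K where "K > 0 \<and> (\<forall>(A :: real ^ 'n ^ 'n) B :: real ^ 'n ^ 'n. norm (A ** B) \<le> norm A * norm B * K)"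
    by (rule exE)
  then have K: "K > 0" "norm (A ** B) \<le> norm A * norm B * K" for A B :: "real ^ 'n ^ 'n"
    by simp_all
  have bound: "norm (matrix_power M k) \<le> norm (mat 1 :: real ^ 'n ^ 'n) * (norm M * K) ^ k" for k
  proof (induction k)
    case (Suc k)
    have "norm (matrix_power M (Suc k)) \<le> norm M * norm (matrix_power M k) * K" using K by simp
    also have "\<dots> \<le> norm M * (norm (mat 1 :: real ^ 'n ^ 'n) * (norm M * K) ^ k) * K"
      using K Suc by (intro mult_right_mono mult_left_mono) auto
    finally show ?case by (simp add: mult_ac)
  qed simp
  show ?thesis
  proof (rule summable_comparison_test')
    show "summable (\<lambda>k. norm (mat 1 :: real ^ 'n ^ 'n) * (inverse (fact k) * (norm M * K) ^ k))"
      by (intro summable_mult summable_exp)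
    show "norm ((1 / fact k) *\<^sub>R matrix_power M k) \<le> norm (mat 1 :: real ^ 'n ^ 'n) * (inverse (fact k) * (norm M * K) ^ k)"
      if "k \<ge> 0" for k
      using mult_left_mono[OF bound[of k], of "inverse (fact k)"] by (simp add: field_simps)
  qed
qed

lemma matrix_exp_mult_vec:
  fixes M :: "real ^ 'n ^ 'n"
  shows "(\<lambda>k. (1 / fact k) *\<^sub>R (matrix_power M k *v v)) sums (matrix_exp M *v v)"
proof -
  have "bounded_linear (\<lambda>A :: real ^ 'n ^ 'n. A *v v)"
    by (simp add: linear_conv_bounded_linear[symmetric] linear_iff matrix_vector_mult_add_rdistrib scaleR_matrix_mult_vec)
  from bounded_linear.sums[OF this summable_sums[OF summable_matrix_exp[of M]]]
  show ?thesis by (simp add: matrix_exp_def scaleR_matrix_mult_vec)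
qed

lemma matrix_exp_eigenvector:
  assumes "L *v w = l *\<^sub>R w"
  shows "matrix_exp L *v w = exp l *\<^sub>R w"
proof -
  have "matrix_power L k *v w = l ^ k *\<^sub>R w" for k
    by (induction k) (simp_all add: matrix_vector_mul_assoc[symmetric] matrix_vector_mult_scaleR assms mult.commute)
  then have "(\<lambda>k. (l ^ k /\<^sub>R fact k) *\<^sub>R w) sums (matrix_exp L *v w)"
    using matrix_exp_mult_vec[of L w] by (simp add: divide_inverse mult.commute)
  moreover have "(\<lambda>k. (l ^ k /\<^sub>R fact k) *\<^sub>R w) sums (exp l *\<^sub>R w)"
    by (rule sums_scaleR_left[OF exp_converges])
  ultimately show ?thesis by (rule sums_unique2)
qed

text \<open>For a unit vector \<open>e\<close>: eigenvalue \<open>q\<close> along \<open>e\<close>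
  and eigenvalue \<open>p\<close> on the orthogonal complement of \<open>e\<close>. The coefficient
  has this form off the origin, and its exponential and logarithm act on \<open>p\<close> and
  \<open>q\<close> separately.\<close>

definition axial_matrix :: "real \<Rightarrow> real \<Rightarrow> real ^ 'n \<Rightarrow> real ^ 'n ^ 'n" where
  "axial_matrix p q e = p *\<^sub>R mat 1 + (q - p) *\<^sub>R rank_one e"

lemma axial_matrix_mult_vec: "axial_matrix p q e *v v = p *\<^sub>R v + ((q - p) * (e \<bullet> v)) *\<^sub>R e"
  by (simp add: axial_matrix_def matrix_vector_mult_add_rdistrib scaleR_matrix_mult_vec rank_one_mult_vec)

lemma transpose_axial_matrix: "transpose (axial_matrix p q e) = axial_matrix p q e"
  by (simp add: axial_matrix_def transpose_add transpose_scaleR transpose_rank_one)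

lemma matrix_exp_axial_matrix:
  assumes e: "norm (e :: real ^ 'n) = 1"
  shows "matrix_exp (axial_matrix p q e) = axial_matrix (exp p) (exp q) e"
proof (subst matrix_eq, rule allI)
  fix v :: "real ^ 'n"
  have ee: "e \<bullet> e = 1" using e by (simp add: dot_square_norm)
  have 1: "matrix_exp (axial_matrix p q e) *v e = exp q *\<^sub>R e"
    by (rule matrix_exp_eigenvector) (simp add: axial_matrix_mult_vec ee algebra_simps flip: scaleR_add_left)
  have 2: "matrix_exp (axial_matrix p q e) *v (v - (e \<bullet> v) *\<^sub>R e) = exp p *\<^sub>R (v - (e \<bullet> v) *\<^sub>R e)"
    by (rule matrix_exp_eigenvector) (simp add: axial_matrix_mult_vec ee inner_simps)
  have "matrix_exp (axial_matrix p q e) *v v = matrix_exp (axial_matrix p q e) *v (v - (e \<bullet> v) *\<^sub>R e + (e \<bullet> v) *\<^sub>R e)" by simp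
  also have "\<dots> = exp p *\<^sub>R (v - (e \<bullet> v) *\<^sub>R e) + (e \<bullet> v) *\<^sub>R exp q *\<^sub>R e"
    by (simp only: matrix_vector_right_distrib 2 matrix_vector_mult_scaleR 1)
  also have "\<dots> = axial_matrix (exp p) (exp q) e *v v"
    by (simp add: axial_matrix_mult_vec algebra_simps)
  finally show "matrix_exp (axial_matrix p q e) *v v = axial_matrix (exp p) (exp q) e *v v" .
qed

text \<open>The logarithm is a definite description, so uniqueness has to be proved: a competitor L
  has eigenvectors that are eigenvectors of \<open>matrix_exp L\<close>, whose eigenspaces are
  known. Hence L agrees with the candidate on its own eigenvectors, and these span.\<close>

lemma matrix_log_axial_matrix:
  assumes e: "norm (e :: real ^ 'n) = 1" and pq: "p > 0" "q > 0"
  shows "matrix_log (axial_matrix p q e) = axial_matrix (ln p) (ln q) e"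
  unfolding matrix_log_def
proof (rule the_equality)
  show "transpose (axial_matrix (ln p) (ln q) e) = axial_matrix (ln p) (ln q) e \<and> matrix_exp (axial_matrix (ln p) (ln q) e) = axial_matrix p q e"
    using pq by (simp add: transpose_axial_matrix matrix_exp_axial_matrix[OF e])
next
  fix L :: "real ^ 'n ^ 'n"
  assume L: "transpose L = L \<and> matrix_exp L = axial_matrix p q e"
  have ee: "e \<bullet> e = 1" using e by (simp add: dot_square_norm)
  have eig: "L *v w = axial_matrix (ln p) (ln q) e *v w" if "L *v w = l *\<^sub>R w" for l w
  proof -
    have eq: "p *\<^sub>R w + ((q - p) * (e \<bullet> w)) *\<^sub>R e = exp l *\<^sub>R w"
      using matrix_exp_eigenvector[OF that] L by (simp add: axial_matrix_mult_vec)
    have "(p *\<^sub>R w + ((q - p) * (e \<bullet> w)) *\<^sub>R e) \<bullet> e = (exp l *\<^sub>R w) \<bullet> e" using eq by simp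
    \<comment> \<open>Pairing with e leaves two cases: w is orthogonal to e and belongs to the
      eigenvalue p, or exp l = q.\<close>
    then have 1: "(q - exp l) * (e \<bullet> w) = 0"
      by (simp add: inner_simps ee inner_commute algebra_simps)
    show ?thesis
    proof (cases "e \<bullet> w = 0")
      case True
      with eq have "(p - exp l) *\<^sub>R w = 0" by (simp add: algebra_simps)
      then have "w = 0 \<or> ln p = l" by auto
      then show ?thesis using that True by (auto simp: axial_matrix_mult_vec)
    next
      case False
      with 1 have q: "q = exp l" by simp
      with eq have "(p - q) *\<^sub>R (w - (e \<bullet> w) *\<^sub>R e) = 0" by (simp add: algebra_simps)
      then have "p = q \<or> w = (e \<bullet> w) *\<^sub>R e" by auto
      then show ?thesis
      proof
        assume "p = q"
        then show ?thesis using that q by (simp add: axial_matrix_mult_vec)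
      next
        assume w: "w = (e \<bullet> w) *\<^sub>R e"
        have "axial_matrix (ln p) (ln q) e *v w = ln p *\<^sub>R w + (ln q - ln p) *\<^sub>R ((e \<bullet> w) *\<^sub>R e)"
          by (simp add: axial_matrix_mult_vec)
        also have "(e \<bullet> w) *\<^sub>R e = w" using w by simp
        finally show ?thesis using that q by (simp flip: scaleR_add_left)
      qed
    qed
  qed
  show "L = axial_matrix (ln p) (ln q) e"
  proof (subst matrix_eq, rule allI)
    fix v
    have "v \<in> span {w. \<exists>l. L *v w = l *\<^sub>R w}" using span_eigenvectors_symmetric L by blast
    then show "L *v v = axial_matrix (ln p) (ln q) e *v v"
    proof (induction rule: span_induct_alt)
      case base show ?case by simp
    next
      case (step c x y)
      then show ?case using eig by (auto simp: matrix_vector_right_distrib matrix_vector_mult_scaleR)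
    qed
  qed
qed

lemma spectral_norm_axial_matrix:
  assumes e: "norm (e :: real ^ 'n) = 1" and d: "CARD('n) \<ge> 2"
  shows "spectral_norm (axial_matrix p q e) = max \<bar>p\<bar> \<bar>q\<bar>"
proof (rule antisym)
  have ee: "e \<bullet> e = 1" using e by (simp add: dot_square_norm)
  let ?m = "max \<bar>p\<bar> \<bar>q\<bar>"
  show "spectral_norm (axial_matrix p q e) \<le> ?m"
    unfolding spectral_norm_def
  proof (rule onorm_le)
    fix v :: "real ^ 'n"
    define y where "y = v - (e \<bullet> v) *\<^sub>R e"
    have oy: "e \<bullet> y = 0" by (simp add: y_def inner_simps ee)
    have v: "v = y + (e \<bullet> v) *\<^sub>R e" by (simp add: y_def)
    have nv: "(norm v)\<^sup>2 = (norm y)\<^sup>2 + (e \<bullet> v)\<^sup>2"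
      by (subst v, subst norm_add_Pythagorean) (simp_all add: orthogonal_def inner_commute oy e)
    have "axial_matrix p q e *v v = p *\<^sub>R y + (q * (e \<bullet> v)) *\<^sub>R e"
      by (simp add: axial_matrix_mult_vec y_def algebra_simps)
    then have "(norm (axial_matrix p q e *v v))\<^sup>2 = (norm (p *\<^sub>R y))\<^sup>2 + (norm ((q * (e \<bullet> v)) *\<^sub>R e))\<^sup>2"
      by (simp add: norm_add_Pythagorean orthogonal_def inner_commute oy)
    also have "\<dots> = p\<^sup>2 * (norm y)\<^sup>2 + q\<^sup>2 * (e \<bullet> v)\<^sup>2" using e by (simp add: power_mult_distrib)
    also have "\<dots> \<le> ?m\<^sup>2 * (norm y)\<^sup>2 + ?m\<^sup>2 * (e \<bullet> v)\<^sup>2"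
      by (intro add_mono mult_right_mono) (auto simp: abs_le_square_iff[symmetric])
    also have "\<dots> = (?m * norm v)\<^sup>2" by (simp add: nv power_mult_distrib algebra_simps)
    finally show "norm (axial_matrix p q e *v v) \<le> ?m * norm v"
      by (rule power2_le_imp_le) (simp add: max_def)
  qed
  have bl: "bounded_linear ((*v) (axial_matrix p q e))" by (rule matrix_vector_mul_bounded_linear)
  \<comment> \<open>Dimension at least 2 provides a vector orthogonal to e, at which the value |p|
    is attained.\<close>
  obtain y where y: "y \<noteq> 0" "orthogonal e y"
    using orthogonal_to_vector_exists[of e] d by auto
  have "norm (axial_matrix p q e *v y) \<le> onorm ((*v) (axial_matrix p q e)) * norm y" by (rule onorm[OF bl])
  then have "\<bar>p\<bar> \<le> spectral_norm (axial_matrix p q e)"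
    using y by (simp add: axial_matrix_mult_vec orthogonal_def spectral_norm_def)
  moreover have "norm (axial_matrix p q e *v e) \<le> onorm ((*v) (axial_matrix p q e)) * norm e" by (rule onorm[OF bl])
  then have "\<bar>q\<bar> \<le> spectral_norm (axial_matrix p q e)"
    using e by (simp add: axial_matrix_mult_vec ee spectral_norm_def flip: scaleR_add_left)
  ultimately show "?m \<le> spectral_norm (axial_matrix p q e)" by simp
qed

text \<open>The function -ln (1 - z) is convex, so on [0, 3/4] it lies below its chord, whose slope
  (4/3) ln 4 = (8/3) ln 2 is less than 2. The end point 3/4 is the supremum of (1 + 2s) \<epsilon> /
  2 over the admissible s and \<epsilon>.\<close>

lemma neg_ln_le_chord:
  assumes "0 \<le> z" "z \<le> 3/4"
  shows "- ln (1 - z) \<le> 2 * (z::real)"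
proof -
  have "(1/4) powr (4 * z / 3) * 1 powr (1 - 4 * z / 3) \<le> 4 * z / 3 * (1/4) + (1 - 4 * z / 3) * 1"
    using assms by (intro Youngs_inequality_0) auto
  then have "ln ((1/4) powr (4 * z / 3)) \<le> ln (1 - z)"
    using assms by (intro ln_mono) auto
  then have "- ln (1 - z) \<le> 4 * z / 3 * ln 4" by (simp add: ln_powr ln_div)
  also have "ln 4 = 2 * ln (2::real)" using ln_realpow[of 2 2] by simp
  also have "4 * z / 3 * (2 * ln 2) \<le> 4 * z / 3 * (2 * (3/4))"
    using assms ln2_le_25_over_36 by (intro mult_left_mono) auto
  finally show ?thesis by simp
qed

lemma esssup_log_A_coeff_le:
  assumes s: "0 < s" "s < 1" and \<epsilon>: "0 \<le> \<epsilon>" "\<epsilon> \<le> 1/2" and d: "CARD('n::finite) \<ge> 2"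
  shows "esssup lborel (\<lambda>x::real ^ 'n. ereal (spectral_norm (matrix_log (A_coeff s \<epsilon> x))))
          \<le> ereal ((1 + real CARD('n) + 4 * s) / 2 * \<epsilon>)"
proof -
  let ?d = "real CARD('n)"
  define p where "p = 1 - (1 + 2 * s) / 2 * \<epsilon>"
  define q where "q = 1 + (?d - 1) / 2 * \<epsilon>"
  define m where "m = max \<bar>ln p\<bar> \<bar>ln q\<bar>"
  let ?f = "\<lambda>x::real ^ 'n. ereal (spectral_norm (matrix_log (A_coeff s \<epsilon> x)))"
  have z0: "0 \<le> (1 + 2 * s) / 2 * \<epsilon>" using s \<epsilon> by simp
  have z1: "(1 + 2 * s) / 2 * \<epsilon> \<le> 3/4"
    using mult_mono[of "(1 + 2 * s) / 2" "3/2" \<epsilon> "1/2"] s \<epsilon> by simp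
  have p: "p > 0" "p \<le> 1" unfolding p_def using z0 z1 by linarith+
  have q: "q \<ge> 1" using d \<epsilon> by (simp add: q_def)
  have A: "A_coeff s \<epsilon> x = axial_matrix p q (sgn x)" for x :: "real ^ 'n"
    by (simp add: A_coeff_eq axial_matrix_def p_def q_def diff_divide_distrib add_divide_distrib algebra_simps)
  have f: "?f x = ereal m" if "x \<noteq> 0" for x :: "real ^ 'n"
    using that p q by (simp add: A matrix_log_axial_matrix norm_sgn spectral_norm_axial_matrix[OF _ d] m_def)
  \<comment> \<open>The norm of the logarithm is constant off the origin. This yields measurability
    and leaves two scalar estimates.\<close>
  have "?f = (\<lambda>x. if x = 0 then ?f 0 else ereal m)"
    using f by (auto simp: fun_eq_iff)
  moreover have "(\<lambda>x::real ^ 'n. if x = 0 then ?f 0 else ereal m) \<in> borel_measurable lborel"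
    by measurable
  ultimately have meas: "?f \<in> borel_measurable lborel" by metis
  have "- ln p \<le> 2 * ((1 + 2 * s) / 2 * \<epsilon>)"
    unfolding p_def by (rule neg_ln_le_chord[OF z0 z1])
  \<comment> \<open>2 * (1 + 2s)/2 = (2 + 4s)/2 and 2 \<le> 1 + d; the summand 4s of the bound comes
    from here.\<close>
  also have "\<dots> \<le> (1 + ?d + 4 * s) / 2 * \<epsilon>"
    using d \<epsilon> mult_right_mono[of 2 "1 + ?d" \<epsilon>] by (simp add: field_simps)
  finally have 1: "\<bar>ln p\<bar> \<le> (1 + ?d + 4 * s) / 2 * \<epsilon>" using p by simp
  have "ln q \<le> (?d - 1) / 2 * \<epsilon>" unfolding q_def using d \<epsilon> by (intro ln_add_one_self_le_self) auto
  also have "\<dots> \<le> (1 + ?d + 4 * s) / 2 * \<epsilon>" using s \<epsilon> by (intro mult_right_mono) auto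
  finally have "\<bar>ln q\<bar> \<le> (1 + ?d + 4 * s) / 2 * \<epsilon>" using q by simp
  with 1 have m: "m \<le> (1 + ?d + 4 * s) / 2 * \<epsilon>" by (simp add: m_def)
  show ?thesis
  proof (rule esssup_I[OF meas])
    show "AE x in lborel. ?f x \<le> ereal ((1 + ?d + 4 * s) / 2 * \<epsilon>)"
      using AE_lborel_singleton[of 0] by (rule eventually_mono) (use f m in auto)
  qed
qed

subsection \<open>Gaussian moments\<close>

lemma has_bochner_integral_lborel_prod_Basis:
  fixes f :: "'a::euclidean_space \<Rightarrow> real \<Rightarrow> real"
  assumes f: "\<And>b. b \<in> Basis \<Longrightarrow> has_bochner_integral lborel (f b) (v b)"
  shows "has_bochner_integral lborel (\<lambda>x::'a. \<Prod>b\<in>Basis. f b (x \<bullet> b)) (\<Prod>b\<in>Basis. v b)"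
proof -
  interpret product_sigma_finite "\<lambda>b::'a. lborel :: real measure" ..
  have [measurable]: "f b \<in> borel_measurable borel" if "b \<in> Basis" for b
    using f[OF that] by (auto simp: has_bochner_integral_iff dest!: borel_measurable_integrable)
  have i: "integrable lborel (f b)" "integral\<^sup>L lborel (f b) = v b" if "b \<in> Basis" for b
    using f[OF that] by (auto simp: has_bochner_integral_iff)
  have 1: "has_bochner_integral (\<Pi>\<^sub>M b\<in>Basis. lborel) (\<lambda>x. \<Prod>b\<in>Basis. f b (x b)) (\<Prod>b\<in>Basis. v b)"
    unfolding has_bochner_integral_iff
    using product_integrable_prod[of Basis f] product_integral_prod[of Basis f] i by (auto intro!: prod.cong)
  have 2: "(\<Prod>b\<in>Basis. f b (x b)) = (\<Prod>b\<in>Basis. f b ((\<Sum>b\<in>Basis. x b *\<^sub>R b) \<bullet> b))" for x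
    by (intro prod.cong) auto
  have "has_bochner_integral (\<Pi>\<^sub>M b\<in>Basis. lborel) (\<lambda>x. \<Prod>b\<in>Basis. f b ((\<Sum>b\<in>Basis. x b *\<^sub>R b) \<bullet> b)) (\<Prod>b\<in>Basis. v b)"
    by (rule has_bochner_integral_cong[THEN iffD1, OF refl _ refl 1]) (rule 2)
  moreover have L: "(lborel :: 'a measure) = distr (\<Pi>\<^sub>M b\<in>Basis. lborel) borel (\<lambda>f. \<Sum>b\<in>Basis. f b *\<^sub>R b)"
    by (rule lborel_eq)
  ultimately show ?thesis
    unfolding L by (simp add: has_bochner_integral_iff integrable_distr_eq integral_distr)
qed

lemma gaussian_moments_real:
  fixes T :: real
  assumes T: "T > 0"
  shows "has_bochner_integral lborel (\<lambda>y. exp (- T * y\<^sup>2)) (sqrt (pi / T))"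
    and "has_bochner_integral lborel (\<lambda>y. exp (- T * y\<^sup>2) * y) 0"
    and "has_bochner_integral lborel (\<lambda>y. exp (- T * y\<^sup>2) * y\<^sup>2) (sqrt (pi / T) / (2 * T))"
proof -
  \<comment> \<open>The centred normal density of variance 1/(2T) is exp (-T y^2) divided by sqrt
    (pi/T).\<close>
  define \<sigma> where "\<sigma> = 1 / sqrt (2 * T)"
  have \<sigma>: "\<sigma> > 0" "\<sigma>\<^sup>2 = 1 / (2 * T)" using T by (simp_all add: \<sigma>_def power_divide)
  have nd: "sqrt (pi / T) * normal_density 0 \<sigma> y = exp (- T * y\<^sup>2)" for y
  proof -
    have "2 * pi * \<sigma>\<^sup>2 = pi / T" using \<sigma> T by simp
    moreover have "- (y - 0)\<^sup>2 / (2 * \<sigma>\<^sup>2) = - T * y\<^sup>2" using \<sigma> T by simp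
    ultimately show ?thesis using T by (simp add: normal_density_def)
  qed
  have "has_bochner_integral lborel (\<lambda>y. sqrt (pi / T) * (normal_density 0 \<sigma> y * (y - 0) ^ (2 * 0))) (sqrt (pi / T) * (fact (2 * 0) / ((2 / \<sigma>\<^sup>2)^0 * fact 0)))"
    by (intro has_bochner_integral_mult_right normal_moment_even \<sigma>)
  then show "has_bochner_integral lborel (\<lambda>y. exp (- T * y\<^sup>2)) (sqrt (pi / T))"
    by (simp add: nd)
  have "has_bochner_integral lborel (\<lambda>y. sqrt (pi / T) * (normal_density 0 \<sigma> y * (y - 0) ^ (2 * 0 + 1))) (sqrt (pi / T) * 0)"
    by (intro has_bochner_integral_mult_right normal_moment_odd \<sigma>)
  then show "has_bochner_integral lborel (\<lambda>y. exp (- T * y\<^sup>2) * y) 0"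
    by (simp add: nd mult.assoc[symmetric])
  have "has_bochner_integral lborel (\<lambda>y. sqrt (pi / T) * (normal_density 0 \<sigma> y * (y - 0) ^ (2 * 1))) (sqrt (pi / T) * (fact (2 * 1) / ((2 / \<sigma>\<^sup>2)^1 * fact 1)))"
    by (intro has_bochner_integral_mult_right normal_moment_even \<sigma>)
  moreover have "sqrt (pi / T) * (fact (2 * 1) / ((2 / \<sigma>\<^sup>2)^1 * fact 1)) = sqrt (pi / T) / (2 * T)"
    using T by (simp add: \<sigma>(2) fact_2)
  ultimately show "has_bochner_integral lborel (\<lambda>y. exp (- T * y\<^sup>2) * y\<^sup>2) (sqrt (pi / T) / (2 * T))"
    by (simp only: nd mult.assoc[symmetric] diff_zero mult_1_right)
qed

lemma exp_norm_eq_prod: "exp (- (T * (norm (z::'a::euclidean_space))\<^sup>2)) = (\<Prod>b\<in>Basis. exp (- (T * (z \<bullet> b)\<^sup>2)))"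
proof -
  have "(norm z)\<^sup>2 = (\<Sum>b\<in>Basis. (z \<bullet> b)\<^sup>2)"
    unfolding power2_norm_eq_inner by (subst euclidean_inner) (simp add: power2_eq_square)
  then show ?thesis by (simp add: exp_sum[symmetric] sum_distrib_left sum_negf)
qed

lemma sqrt_power_eq_powr: "x > 0 \<Longrightarrow> sqrt x ^ k = x powr (real k / 2)"
  by (simp add: powr_half_sqrt[symmetric] powr_realpow[symmetric] powr_powr)

lemma gaussian_integral:
  assumes T: "T > 0"
  shows "has_bochner_integral lborel (\<lambda>z::'a::euclidean_space. exp (- T * (norm z)\<^sup>2)) ((pi / T) powr (DIM('a) / 2))"
  using has_bochner_integral_lborel_prod_Basis[where 'a = 'a and f = "\<lambda>_ y. exp (- T * y\<^sup>2)" and v = "\<lambda>_. sqrt (pi / T)", OF gaussian_moments_real(1)[OF T]] T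
  by (simp add: exp_norm_eq_prod[symmetric] sqrt_power_eq_powr)

lemma gaussian_second_moment_Basis:
  assumes T: "T > 0" and b: "b \<in> Basis" "c \<in> Basis"
  shows "has_bochner_integral lborel (\<lambda>z::'a::euclidean_space. exp (- T * (norm z)\<^sup>2) * ((z \<bullet> b) * (z \<bullet> c)))
     ((pi / T) powr (DIM('a) / 2) * ((b \<bullet> c) / (2 * T)))"
proof -
  \<comment> \<open>The coordinate a receives one factor y for each of b and c that equals a. The
    mixed moment thus factorises, and for b \<noteq> c it contains a vanishing first moment.\<close>
  let ?f = "\<lambda>a y. exp (- T * y\<^sup>2) * ((if a = b then y else 1) * (if a = c then y else 1))"
  let ?v = "\<lambda>a. if a = b \<and> a = c then sqrt (pi / T) / (2 * T) else if a = b \<or> a = c then 0 else sqrt (pi / T)"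
  have 1: "has_bochner_integral lborel (\<lambda>x. \<Prod>a\<in>Basis. ?f a (x \<bullet> a)) (\<Prod>a\<in>Basis. ?v a)"
    by (rule has_bochner_integral_lborel_prod_Basis)
       (use gaussian_moments_real[OF T] in \<open>auto simp: power2_eq_square\<close>)
  have 2: "(\<Prod>a\<in>Basis. ?f a (z \<bullet> a)) = exp (- T * (norm z)\<^sup>2) * ((z \<bullet> b) * (z \<bullet> c))" for z :: 'a
    using b by (simp add: prod.distrib prod.delta exp_norm_eq_prod)
  have 3: "(\<Prod>a\<in>Basis. ?v a) = (pi / T) powr (DIM('a) / 2) * ((b \<bullet> c) / (2 * T))"
  proof (cases "b = c")
    case True
    have "(\<Prod>a\<in>Basis. ?v a) = (\<Prod>a\<in>Basis. sqrt (pi / T) * (if a = b then 1 / (2 * T) else 1))"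
      using True by (intro prod.cong) auto
    also have "\<dots> = (pi / T) powr (DIM('a) / 2) * ((b \<bullet> c) / (2 * T))"
      using True b T by (simp add: prod.distrib prod.delta sqrt_power_eq_powr)
    finally show ?thesis .
  next
    case False
    then have "(\<Prod>a\<in>Basis. ?v a) = 0" using b by (intro prod_zero) auto
    then show ?thesis using False b by (simp add: inner_Basis)
  qed
  show ?thesis using 1 unfolding 2 3 .
qed

lemma gaussian_second_moment:
  fixes u w :: "'a::euclidean_space"
  assumes T: "T > 0"
  shows "has_bochner_integral lborel (\<lambda>z::'a. exp (- T * (norm z)\<^sup>2) * ((z \<bullet> u) * (z \<bullet> w)))
     ((pi / T) powr (DIM('a) / 2) * ((u \<bullet> w) / (2 * T)))"
proof -
  let ?c = "(pi / T) powr (DIM('a) / 2)"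
  have 1: "has_bochner_integral lborel (\<lambda>z. \<Sum>b\<in>Basis. \<Sum>c\<in>Basis. (u \<bullet> b) * (w \<bullet> c) * (exp (- T * (norm z)\<^sup>2) * ((z \<bullet> b) * (z \<bullet> c))))
     (\<Sum>b\<in>Basis. \<Sum>c\<in>Basis. (u \<bullet> b) * (w \<bullet> c) * (?c * ((b \<bullet> c) / (2 * T))))"
  proof (rule has_bochner_integral_sum, rule has_bochner_integral_sum, rule has_bochner_integral_mult_right)
    fix b c :: 'a assume "b \<in> Basis" "c \<in> Basis"
    then show "has_bochner_integral lborel (\<lambda>z. exp (- T * (norm z)\<^sup>2) * ((z \<bullet> b) * (z \<bullet> c))) (?c * ((b \<bullet> c) / (2 * T)))"
      by (rule gaussian_second_moment_Basis[OF T])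
  qed
  have 2: "(\<Sum>b\<in>Basis. \<Sum>c\<in>Basis. (u \<bullet> b) * (w \<bullet> c) * (exp (- T * (norm z)\<^sup>2) * ((z \<bullet> b) * (z \<bullet> c))))
      = exp (- T * (norm z)\<^sup>2) * ((z \<bullet> u) * (z \<bullet> w))" for z
  proof -
    have *: "(z \<bullet> u) * (z \<bullet> w) = (\<Sum>b\<in>Basis. (z \<bullet> b) * (u \<bullet> b)) * (\<Sum>c\<in>Basis. (z \<bullet> c) * (w \<bullet> c))"
      by (simp only: euclidean_inner[symmetric])
    show ?thesis
      unfolding * by (subst sum_product, subst sum_distrib_left, intro sum.cong refl, subst sum_distrib_left, intro sum.cong refl)
        (simp only: mult_ac)
  qed
  have 3: "(\<Sum>b\<in>Basis. \<Sum>c\<in>Basis. (u \<bullet> b) * (w \<bullet> c) * (?c * ((b \<bullet> c) / (2 * T)))) = ?c * ((u \<bullet> w) / (2 * T))"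
  proof -
    have "(\<Sum>c\<in>Basis. (u \<bullet> b) * (w \<bullet> c) * (?c * ((b \<bullet> c) / (2 * T)))) = (u \<bullet> b) * (w \<bullet> b) * (?c / (2 * T))" if "b \<in> Basis" for b
    proof -
      have "(\<Sum>c\<in>Basis. (u \<bullet> b) * (w \<bullet> c) * (?c * ((b \<bullet> c) / (2 * T)))) = (\<Sum>c\<in>Basis. if c = b then (u \<bullet> b) * (w \<bullet> b) * (?c / (2 * T)) else 0)"
        using that by (intro sum.cong) (auto simp: inner_Basis)
      then show ?thesis using that by (simp add: sum.delta)
    qed
    then show ?thesis
      by (simp add: euclidean_inner[of u w] sum_distrib_right sum_divide_distrib sum_distrib_left mult_ac)
  qed
  show ?thesis using 1 unfolding 2 3 .
qed

lemma gaussian_norm_moment: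
  assumes T: "T > 0"
  shows "has_bochner_integral lborel (\<lambda>z::'a::euclidean_space. exp (- T * (norm z)\<^sup>2) * (z \<bullet> z))
     ((pi / T) powr (DIM('a) / 2) * (DIM('a) / (2 * T)))"
proof -
  have "has_bochner_integral lborel (\<lambda>z::'a. \<Sum>b\<in>Basis. exp (- T * (norm z)\<^sup>2) * ((z \<bullet> b) * (z \<bullet> b)))
     (\<Sum>b\<in>(Basis::'a set). (pi / T) powr (DIM('a) / 2) * ((b \<bullet> b) / (2 * T)))"
    by (rule has_bochner_integral_sum) (rule gaussian_second_moment[OF T])
  then show ?thesis
    by (simp add: sum_distrib_left[symmetric] euclidean_inner[symmetric] mult.commute[of "real DIM('a)"])
qed

text \<open>A class closed under sums, products and translations that is integrable against every
  Gaussian; it settles all integrability questions for the Gaussian means below.\<close>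

definition poly_growth :: "('a::euclidean_space \<Rightarrow> real) \<Rightarrow> bool" where
  "poly_growth f \<longleftrightarrow> f \<in> borel_measurable borel \<and> (\<exists>C k. \<forall>z. \<bar>f z\<bar> \<le> C * (1 + norm z) ^ k)"

lemma poly_growth_const: "poly_growth (\<lambda>z. c)"
  unfolding poly_growth_def by (auto intro!: exI[of _ "\<bar>c\<bar>"] exI[of _ "0::nat"])

lemma poly_growth_inner: "poly_growth (\<lambda>z. z \<bullet> u)" "poly_growth (\<lambda>z. u \<bullet> z)"
proof -
  have *: "\<bar>z \<bullet> u\<bar> \<le> norm u * (1 + norm z) ^ 1" for z
    using Cauchy_Schwarz_ineq2[of z u] by (simp add: algebra_simps) (smt (verit) norm_ge_zero)
  then show "poly_growth (\<lambda>z. z \<bullet> u)" unfolding poly_growth_def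
    by (intro conjI exI[of _ "norm u"] exI[of _ "1::nat"]) auto
  then show "poly_growth (\<lambda>z. u \<bullet> z)" by (simp add: inner_commute)
qed

lemma poly_growth_mult:
  assumes "poly_growth f" "poly_growth g"
  shows "poly_growth (\<lambda>z. f z * g z)"
proof -
  obtain C k D l where *: "\<And>z. \<bar>f z\<bar> \<le> C * (1 + norm z) ^ k" "\<And>z. \<bar>g z\<bar> \<le> D * (1 + norm z) ^ l"
    using assms unfolding poly_growth_def by blast
  have "\<bar>f z * g z\<bar> \<le> C * D * (1 + norm z) ^ (k + l)" for z
    using mult_mono'[OF *[of z]] by (simp add: abs_mult power_add mult_ac)
  then show ?thesis using assms unfolding poly_growth_def by auto
qed

lemma poly_growth_add:
  assumes "poly_growth f" "poly_growth g"
  shows "poly_growth (\<lambda>z. f z + g z)"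
proof -
  obtain C k D l where *: "\<And>z. \<bar>f z\<bar> \<le> C * (1 + norm z) ^ k" "\<And>z. \<bar>g z\<bar> \<le> D * (1 + norm z) ^ l"
    using assms unfolding poly_growth_def by blast
  have "\<bar>f z + g z\<bar> \<le> (\<bar>C\<bar> + \<bar>D\<bar>) * (1 + norm z) ^ (k + l)" for z
  proof -
    have "C * (1 + norm z) ^ k \<le> \<bar>C\<bar> * (1 + norm z) ^ (k + l)"
      by (intro mult_mono power_increasing) auto
    moreover have "D * (1 + norm z) ^ l \<le> \<bar>D\<bar> * (1 + norm z) ^ (k + l)"
      by (intro mult_mono power_increasing) auto
    ultimately show ?thesis using *[of z] by (simp add: distrib_right)
  qed
  then show ?thesis using assms unfolding poly_growth_def by auto
qed

lemma poly_growth_diff: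
  assumes "poly_growth f" "poly_growth g"
  shows "poly_growth (\<lambda>z. f z - g z)"
  using poly_growth_add[OF assms(1) poly_growth_mult[OF poly_growth_const[of "-1"] assms(2)]] by simp

lemma poly_growth_power: "poly_growth f \<Longrightarrow> poly_growth (\<lambda>z. f z ^ k)"
  by (induction k) (auto intro: poly_growth_const poly_growth_mult)

lemma poly_growth_norm: "poly_growth norm"
  unfolding poly_growth_def by (auto intro!: exI[of _ "1::real"] exI[of _ "1::nat"])

lemma poly_growth_inner_self: "poly_growth (\<lambda>z. z \<bullet> z)"
  using poly_growth_power[OF poly_growth_norm, of 2] by (simp add: power2_norm_eq_inner)

lemma poly_growth_bound:
  assumes "poly_growth g" "f \<in> borel_measurable borel" "\<And>z. \<bar>f z\<bar> \<le> \<bar>g z\<bar>"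
  shows "poly_growth f"
proof -
  obtain C k where "\<And>z. \<bar>g z\<bar> \<le> C * (1 + norm z) ^ k"
    using assms(1) unfolding poly_growth_def by blast
  then have "\<And>z. \<bar>f z\<bar> \<le> C * (1 + norm z) ^ k" using assms(3) order_trans by blast
  then show ?thesis using assms(2) unfolding poly_growth_def by blast
qed

lemma poly_growth_translate:
  assumes "poly_growth f"
  shows "poly_growth (\<lambda>z. f (c + z))"
proof -
  obtain C k where *: "\<And>z. \<bar>f z\<bar> \<le> C * (1 + norm z) ^ k"
    using assms unfolding poly_growth_def by blast
  have "\<bar>f (c + z)\<bar> \<le> (\<bar>C\<bar> * (1 + norm c) ^ k) * (1 + norm z) ^ k" for z
  proof -
    have "norm (c + z) \<le> norm c + norm z" by (rule norm_triangle_ineq)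
    moreover have "0 \<le> norm c * norm z" by simp
    ultimately have "1 + norm (c + z) \<le> (1 + norm c) * (1 + norm z)"
      unfolding distrib_left distrib_right by linarith
    then have "(1 + norm (c + z)) ^ k \<le> ((1 + norm c) * (1 + norm z)) ^ k"
      by (intro power_mono) auto
    then have "\<bar>C\<bar> * (1 + norm (c + z)) ^ k \<le> \<bar>C\<bar> * ((1 + norm c) ^ k * (1 + norm z) ^ k)"
      by (simp add: mult_left_mono power_mult_distrib)
    moreover have "C * (1 + norm (c + z)) ^ k \<le> \<bar>C\<bar> * (1 + norm (c + z)) ^ k"
      by (intro mult_right_mono) auto
    ultimately show ?thesis using *[of "c + z"] by (simp add: mult.assoc)
  qed
  moreover have "(\<lambda>z. f (c + z)) \<in> borel_measurable borel"
  proof -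
    have [measurable]: "f \<in> borel_measurable borel" using assms by (simp add: poly_growth_def)
    show ?thesis by measurable
  qed
  ultimately show ?thesis unfolding poly_growth_def by blast
qed

lemmas poly_growth_intros = poly_growth_const poly_growth_inner poly_growth_mult poly_growth_add
  poly_growth_diff poly_growth_power poly_growth_norm poly_growth_inner_self

text \<open>With r = |z|: (1 + r)^k \<le> k! exp (1 + r), and r \<le> 1/(2T) + T r^2 / 2 because (T
  r - 1)^2 \<ge> 0. So the polynomial costs at most half of the Gaussian exponent.\<close>

lemma integrable_gaussian_poly_growth:
  fixes f :: "'a::euclidean_space \<Rightarrow> real"
  assumes f: "poly_growth f" and T: "T > 0"
  shows "integrable lborel (\<lambda>z. exp (- T * (norm z)\<^sup>2) * f z)"
proof -
  obtain C k where *: "\<And>z. \<bar>f z\<bar> \<le> C * (1 + norm z) ^ k" and [measurable]: "f \<in> borel_measurable borel"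
    using f unfolding poly_growth_def by blast
  define K where "K = \<bar>C\<bar> * (fact k * exp (1 + 1 / (2 * T)))"
  have "integrable lborel (\<lambda>z::'a. K * exp (- (T / 2) * (norm z)\<^sup>2))"
    using gaussian_integral[of "T / 2", where 'a = 'a] T by (intro integrable_mult_right) (auto simp: has_bochner_integral_iff)
  then show ?thesis
  proof (rule Bochner_Integration.integrable_bound)
    show "AE z in lborel. norm (exp (- T * (norm z)\<^sup>2) * f z) \<le> norm (K * exp (- (T / 2) * (norm (z::'a))\<^sup>2))"
    proof (rule AE_I2)
      fix z :: 'a
      let ?r = "norm z"
      have "(1 + ?r) ^ k / fact k \<le> exp (1 + ?r)"
      proof -
        have "(\<Sum>j\<in>{k}. (1 + ?r) ^ j /\<^sub>R fact j) \<le> (\<Sum>j. (1 + ?r) ^ j /\<^sub>R fact j)"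
          by (rule sum_le_suminf[OF summable_exp_generic]) auto
        then show ?thesis by (simp add: exp_def divide_inverse mult.commute)
      qed
      then have "(1 + ?r) ^ k \<le> fact k * exp (1 + ?r)" by (simp add: field_simps)
      also have "?r \<le> 1 / (2 * T) + T / 2 * ?r\<^sup>2"
        using T zero_le_power2[of "T * ?r - 1"] by (simp add: field_simps power2_eq_square)
      then have "exp (1 + ?r) \<le> exp (1 + 1 / (2 * T)) * exp (T / 2 * ?r\<^sup>2)"
        by (simp add: exp_add[symmetric])
      finally have "(1 + ?r) ^ k \<le> fact k * (exp (1 + 1 / (2 * T)) * exp (T / 2 * ?r\<^sup>2))"
        by simp
      then have "\<bar>C\<bar> * (1 + ?r) ^ k \<le> \<bar>C\<bar> * (fact k * (exp (1 + 1 / (2 * T)) * exp (T / 2 * ?r\<^sup>2)))"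
        by (intro mult_left_mono) auto
      moreover have "C * (1 + ?r) ^ k \<le> \<bar>C\<bar> * (1 + ?r) ^ k" by (intro mult_right_mono) auto
      ultimately have "\<bar>f z\<bar> \<le> K * exp (T / 2 * ?r\<^sup>2)"
        using *[of z] by (simp add: K_def mult_ac)
      then have "exp (- T * ?r\<^sup>2) * \<bar>f z\<bar> \<le> exp (- T * ?r\<^sup>2) * (K * exp (T / 2 * ?r\<^sup>2))"
        by (intro mult_left_mono) auto
      also have "\<dots> = K * exp (- (T / 2) * ?r\<^sup>2)" by (simp add: exp_add[symmetric] field_simps)
      finally show "norm (exp (- T * ?r\<^sup>2) * f z) \<le> norm (K * exp (- (T / 2) * ?r\<^sup>2))"
        by (simp add: abs_mult K_def)
    qed
  qed measurable
qed

lemma has_bochner_integral_lborel_translate: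
  fixes f :: "'a::euclidean_space \<Rightarrow> real"
  assumes "has_bochner_integral lborel f v"
  shows "has_bochner_integral lborel (\<lambda>x. f (c + x)) v"
proof -
  have "has_bochner_integral (distr lborel borel ((+) c)) f v"
    using assms by (simp add: lborel_distr_plus)
  moreover have "f \<in> borel_measurable borel"
    using borel_measurable_has_bochner_integral[OF assms] by simp
  ultimately show ?thesis
    by (simp add: has_bochner_integral_iff integrable_distr_eq integral_distr)
qed

lemma has_bochner_integral_lborel_uminus:
  fixes f :: "'a::euclidean_space \<Rightarrow> real"
  assumes "has_bochner_integral lborel f v"
  shows "has_bochner_integral lborel (\<lambda>x. f (- x)) v"
proof -
  have "distr lborel borel (uminus :: 'a \<Rightarrow> 'a) = density (distr lborel borel (\<lambda>x::'a. 0 + (-1) *\<^sub>R x)) (\<lambda>_. ennreal (\<bar>-1\<bar> ^ DIM('a)))"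
    by (simp add: density_1)
  also have "\<dots> = lborel"
    by (rule lborel_affine[symmetric]) simp
  finally have *: "distr lborel borel (uminus :: 'a \<Rightarrow> 'a) = lborel" .
  have "has_bochner_integral (distr lborel borel uminus) f v"
    unfolding * by (rule assms)
  moreover have "f \<in> borel_measurable borel"
    using borel_measurable_has_bochner_integral[OF assms] by simp
  ultimately show ?thesis
    by (simp add: has_bochner_integral_iff integrable_distr_eq integral_distr)
qed

text \<open>Odd terms cancel under z \<mapsto> -z, so only the even part of f is prescribed. The
  polynomials met later are cubic with quadratic even part; moments up to order 2 therefore
  suffice.\<close>

lemma gaussian_expectation_quadratic:
  fixes f :: "'a::euclidean_space \<Rightarrow> real" and x u :: 'a and c0 c1 c2 c3 :: real
  assumes T: "T > 0" and f: "poly_growth f"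
    and even: "\<And>z. f z + f (- z) = 2 * (c0 + c1 * ((z \<bullet> x) * (z \<bullet> x)) + c2 * ((z \<bullet> x) * (z \<bullet> u)) + c3 * (z \<bullet> z))"
  shows "has_bochner_integral lborel (\<lambda>z. exp (- T * (norm z)\<^sup>2) * f z)
    ((pi / T) powr (DIM('a) / 2) * (c0 + (c1 * (x \<bullet> x) + c2 * (x \<bullet> u) + c3 * DIM('a)) / (2 * T)))"
proof -
  let ?c = "(pi / T) powr (DIM('a) / 2)"
  let ?g = "\<lambda>z::'a. exp (- T * (norm z)\<^sup>2)"
  have "integrable lborel (\<lambda>z. ?g z * f z)" by (rule integrable_gaussian_poly_growth[OF f T])
  then obtain v where v: "has_bochner_integral lborel (\<lambda>z. ?g z * f z) v"
    using has_bochner_integral_integrable by blast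
  from has_bochner_integral_add[OF v has_bochner_integral_lborel_uminus[OF v]]
  have 1: "has_bochner_integral lborel (\<lambda>z. ?g z * (f z + f (- z))) (v + v)"
    by (simp add: distrib_left)
  have "has_bochner_integral lborel (\<lambda>z. 2 * (c0 * ?g z + c1 * (?g z * ((z \<bullet> x) * (z \<bullet> x))) + c2 * (?g z * ((z \<bullet> x) * (z \<bullet> u))) + c3 * (?g z * (z \<bullet> z))))
    (2 * (c0 * ?c + c1 * (?c * ((x \<bullet> x) / (2 * T))) + c2 * (?c * ((x \<bullet> u) / (2 * T))) + c3 * (?c * (DIM('a) / (2 * T)))))"
    by (rule has_bochner_integral_mult_right, (rule has_bochner_integral_add)+; rule has_bochner_integral_mult_right)
       (rule gaussian_integral[OF T] gaussian_second_moment[OF T] gaussian_norm_moment[OF T])+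
  moreover have "2 * (c0 * ?g z + c1 * (?g z * ((z \<bullet> x) * (z \<bullet> x))) + c2 * (?g z * ((z \<bullet> x) * (z \<bullet> u))) + c3 * (?g z * (z \<bullet> z)))
      = ?g z * (f z + f (- z))" for z
    unfolding even by (simp add: algebra_simps)
  ultimately have "has_bochner_integral lborel (\<lambda>z. ?g z * (f z + f (- z))) (2 * (c0 * ?c + c1 * (?c * ((x \<bullet> x) / (2 * T))) + c2 * (?c * ((x \<bullet> u) / (2 * T))) + c3 * (?c * (DIM('a) / (2 * T)))))"
    by simp
  from has_bochner_integral_eq[OF 1 this]
  have "v = ?c * (c0 + (c1 * (x \<bullet> x) + c2 * (x \<bullet> u) + c3 * DIM('a)) / (2 * T))"
    using T by (simp add: field_simps)
  with v show ?thesis by simp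
qed

subsection \<open>Integrals of Gamma, Beta and Kummer type\<close>

lemma lborel_fubini_swap:
  fixes W :: "'a::euclidean_space \<Rightarrow> 'b::euclidean_space \<Rightarrow> real"
  assumes meas: "case_prod W \<in> borel_measurable (lborel \<Otimes>\<^sub>M lborel)"
    and int: "AE y in lborel. integrable lborel (\<lambda>t. W t y)"
    and abs: "integrable lborel (\<lambda>y. LINT t|lborel. \<bar>W t y\<bar>)"
  shows "integrable lborel (\<lambda>t. LINT y|lborel. W t y)"
    and "(LINT t|lborel. LINT y|lborel. W t y) = (LINT y|lborel. LINT t|lborel. W t y)"
proof -
  have meas': "(\<lambda>(y, t). W t y) \<in> borel_measurable (lborel \<Otimes>\<^sub>M lborel)"
    using measurable_compose[OF measurable_pair_swap' meas] by (simp add: case_prod_beta')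
  have "integrable (lborel \<Otimes>\<^sub>M lborel) (\<lambda>(y, t). W t y)"
    by (rule lborel_pair.Fubini_integrable[OF meas']) (use int abs in auto)
  then have i: "integrable (lborel \<Otimes>\<^sub>M lborel) (case_prod W)"
    using lborel_pair.integrable_product_swap[of "\<lambda>(y, t). W t y"] by simp
  show "integrable lborel (\<lambda>t. LINT y|lborel. W t y)"
    using lborel_pair.integrable_fst'[OF i] by simp
  show "(LINT t|lborel. LINT y|lborel. W t y) = (LINT y|lborel. LINT t|lborel. W t y)"
    using lborel_pair.Fubini_integral[OF i] by simp
qed

text \<open>For nonnegative W it is enough to evaluate the iterated integral in the convenient
  order; the assumption on \<open>k\<close> names the inner integral of the other order, whose
  integral is wanted.\<close>

lemma lborel_tonelli_swap:
  fixes W :: "'a::euclidean_space \<Rightarrow> 'b::euclidean_space \<Rightarrow> real"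
  assumes meas: "case_prod W \<in> borel_measurable (lborel \<Otimes>\<^sub>M lborel)"
    and nn: "\<And>t y. 0 \<le> W t y"
    and g: "\<And>y. has_bochner_integral lborel (\<lambda>t. W t y) (g y)" and v: "has_bochner_integral lborel g v"
    and k: "\<And>t. has_bochner_integral lborel (\<lambda>y. W t y) (k t)"
  shows "has_bochner_integral lborel k v"
proof -
  have 1: "integrable lborel (\<lambda>t. W t y)" "(LINT t|lborel. W t y) = g y" for y
    using g[of y] by (auto simp: has_bochner_integral_iff)
  have 2: "(LINT y|lborel. W t y) = k t" for t
    using k[of t] by (auto simp: has_bochner_integral_iff)
  have "integrable lborel (\<lambda>y. LINT t|lborel. \<bar>W t y\<bar>)"
    using v nn 1 by (simp add: has_bochner_integral_iff)
  from lborel_fubini_swap[OF meas _ this] 1 2 v show ?thesis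
    by (simp add: has_bochner_integral_iff)
qed

lemma has_integral_nonneg_imp_bochner:
  fixes f :: "real \<Rightarrow> real"
  assumes "(f has_integral I) S" and "\<And>x. x \<in> S \<Longrightarrow> 0 \<le> f x"
    and "(\<lambda>x. indicator S x * f x) \<in> borel_measurable borel"
  shows "has_bochner_integral lborel (\<lambda>x. indicator S x * f x) I"
proof (rule has_bochner_integral_nn_integral)
  have nn: "0 \<le> indicator S x * f x" for x using assms(2)[of x] by (simp add: indicator_def)
  then show "AE x in lborel. 0 \<le> indicator S x * f x" by simp
  have *: "((\<lambda>x. indicator S x * f x) has_integral I) UNIV"
  proof -
    have "(\<lambda>x. indicator S x * f x) = (\<lambda>x. if x \<in> S then f x else 0)"
      by (auto simp: indicator_def)
    then show ?thesis using assms(1) by (simp add: has_integral_restrict_UNIV)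
  qed
  from nn_integral_has_integral_lborel[OF assms(3) nn *]
  show "(\<integral>\<^sup>+x. ennreal (indicator S x * f x) \<partial>lborel) = ennreal I" .
  show "0 \<le> I" by (rule has_integral_nonneg[OF assms(1,2)])
qed (use assms in simp)

lemma bochner_imp_has_integral:
  fixes f :: "real \<Rightarrow> real"
  assumes "has_bochner_integral lborel (\<lambda>x. indicator S x * f x) I"
  shows "(f has_integral I) S"
proof -
  have "((\<lambda>x. indicator S x * f x) has_integral I) UNIV"
    using assms has_integral_integral_lborel[of "\<lambda>x. indicator S x * f x"] by (simp add: has_bochner_integral_iff)
  moreover have "(\<lambda>x. indicator S x * f x) = (\<lambda>x. if x \<in> S then f x else 0)"
    by (auto simp: indicator_def)
  ultimately show ?thesis
    by (simp add: has_integral_restrict_UNIV)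
qed

lemma has_bochner_integral_Gamma:
  fixes z c :: real
  assumes z: "z > 0" and c: "c > 0"
  shows "has_bochner_integral lborel (\<lambda>t. indicator {0<..} t * (t powr (z - 1) * exp (- (t * c)))) (Gamma z / c powr z)"
proof -
  have "((\<lambda>t. t powr (z - 1) / exp t) has_integral Gamma z) {0..}"
    by (rule Gamma_integral_real[OF z])
  then have "has_bochner_integral lborel (\<lambda>t. indicator {0..} t * (t powr (z - 1) / exp t)) (Gamma z)"
    by (rule has_integral_nonneg_imp_bochner) auto
  then have "has_bochner_integral lborel (\<lambda>t. indicator {0..} (0 + c * t) * ((0 + c * t) powr (z - 1) / exp (0 + c * t))) (Gamma z /\<^sub>R \<bar>c\<bar>)"
    using c by (subst (asm) lborel_has_bochner_integral_real_affine_iff[of c _ _ 0]) auto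
  then have "has_bochner_integral lborel (\<lambda>t. c powr (1 - z) * (indicator {0..} (0 + c * t) * ((0 + c * t) powr (z - 1) / exp (0 + c * t)))) (c powr (1 - z) * (Gamma z /\<^sub>R \<bar>c\<bar>))"
    by (rule has_bochner_integral_mult_right)
  moreover have "c powr (1 - z) * (indicator {0..} (0 + c * t) * ((0 + c * t) powr (z - 1) / exp (0 + c * t)))
     = indicator {0<..} t * (t powr (z - 1) * exp (- (t * c)))" for t
  proof (cases "t > 0")
    case True
    have "c powr (1 - z) * c powr (z - 1) = 1" using c by (simp add: powr_add[symmetric])
    moreover have "(c * t) powr (z - 1) = c powr (z - 1) * t powr (z - 1)" using c True by (simp add: powr_mult)
    ultimately show ?thesis using c True
      by (simp add: exp_minus divide_inverse mult.assoc[symmetric])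
  next
    case False
    then have "c * t > 0 \<longleftrightarrow> False" "c * t = 0 \<longleftrightarrow> t = 0" using c by (auto simp: zero_less_mult_iff)
    \<comment> \<open>At t = 0 both sides vanish, since \<open>0 powr a\<close> is 0.\<close>
    then show ?thesis using False by (cases "t = 0") (auto simp: indicator_def)
  qed
  moreover have "c powr (1 - z) * (Gamma z /\<^sub>R \<bar>c\<bar>) = Gamma z / c powr z"
    using c by (simp add: powr_diff field_simps)
  ultimately show ?thesis by simp
qed

lemma has_bochner_integral_Beta:
  fixes a b :: real
  assumes a: "a > 0" and b: "b > 0"
  shows "has_bochner_integral lborel (\<lambda>n. indicator {0<..<1} n * (n powr (a - 1) * (1 - n) powr (b - 1))) (Beta a b)"
proof -
  have "has_bochner_integral lborel (\<lambda>n. indicator {0..1} n * (n powr (a - 1) * (1 - n) powr (b - 1))) (Beta a b)"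
    by (rule has_integral_nonneg_imp_bochner[OF has_integral_Beta_real[OF a b]]) auto
  \<comment> \<open>The end points contribute 0 on the left, again because \<open>0 powr a\<close>
    is 0.\<close>
  moreover have "indicator {0..1} n * (n powr (a - 1) * (1 - n) powr (b - 1)) = indicator {0<..<1} n * (n powr (a - 1) * (1 - n) powr (b - 1))" for n :: real
    by (cases "n = 0 \<or> n = 1") (auto simp: indicator_def)
  ultimately show ?thesis by simp
qed

text \<open>Substitute n / (1 - n), with derivative 1 / (1 - n)^2, into the Gamma integral. A
  bounded parameter n turns the Gaussian means into integrals of Kummer type over (0, 1).\<close>

lemma has_bochner_integral_Gamma_unit_interval:
  fixes \<alpha> X :: real
  assumes \<alpha>: "\<alpha> > 0" and X: "X > 0"
  shows "has_bochner_integral lborel (\<lambda>n. indicator {0<..<1} n * (n powr (\<alpha> - 1) * (1 - n) powr (- \<alpha> - 1) * exp (- (X * n / (1 - n)))))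
    (Gamma \<alpha> / X powr \<alpha>)"
proof -
  let ?f = "\<lambda>t::real. t powr (\<alpha> - 1) * exp (- (t * X))"
  let ?g = "\<lambda>n::real. n / (1 - n)" and ?g' = "\<lambda>n::real. 1 / (1 - n)\<^sup>2"
  let ?b = "Gamma \<alpha> / X powr \<alpha>"
  have f: "(?f has_integral ?b) {0<..}"
    by (rule bochner_imp_has_integral[OF has_bochner_integral_Gamma[OF \<alpha> X]])
  have im: "?g ` {0<..<1} = {0<..}"
  proof (intro equalityI subsetI)
    fix t :: real assume "t \<in> {0<..}"
    then show "t \<in> ?g ` {0<..<1}" by (intro image_eqI[of _ _ "t / (1 + t)"]) (auto simp: field_simps)
  qed auto
  have inj: "inj_on ?g {0<..<1}" by (rule inj_onI) (auto simp: field_simps)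
  have der: "(?g has_field_derivative ?g' n) (at n within {0<..<1})" if "n \<in> {0<..<1}" for n
    using that by (auto intro!: derivative_eq_intros simp: field_simps power2_eq_square)
  have "?f absolutely_integrable_on (?g ` {0<..<1}) \<and> integral (?g ` {0<..<1}) ?f = ?b"
    unfolding im using f by (auto intro!: nonnegative_absolutely_integrable_1 simp: has_integral_iff)
  then have "(\<lambda>n. \<bar>?g' n\<bar> * ?f (?g n)) absolutely_integrable_on {0<..<1} \<and> integral {0<..<1} (\<lambda>n. \<bar>?g' n\<bar> * ?f (?g n)) = ?b"
    by (subst has_absolute_integral_change_of_variables_1'[OF _ der inj]) auto
  then have "((\<lambda>n. \<bar>?g' n\<bar> * ?f (?g n)) has_integral ?b) {0<..<1}"
    by (auto simp: has_integral_iff absolutely_integrable_on_def)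
  moreover have "\<bar>?g' n\<bar> * ?f (?g n) = n powr (\<alpha> - 1) * (1 - n) powr (- \<alpha> - 1) * exp (- (X * n / (1 - n)))" if "n \<in> {0<..<1}" for n
  proof -
    have n: "0 < n" "n < 1" using that by auto
    have "(1 - n) powr (- \<alpha> - 1) = (1 - n) powr (-2) * (1 - n) powr (- (\<alpha> - 1))"
    proof -
      have "- \<alpha> - 1 = -2 + - (\<alpha> - 1)" by simp
      then show ?thesis by (simp only: powr_add)
    qed
    also have "\<dots> = 1 / (1 - n)\<^sup>2 / (1 - n) powr (\<alpha> - 1)"
      using n by (simp only: powr_minus) (simp add: powr_numeral divide_inverse)
    finally show ?thesis using n by (simp add: powr_divide mult.commute)
  qed
  ultimately have "((\<lambda>n. n powr (\<alpha> - 1) * (1 - n) powr (- \<alpha> - 1) * exp (- (X * n / (1 - n)))) has_integral ?b) {0<..<1}"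
    by (subst has_integral_cong[symmetric]) auto
  then show ?thesis
    by (rule has_integral_nonneg_imp_bochner) auto
qed

text \<open>Kummer's function \<open>M(a + 1, a + b + 2, -t)\<close> times \<open>Beta (a + 1) (b + 1)\<close>.\<close>

definition kummer :: "real \<Rightarrow> real \<Rightarrow> real \<Rightarrow> real" where
  "kummer a b t = (LINT n|lborel. indicator {0<..<1} n * (n powr a * (1 - n) powr b * exp (- (t * n))))"

lemma has_bochner_integral_kummer:
  assumes a: "a > -1" and b: "b > -1" and t: "t \<ge> 0"
  shows "has_bochner_integral lborel (\<lambda>n. indicator {0<..<1} n * (n powr a * (1 - n) powr b * exp (- (t * n)))) (kummer a b t)"
proof -
  have "integrable lborel (\<lambda>n. indicator {0<..<1} n * (n powr (a + 1 - 1) * (1 - n) powr (b + 1 - 1)))"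
    using has_bochner_integral_Beta[of "a + 1" "b + 1"] a b by (auto simp: has_bochner_integral_iff)
  then have "integrable lborel (\<lambda>n. indicator {0<..<1} n * (n powr a * (1 - n) powr b * exp (- (t * n))))"
  proof (rule Bochner_Integration.integrable_bound)
    show "AE n in lborel. norm (indicator {0<..<1} n * (n powr a * (1 - n) powr b * exp (- (t * n))))
       \<le> norm (indicator {0<..<1} n * (n powr (a + 1 - 1) * (1 - n) powr (b + 1 - 1)))"
      using t by (intro AE_I2) (auto simp: indicator_def abs_mult mult_le_cancel_left1)
  qed measurable
  then show ?thesis by (simp add: has_bochner_integral_iff kummer_def)
qed

lemma has_integral_kummer:
  assumes a: "a > -1" and b: "b > -1" and t: "t \<ge> 0"
  shows "((\<lambda>n. n powr a * (1 - n) powr b * exp (- (t * n))) has_integral (kummer a b t)) {0<..<1}"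
  by (rule bochner_imp_has_integral[OF has_bochner_integral_kummer[OF assms]])

lemma kummer_split:
  assumes "a > -1" "b > -1" "t \<ge> 0"
  shows "kummer a (b + 1) t = kummer a b t - kummer (a + 1) b t"
proof -
  have "((\<lambda>n. n powr a * (1 - n) powr b * exp (- (t * n)) - n powr (a + 1) * (1 - n) powr b * exp (- (t * n))) has_integral
    kummer a b t - kummer (a + 1) b t) {0<..<1}"
    using assms by (intro has_integral_diff has_integral_kummer) auto
  then have 1: "((\<lambda>n. n powr a * (1 - n) powr (b + 1) * exp (- (t * n))) has_integral
    kummer a b t - kummer (a + 1) b t) {0<..<1}"
    by (rule has_integral_eq[rotated]) (auto simp: powr_add algebra_simps)
  have 2: "((\<lambda>n. n powr a * (1 - n) powr (b + 1) * exp (- (t * n))) has_integral kummer a (b + 1) t) {0<..<1}"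
    using assms by (intro has_integral_kummer) auto
  show ?thesis using has_integral_unique[OF 1 2] by simp
qed

text \<open>Integrate the derivative of n^a (1-n)^(b+1) exp (-t n), which vanishes at both ends as a
  > 0 and b + 1 > 0. The identity serves to absorb a factor t that would spoil integrability at
  infinity.\<close>

lemma kummer_by_parts:
  assumes a: "a > 0" and b: "b > -1" and t: "t \<ge> 0"
  shows "t * kummer a (b + 1) t = a * kummer (a - 1) (b + 1) t - (b + 1) * kummer a b t"
proof -
  let ?F = "\<lambda>n::real. n powr a * (1 - n) powr (b + 1) * exp (- (t * n))"
  let ?F' = "\<lambda>n::real. a * (n powr (a - 1) * (1 - n) powr (b + 1) * exp (- (t * n)))
    - (b + 1) * (n powr a * (1 - n) powr b * exp (- (t * n))) - t * (n powr a * (1 - n) powr (b + 1) * exp (- (t * n)))"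
  have "(?F' has_integral (?F 1 - ?F 0)) {0..1}"
  proof (rule fundamental_theorem_of_calculus_interior)
    show "continuous_on {0..1} ?F"
      using a b by (intro continuous_intros continuous_on_powr') auto
    show "(?F has_vector_derivative ?F' n) (at n)" if "n \<in> {0<..<1}" for n
      using that unfolding has_real_derivative_iff_has_vector_derivative[symmetric]
      by (auto intro!: derivative_eq_intros simp: powr_diff field_simps)
  qed simp
  then have 1: "(?F' has_integral 0) {0<..<1}"
    using a b by (simp add: has_integral_Icc_iff_Ioo)
  have 2: "(?F' has_integral (a * kummer (a - 1) (b + 1) t - (b + 1) * kummer a b t - t * kummer a (b + 1) t)) {0<..<1}"
    using assms by (intro has_integral_diff has_integral_mult_right has_integral_kummer) auto
  show ?thesis using has_integral_unique[OF 1 2] by simp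
qed

text \<open>For a = 0 the primitive has the value 1 at n = 0; this boundary term is the constant
  that later cancels against the isotropic part.\<close>

lemma kummer_by_parts_zero:
  assumes b: "b > 0" and t: "t \<ge> 0"
  shows "t * kummer 0 b t = 1 - b * kummer 0 (b - 1) t"
proof -
  let ?F = "\<lambda>n::real. (1 - n) powr b * exp (- (t * n))"
  let ?F' = "\<lambda>n::real. - b * ((1 - n) powr (b - 1) * exp (- (t * n))) - t * ((1 - n) powr b * exp (- (t * n)))"
  have "(?F' has_integral (?F 1 - ?F 0)) {0..1}"
  proof (rule fundamental_theorem_of_calculus_interior)
    show "continuous_on {0..1} ?F"
      using b by (intro continuous_intros continuous_on_powr') auto
    show "(?F has_vector_derivative ?F' n) (at n)" if "n \<in> {0<..<1}" for n
      using that unfolding has_real_derivative_iff_has_vector_derivative[symmetric]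
      by (auto intro!: derivative_eq_intros simp: powr_diff field_simps)
  qed simp
  then have 1: "(?F' has_integral -1) {0<..<1}"
    using b by (simp add: has_integral_Icc_iff_Ioo)
  have "((\<lambda>n. - b * (n powr 0 * (1 - n) powr (b - 1) * exp (- (t * n))) - t * (n powr 0 * (1 - n) powr b * exp (- (t * n)))) has_integral
    (- b * kummer 0 (b - 1) t - t * kummer 0 b t)) {0<..<1}"
    using assms by (intro has_integral_diff has_integral_mult_right has_integral_kummer) auto
  then have 2: "(?F' has_integral (- b * kummer 0 (b - 1) t - t * kummer 0 b t)) {0<..<1}"
    by (rule has_integral_eq[rotated]) auto
  show ?thesis using has_integral_unique[OF 1 2] by simp
qed

text \<open>A Mellin transform: integrating over t first gives Gamma z * n^(-z), and a Beta integral
  in n remains.\<close>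

lemma has_bochner_integral_powr_kummer:
  assumes z: "z > 0" and a: "a - z > -1" and b: "b > -1"
  shows "has_bochner_integral lborel (\<lambda>t. indicator {0<..} t * (t powr (z - 1) * kummer a b t)) (Gamma z * Beta (a - z + 1) (b + 1))"
proof -
  define W where "W t n = (indicator {0<..} t * (t powr (z - 1) * exp (- (t * n)))) * (indicator {0<..<1} n * (n powr a * (1 - n) powr b))" for t n :: real
  show ?thesis
  proof (rule lborel_tonelli_swap[where W = W and g = "\<lambda>n. Gamma z * (indicator {0<..<1} n * (n powr (a - z) * (1 - n) powr b))"])
    show "case_prod W \<in> borel_measurable (lborel \<Otimes>\<^sub>M lborel)"
      unfolding W_def by measurable
    show "0 \<le> W t n" for t n by (simp add: W_def)
    show "has_bochner_integral lborel (\<lambda>t. W t n) (Gamma z * (indicator {0<..<1} n * (n powr (a - z) * (1 - n) powr b)))" for n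
    proof (cases "n \<in> {0<..<1}")
      case True
      then have "has_bochner_integral lborel (\<lambda>t. W t n) (Gamma z / n powr z * (indicator {0<..<1} n * (n powr a * (1 - n) powr b)))"
        unfolding W_def by (intro has_bochner_integral_mult_left has_bochner_integral_Gamma z) auto
      then show ?thesis using True by (simp add: powr_diff)
    next
      case False
      then have "W t n = 0" for t by (simp add: W_def indicator_def)
      moreover have "indicator {0<..<1} n = (0::real)" using False by simp
      ultimately show ?thesis by (simp add: has_bochner_integral_zero)
    qed
    show "has_bochner_integral lborel (\<lambda>n. Gamma z * (indicator {0<..<1} n * (n powr (a - z) * (1 - n) powr b))) (Gamma z * Beta (a - z + 1) (b + 1))"
      using has_bochner_integral_Beta[of "a - z + 1" "b + 1"] a b
      by (intro has_bochner_integral_mult_right) simp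
    show "has_bochner_integral lborel (\<lambda>n. W t n) (indicator {0<..} t * (t powr (z - 1) * kummer a b t))" for t
    proof (cases "t > 0")
      case True
      have "has_bochner_integral lborel (\<lambda>n. (indicator {0<..} t * t powr (z - 1)) * (indicator {0<..<1} n * (n powr a * (1 - n) powr b * exp (- (t * n)))))
         ((indicator {0<..} t * t powr (z - 1)) * kummer a b t)"
        using True z a b by (intro has_bochner_integral_mult_right has_bochner_integral_kummer) auto
      then show ?thesis by (simp add: W_def mult_ac)
    qed (simp add: W_def has_bochner_integral_zero)
  qed
qed

text \<open>Bernoulli's inequality is applied with the exponent b + 1 \<ge> 1, because (1-n)^b \<ge>
  1 - b n fails for 0 < b < 1; passing from b + 1 to b only increases the power.\<close>

lemma one_minus_powr_le:
  assumes "b \<ge> 0" "0 \<le> n" "n \<le> 1"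
  shows "0 \<le> 1 - (1 - n) powr b" "1 - (1 - n) powr b \<le> (b + 1) * (n::real)"
proof -
  show "0 \<le> 1 - (1 - n) powr b" using assms powr_le1[of b "1 - n"] by simp
  show "1 - (1 - n) powr b \<le> (b + 1) * n"
  proof (cases "n = 1")
    case True then show ?thesis using assms by simp
  next
    case False
    then have n: "n < 1" using assms by simp
    let ?p = "b + 1"
    have p: "?p > 0" "1 / ?p \<le> 1" using assms by (auto simp: field_simps)
    have "((1 - n) powr ?p) powr (1 / ?p) * 1 powr (1 - 1 / ?p) \<le> 1 / ?p * (1 - n) powr ?p + (1 - 1 / ?p) * 1"
      using n p assms by (intro Youngs_inequality_0) auto
    then have "1 - n \<le> 1 / ?p * (1 - n) powr ?p + (1 - 1 / ?p)"
      using n p by (simp add: powr_powr)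
    then have "?p * (1 - n) \<le> ?p * (1 / ?p * (1 - n) powr ?p + (1 - 1 / ?p))"
      using p by (intro mult_left_mono) auto
    also have "\<dots> = (1 - n) powr ?p + ?p - 1"
      using p by (simp add: distrib_left right_diff_distrib)
    finally have "1 - ?p * n \<le> (1 - n) powr ?p"
      by (simp add: algebra_simps)
    also have "(1 - n) powr ?p \<le> (1 - n) powr b"
      using n assms by (intro powr_mono') auto
    finally show ?thesis by simp
  qed
qed

lemma has_bochner_integral_powr_tail:
  assumes s: "s > 0"
  shows "has_bochner_integral lborel (\<lambda>n. indicator {1..} n * n powr (- s - 1)) (1 / s :: real)"
proof -
  have "((\<lambda>n. n powr (- s - 1)) has_integral (- (1 powr (- s - 1 + 1)) / (- s - 1 + 1))) {1..}"
    using s by (intro has_integral_powr_to_inf) auto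
  then have "((\<lambda>n. n powr (- s - 1)) has_integral (1 / s)) {1..}" by simp
  then show ?thesis by (rule has_integral_nonneg_imp_bochner) auto
qed

text \<open>The value is minus the analytic continuation of the Beta function to (-s, b + 1).
  Subtracting the power from 1 removes the singularity n^(-s-1) at 0, and the bracket equals 1 for n
  \<ge> 1.\<close>

lemma has_bochner_integral_powr_defect:
  fixes s b :: real
  assumes s: "0 < s" "s < 1" and b: "b \<ge> 0"
  shows "has_bochner_integral lborel (\<lambda>n. indicator {0<..} n * (n powr (- s - 1) * (1 - indicator {0<..<1} n * (1 - n) powr b)))
    (Gamma (1 - s) * Gamma (b + 1) / (s * Gamma (b + 1 - s)))"
proof -
  let ?I = "Gamma (1 - s) * Gamma (b + 1) / (s * Gamma (b + 1 - s))"
  have Gpos: "Gamma (b + 1 - s) > 0" "Gamma (1 - s) > 0" using s b by (simp_all add: Gamma_real_pos)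
  have inner: "has_bochner_integral lborel (\<lambda>n. indicator {0<..<1} n * (n powr (- s - 1) * (1 - (1 - n) powr b))) (?I - 1 / s)"
  proof (cases "b = 0")
    \<comment> \<open>For b = 0 the integrand vanishes, whereas the Beta integral used below has a
      pole there.\<close>
    case True
    have 1: "indicator {0<..<1} n * (n powr (- s - 1) * (1 - (1 - n) powr b)) = 0" for n :: real
      using True by (simp add: indicator_def)
    have 2: "?I - 1 / s = 0" using True Gpos by simp
    show ?thesis unfolding 1 2 by (rule has_bochner_integral_zero)
  next
    case False
    with b have b0: "b > 0" by simp
    \<comment> \<open>Integration by parts: the derivative of \<open>?F\<close> is \<open>?H\<close>
      - \<open>?G\<close>, where \<open>?H\<close> is a Beta integrand and \<open>?G\<close> is s
      times the integrand sought. Continuity of \<open>?F\<close> at 0 needs the bound (b + 1)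
      n^(1-s) and s < 1.\<close>
    let ?F = "\<lambda>n::real. n powr (- s) * (1 - (1 - n) powr b)"
    let ?G = "\<lambda>n::real. s * (n powr (- s - 1) * (1 - (1 - n) powr b))"
    let ?H = "\<lambda>n::real. b * (n powr ((1 - s) - 1) * (1 - n) powr (b - 1))"
    have "((\<lambda>n. ?H n - ?G n) has_integral (?F 1 - ?F 0)) {0..1}"
    proof (rule fundamental_theorem_of_calculus_interior)
      show "continuous_on {0..1} ?F"
        unfolding continuous_on_eq_continuous_within
      proof
        fix n :: real assume n: "n \<in> {0..1}"
        show "continuous (at n within {0..1}) ?F"
        proof (cases "n = 0")
          case False
          then show ?thesis using n b0 unfolding continuous_within
            by (intro tendsto_mult tendsto_diff tendsto_powr' tendsto_const tendsto_ident_at)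
              (auto simp: eventually_at_filter)
        next
          case True
          have "(?F \<longlongrightarrow> 0) (at 0 within {0..1})"
          proof (rule tendsto_sandwich[OF _ _ tendsto_const])
            show "\<forall>\<^sub>F n in at 0 within {0..1}. 0 \<le> ?F n"
              using one_minus_powr_le(1)[OF b] by (auto simp: eventually_at_filter intro!: always_eventually)
            show "\<forall>\<^sub>F n in at 0 within {0..1}. ?F n \<le> (b + 1) * n powr (1 - s)"
            proof -
              have "?F n \<le> (b + 1) * n powr (1 - s)" if "n \<noteq> 0" "n \<in> {0..1}" for n
              proof -
                have "?F n \<le> n powr (- s) * ((b + 1) * n)"
                  using that one_minus_powr_le(2)[OF b] by (intro mult_left_mono) auto
                also have "\<dots> = (b + 1) * n powr (1 - s)"
                  using that by (simp add: powr_diff powr_minus field_simps)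
                finally show ?thesis .
              qed
              then show ?thesis by (auto simp: eventually_at_filter intro!: always_eventually)
            qed
            have "((\<lambda>n. (b + 1) * n powr (1 - s)) \<longlongrightarrow> (b + 1) * 0 powr (1 - s)) (at 0 within {0..1})"
              using s by (intro tendsto_intros tendsto_powr') (auto simp: eventually_at_filter)
            then show "((\<lambda>n. (b + 1) * n powr (1 - s)) \<longlongrightarrow> 0) (at 0 within {0..1})" by simp
          qed
          then show ?thesis using True by (simp add: continuous_within)
        qed
      qed
      show "(?F has_vector_derivative ?H n - ?G n) (at n)" if "n \<in> {0<..<1}" for n
        using that unfolding has_real_derivative_iff_has_vector_derivative[symmetric]
        by (auto intro!: derivative_eq_intros simp: powr_diff powr_minus field_simps)
    qed simp
    then have 1: "((\<lambda>n. ?H n - ?G n) has_integral 1) {0<..<1}"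
      using b0 by (simp add: has_integral_Icc_iff_Ioo)
    have 2: "(?H has_integral (b * Beta (1 - s) b)) {0<..<1}"
      using s b0 by (intro has_integral_mult_right bochner_imp_has_integral has_bochner_integral_Beta) auto
    have "((\<lambda>n. (?H n - (?H n - ?G n)) / s) has_integral ((b * Beta (1 - s) b - 1) / s)) {0<..<1}"
      by (intro has_integral_divide has_integral_diff 1 2)
    then have "((\<lambda>n. n powr (- s - 1) * (1 - (1 - n) powr b)) has_integral ((b * Beta (1 - s) b - 1) / s)) {0<..<1}"
      using s by simp
    then have "has_bochner_integral lborel (\<lambda>n. indicator {0<..<1} n * (n powr (- s - 1) * (1 - (1 - n) powr b))) ((b * Beta (1 - s) b - 1) / s)"
      by (rule has_integral_nonneg_imp_bochner) (use one_minus_powr_le(1)[OF b] in auto)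
    moreover have "(b * Beta (1 - s) b - 1) / s = ?I - 1 / s"
    proof -
      have "Gamma (b + 1) = b * Gamma b"
        by (rule Gamma_plus1) (use b0 in \<open>auto elim!: nonpos_Ints_cases\<close>)
      then have "b * Beta (1 - s) b = Gamma (1 - s) * Gamma (b + 1) / Gamma (b + 1 - s)"
        by (simp add: Beta_def algebra_simps)
      then show ?thesis using s by (simp add: diff_divide_distrib)
    qed
    ultimately show ?thesis by simp
  qed
  \<comment> \<open>The tail over n \<ge> 1 contributes 1/s, which cancels the boundary
    term.\<close>
  have "has_bochner_integral lborel (\<lambda>n. indicator {0<..<1} n * (n powr (- s - 1) * (1 - (1 - n) powr b)) + indicator {1..} n * n powr (- s - 1)) (?I - 1 / s + 1 / s)"
    by (rule has_bochner_integral_add[OF inner has_bochner_integral_powr_tail[OF s(1)]])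
  moreover have "indicator {0<..<1} n * (n powr (- s - 1) * (1 - (1 - n) powr b)) + indicator {1..} n * n powr (- s - 1)
     = indicator {0<..} n * (n powr (- s - 1) * (1 - indicator {0<..<1} n * (1 - n) powr b))" for n :: real
    by (auto simp: indicator_def)
  ultimately show ?thesis by simp
qed

text \<open>Normalised so that it tends to \<open>1\<close> as \<open>t \<rightarrow> \<infinity>\<close>.\<close>

definition kummer_ratio :: "real \<Rightarrow> real \<Rightarrow> real \<Rightarrow> real" where
  "kummer_ratio a b t = t powr a * kummer (a - 1) b t / Gamma a"

text \<open>Write 1 as t^a / Gamma a times the integral of n^(a-1) exp (-t n) over (0, \<infinity>).
  Then 1 - \<open>kummer_ratio a b t\<close> is the same integral weighted by \<open>D\<close> \<ge>
  0, so Tonelli applies, and integrating over t first reduces to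
  \<open>has_bochner_integral_powr_defect\<close>.\<close>

lemma has_bochner_integral_kummer_ratio_defect:
  assumes s: "0 < s" "s < 1" and a: "a > 0" and b: "b \<ge> 0"
  shows "has_bochner_integral lborel (\<lambda>t. indicator {0<..} t * (t powr (s - 1) * (1 - kummer_ratio a b t)))
    (Gamma (s + a) / Gamma a * (Gamma (1 - s) * Gamma (b + 1) / (s * Gamma (b + 1 - s))))"
proof -
  have Ga: "Gamma a > 0" using a by (rule Gamma_real_pos)
  define D where "D n = 1 - indicator {0<..<1} n * (1 - n) powr b" for n :: real
  have D: "D n \<ge> 0" if "n > 0" for n
    using one_minus_powr_le(1)[OF b, of n] that by (auto simp: D_def indicator_def)
  have [measurable]: "D \<in> borel_measurable borel" unfolding D_def by measurable
  define W where "W t n = (indicator {0<..} t * (t powr (s + a - 1) * exp (- (t * n)))) * (indicator {0<..} n * (n powr (a - 1) * D n)) / Gamma a" for t n :: real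
  have "has_bochner_integral lborel (\<lambda>t. indicator {0<..} t * (t powr (s - 1) * (1 - kummer_ratio a b t)))
    (Gamma (s + a) / Gamma a * (Gamma (1 - s) * Gamma (b + 1) / (s * Gamma (b + 1 - s))))"
  proof (rule lborel_tonelli_swap[where W = W and g = "\<lambda>n. Gamma (s + a) / Gamma a * (indicator {0<..} n * (n powr (- s - 1) * D n))"])
    show "case_prod W \<in> borel_measurable (lborel \<Otimes>\<^sub>M lborel)"
      unfolding W_def by measurable
    show "0 \<le> W t n" for t n using D[of n] Ga by (simp add: W_def indicator_def)
    show "has_bochner_integral lborel (\<lambda>t. W t n) (Gamma (s + a) / Gamma a * (indicator {0<..} n * (n powr (- s - 1) * D n)))" for n
    proof (cases "n > 0")
      case True
      have "has_bochner_integral lborel (\<lambda>t. W t n) (Gamma (s + a) / n powr (s + a) * (indicator {0<..} n * (n powr (a - 1) * D n)) / Gamma a)"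
        unfolding W_def using True s a by (intro has_bochner_integral_divide_zero has_bochner_integral_mult_left has_bochner_integral_Gamma) auto
      moreover have "n powr (a - 1) / n powr (s + a) = n powr (- s - 1)"
      proof -
        have "a - 1 - (s + a) = - s - 1" by simp
        then show ?thesis by (metis powr_diff)
      qed
      ultimately show ?thesis using True by (simp add: field_simps)
    next
      case False
      then have "W t n = 0" for t by (simp add: W_def)
      then show ?thesis using False by (simp add: has_bochner_integral_zero)
    qed
    show "has_bochner_integral lborel (\<lambda>n. Gamma (s + a) / Gamma a * (indicator {0<..} n * (n powr (- s - 1) * D n)))
      (Gamma (s + a) / Gamma a * (Gamma (1 - s) * Gamma (b + 1) / (s * Gamma (b + 1 - s))))"
      unfolding D_def by (intro has_bochner_integral_mult_right has_bochner_integral_powr_defect s b)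
    show "has_bochner_integral lborel (\<lambda>n. W t n) (indicator {0<..} t * (t powr (s - 1) * (1 - kummer_ratio a b t)))" for t
    proof (cases "t > 0")
      case True
      have "has_bochner_integral lborel (\<lambda>n. (t powr (s + a - 1) / Gamma a) * (indicator {0<..} n * (n powr (a - 1) * exp (- (n * t)))
          - indicator {0<..<1} n * (n powr (a - 1) * (1 - n) powr b * exp (- (t * n)))))
         ((t powr (s + a - 1) / Gamma a) * (Gamma a / t powr a - kummer (a - 1) b t))"
        using True a b by (intro has_bochner_integral_mult_right has_bochner_integral_diff has_bochner_integral_Gamma has_bochner_integral_kummer) auto
      moreover have "(t powr (s + a - 1) / Gamma a) * (indicator {0<..} n * (n powr (a - 1) * exp (- (n * t)))
          - indicator {0<..<1} n * (n powr (a - 1) * (1 - n) powr b * exp (- (t * n)))) = W t n" for n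
        using True by (auto simp: W_def D_def indicator_def algebra_simps diff_divide_distrib)
      moreover have "(t powr (s + a - 1) / Gamma a) * (Gamma a / t powr a - kummer (a - 1) b t) = t powr (s - 1) * (1 - kummer_ratio a b t)"
      proof -
        have "t powr (s + a - 1) = t powr (s - 1) * t powr a" by (simp add: powr_add[symmetric] algebra_simps)
        then show ?thesis using Ga True by (simp add: kummer_ratio_def field_simps)
      qed
      ultimately show ?thesis using True by simp
    next
      case False
      then have "W t n = 0" for n by (simp add: W_def)
      then show ?thesis using False by (simp add: has_bochner_integral_zero)
    qed
  qed
  then show ?thesis .
qed

subsection \<open>The Gaussian average of the integrand\<close>

lemma powr_eq_mult_power: "x > 0 \<Longrightarrow> b = a + real k \<Longrightarrow> x powr b = x powr a * x ^ k"
  by (simp add: powr_add powr_realpow)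

text \<open>The Gamma integral for \<open>|y|\<^bsup>-2\<alpha>\<^esup>\<close>, in the variable \<open>n\<close> with rate \<open>t n / (1 - n)\<close>, turns the
  product with the Gaussian centred at \<open>x\<close> into Gaussians centred at \<open>(1 - n) x\<close>.\<close>

lemma gaussian_negative_power_weight:
  fixes x :: "'a::euclidean_space" and P :: "'a \<Rightarrow> real" and E :: "real \<Rightarrow> real"
  assumes x: "norm x = 1" and t: "t > 0" and \<alpha>: "\<alpha> > 0"
    and [measurable]: "P \<in> borel_measurable borel"
    and int: "integrable lborel (\<lambda>y. exp (- t * (norm (x - y))\<^sup>2) * (norm y powr (- 2 * \<alpha>) * P y))"
    and E: "\<And>m. 0 < m \<Longrightarrow> m < 1 \<Longrightarrow>
      has_bochner_integral lborel (\<lambda>z. exp (- (t / m) * (norm z)\<^sup>2) * P (m *\<^sub>R x + z)) ((pi / (t / m)) powr (DIM('a) / 2) * E m)"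
    and I: "has_bochner_integral lborel (\<lambda>n. indicator {0<..<1} n * (n powr (\<alpha> - 1) * (1 - n) powr (DIM('a) / 2 - \<alpha> - 1) * exp (- (t * n)) * E (1 - n))) I"
  shows "(LINT y|lborel. exp (- t * (norm (x - y))\<^sup>2) * (norm y powr (- 2 * \<alpha>) * P y)) =
     (pi / t) powr (DIM('a) / 2) * (t powr \<alpha> / Gamma \<alpha> * I)"
proof -
  let ?D = "DIM('a) / 2"
  let ?f = "\<lambda>y. exp (- t * (norm (x - y))\<^sup>2) * (norm y powr (- 2 * \<alpha>) * P y)"
  \<comment> \<open>For y \<noteq> 0 the integral of \<open>w n y\<close> over n is Gamma \<alpha> /
    t^\<alpha> times |y|^(-2 \<alpha>).\<close>
  define w where "w n y = indicator {0<..<1} n * (n powr (\<alpha> - 1) * (1 - n) powr (- \<alpha> - 1) * exp (- (t * (norm y)\<^sup>2 * n / (1 - n))))"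
    for n :: real and y :: 'a
  define W where "W n y = w n y * (exp (- t * (norm (x - y))\<^sup>2) * P y)" for n y
  have w_int: "has_bochner_integral lborel (\<lambda>n. w n y) (Gamma \<alpha> / t powr \<alpha> * norm y powr (- 2 * \<alpha>))" if "y \<noteq> 0" for y
  proof -
    have "(t * (norm y)\<^sup>2) powr \<alpha> = t powr \<alpha> * norm y powr (2 * \<alpha>)"
      using t that by (simp add: powr_mult powr_powr flip: powr_numeral)
    then have eq: "Gamma \<alpha> / (t * (norm y)\<^sup>2) powr \<alpha> = Gamma \<alpha> / t powr \<alpha> * norm y powr (- 2 * \<alpha>)"
      by (simp add: powr_minus divide_inverse)
    have "t * (norm y)\<^sup>2 > 0" using t that by simp
    from has_bochner_integral_Gamma_unit_interval[OF \<alpha> this] show ?thesis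
      unfolding w_def eq .
  qed
  have W_int: "has_bochner_integral lborel (\<lambda>n. W n y) (Gamma \<alpha> / t powr \<alpha> * ?f y)" if "y \<noteq> 0" for y
    using has_bochner_integral_mult_left[OF w_int[OF that], of "exp (- t * (norm (x - y))\<^sup>2) * P y"]
    by (simp add: W_def mult_ac)
  have W_abs: "(LINT n|lborel. \<bar>W n y\<bar>) = Gamma \<alpha> / t powr \<alpha> * \<bar>?f y\<bar>" if "y \<noteq> 0" for y
  proof -
    have "\<bar>W n y\<bar> = w n y * (exp (- t * (norm (x - y))\<^sup>2) * \<bar>P y\<bar>)" for n
      by (simp add: W_def w_def abs_mult)
    moreover have "has_bochner_integral lborel (\<lambda>n. w n y * (exp (- t * (norm (x - y))\<^sup>2) * \<bar>P y\<bar>))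
       (Gamma \<alpha> / t powr \<alpha> * norm y powr (- 2 * \<alpha>) * (exp (- t * (norm (x - y))\<^sup>2) * \<bar>P y\<bar>))"
      by (rule has_bochner_integral_mult_left) (rule w_int[OF that])
    ultimately show ?thesis
      by (simp add: has_bochner_integral_iff abs_mult mult_ac)
  qed
  have ae: "AE y in lborel. y \<noteq> (0::'a)" by (rule AE_lborel_singleton)
  have meas: "case_prod W \<in> borel_measurable (lborel \<Otimes>\<^sub>M lborel)"
    unfolding W_def w_def by measurable
  have aeint: "AE y in lborel. integrable lborel (\<lambda>n. W n y)"
    using ae by (rule eventually_mono) (use W_int in \<open>auto simp: has_bochner_integral_iff\<close>)
  have absint: "integrable lborel (\<lambda>y. LINT n|lborel. \<bar>W n y\<bar>)"
  proof (rule integrable_cong_AE_imp)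
    show "integrable lborel (\<lambda>y. Gamma \<alpha> / t powr \<alpha> * \<bar>?f y\<bar>)" using int by simp
    show "(\<lambda>y. LINT n|lborel. \<bar>W n y\<bar>) \<in> borel_measurable lborel"
      using meas by (intro lborel.borel_measurable_lebesgue_integral) (simp add: W_def w_def)
    show "AE y in lborel. Gamma \<alpha> / t powr \<alpha> * \<bar>?f y\<bar> = (LINT n|lborel. \<bar>W n y\<bar>)"
      using ae by (rule eventually_mono) (use W_abs in auto)
  qed
  note swap = lborel_fubini_swap(2)[OF meas aeint absint]
  have "(LINT y|lborel. LINT n|lborel. W n y) = (LINT y|lborel. Gamma \<alpha> / t powr \<alpha> * ?f y)"
  proof (rule integral_cong_AE)
    show "AE y in lborel. (LINT n|lborel. W n y) = Gamma \<alpha> / t powr \<alpha> * ?f y"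
      using ae by (rule eventually_mono) (use W_int in \<open>auto simp: has_bochner_integral_iff\<close>)
    show "(\<lambda>y. LINT n|lborel. W n y) \<in> borel_measurable lborel"
      by (intro lborel.borel_measurable_lebesgue_integral) (simp add: W_def w_def)
  qed measurable
  also have "\<dots> = Gamma \<alpha> / t powr \<alpha> * (LINT y|lborel. ?f y)"
    by (rule integral_mult_right_zero)
  finally have 1: "(LINT n|lborel. LINT y|lborel. W n y) = Gamma \<alpha> / t powr \<alpha> * (LINT y|lborel. ?f y)"
    using swap by simp
  have 2: "(LINT y|lborel. W n y) = (pi / t) powr ?D * (indicator {0<..<1} n * (n powr (\<alpha> - 1) * (1 - n) powr (?D - \<alpha> - 1) * exp (- (t * n)) * E (1 - n)))" for n
  proof (cases "n \<in> {0<..<1}")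
    case True
    define m where "m = 1 - n"
    have m: "0 < m" "m < 1" "n = 1 - m" using True by (auto simp: m_def)
    \<comment> \<open>Completing the square with |x| = 1 and m = 1 - n: the total rate is t n/m + t
      = t/m, the centre is m x, and the constant left over is t n.\<close>
    have expo: "exp (- (t * (norm y)\<^sup>2 * n / (1 - n))) * exp (- t * (norm (x - y))\<^sup>2) = exp (- (t * n)) * exp (- (t / m) * (norm (- (m *\<^sub>R x) + y))\<^sup>2)" for y
    proof -
      have xx: "x \<bullet> x = 1" using x by (simp add: dot_square_norm)
      have "- (t * (norm y)\<^sup>2 * n / (1 - n)) + - t * (norm (x - y))\<^sup>2 = - (t * n) + - (t / m) * (norm (- (m *\<^sub>R x) + y))\<^sup>2"
        using m(1,2) by (simp add: m(3) power2_norm_eq_inner inner_simps xx inner_commute[of y x] field_simps)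
      then show ?thesis by (simp only: exp_add[symmetric])
    qed
    have "has_bochner_integral lborel (\<lambda>y. exp (- (t / m) * (norm (- (m *\<^sub>R x) + y))\<^sup>2) * P (m *\<^sub>R x + (- (m *\<^sub>R x) + y))) ((pi / (t / m)) powr ?D * E m)"
      by (rule has_bochner_integral_lborel_translate[OF E[OF m(1,2)]])
    then have "has_bochner_integral lborel (\<lambda>y. n powr (\<alpha> - 1) * m powr (- \<alpha> - 1) * exp (- (t * n)) * (exp (- (t / m) * (norm (- (m *\<^sub>R x) + y))\<^sup>2) * P y))
       (n powr (\<alpha> - 1) * m powr (- \<alpha> - 1) * exp (- (t * n)) * ((pi / (t / m)) powr ?D * E m))"
      by (intro has_bochner_integral_mult_right) simp
    moreover have "n powr (\<alpha> - 1) * m powr (- \<alpha> - 1) * exp (- (t * n)) * (exp (- (t / m) * (norm (- (m *\<^sub>R x) + y))\<^sup>2) * P y) = W n y" for y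
    proof -
      have "W n y = n powr (\<alpha> - 1) * m powr (- \<alpha> - 1) * ((exp (- (t * (norm y)\<^sup>2 * n / (1 - n))) * exp (- t * (norm (x - y))\<^sup>2)) * P y)"
        using True by (simp add: W_def w_def m_def mult_ac)
      then show ?thesis unfolding expo by (simp only: mult_ac)
    qed
    \<comment> \<open>The mass of the narrower Gaussian supplies m^(d/2), which raises the exponent
      of 1 - n from -\<alpha> - 1 to d/2 - \<alpha> - 1.\<close>
    moreover have "(pi / (t / m)) powr ?D = (pi / t) powr ?D * m powr ?D"
    proof -
      have "pi / (t / m) = (pi / t) * m" by simp
      then show ?thesis using t m by (simp only: powr_mult)
    qed
    moreover have "m powr (- \<alpha> - 1) * m powr ?D = m powr (?D - \<alpha> - 1)"
      by (simp add: powr_add[symmetric] algebra_simps)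
    ultimately show ?thesis
      using True by (simp add: has_bochner_integral_iff m_def[symmetric] mult_ac)
  next
    case False
    then show ?thesis by (simp add: W_def w_def)
  qed
  have "(LINT n|lborel. LINT y|lborel. W n y) = (pi / t) powr ?D * I"
    unfolding 2 using I by (simp add: has_bochner_integral_iff)
  with 1 have "Gamma \<alpha> / t powr \<alpha> * (LINT y|lborel. ?f y) = (pi / t) powr ?D * I" by simp
  moreover have "Gamma \<alpha> > 0" using \<alpha> by (rule Gamma_real_pos)
  ultimately show ?thesis using t by (simp add: field_simps)
qed

lemma integrable_gaussian_translate:
  fixes f :: "'a::euclidean_space \<Rightarrow> real"
  assumes "poly_growth f" "t > 0"
  shows "integrable lborel (\<lambda>y. exp (- t * (norm (x - y))\<^sup>2) * f y)"
proof -
  have "integrable lborel (\<lambda>z. exp (- t * (norm z)\<^sup>2) * f (x + z))"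
    by (rule integrable_gaussian_poly_growth[OF poly_growth_translate[OF assms(1)] assms(2)])
  then have "has_bochner_integral lborel (\<lambda>z. exp (- t * (norm z)\<^sup>2) * f (x + z)) (LINT z|lborel. exp (- t * (norm z)\<^sup>2) * f (x + z))"
    by (simp add: has_bochner_integral_iff)
  from has_bochner_integral_lborel_translate[OF this, of "- x"]
  show ?thesis by (simp add: has_bochner_integral_iff norm_minus_commute)
qed

lemma has_bochner_integral_gaussian_translate:
  fixes f :: "'a::euclidean_space \<Rightarrow> real"
  assumes "has_bochner_integral lborel (\<lambda>z. exp (- t * (norm z)\<^sup>2) * f (x + z)) v"
  shows "has_bochner_integral lborel (\<lambda>y. exp (- t * (norm (x - y))\<^sup>2) * f y) v"
  using has_bochner_integral_lborel_translate[OF assms, of "- x"] by (simp add: norm_minus_commute)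

text \<open>For a unit vector \<open>x\<close> and \<open>h = y - x\<close>, the form \<open>p |h|\<^sup>2 + (q / 2) ((x \<bullet> h)\<^sup>2 + (sgn y \<bullet> h)\<^sup>2)\<close> is
  \<open>iso_part p q x y + (q / 2) (x \<bullet> y)\<^sup>2 / |y|\<^sup>2\<close>.\<close>

definition iso_part :: "real \<Rightarrow> real \<Rightarrow> 'a::euclidean_space \<Rightarrow> 'a \<Rightarrow> real" where
  "iso_part p q x y = p * ((x - y) \<bullet> (x - y)) + q / 2 * ((x - y) \<bullet> (x - y) - 2 * (x \<bullet> y) + (x \<bullet> y)\<^sup>2)"

lemma poly_growth_iso_part: "poly_growth (iso_part p q x)"
proof -
  have "poly_growth (\<lambda>y. (x - y) \<bullet> (x - y))"
    by (simp add: inner_simps) (intro poly_growth_intros)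
  then show ?thesis
    unfolding iso_part_def[abs_def] by (intro poly_growth_intros)
qed

lemma gaussian_integral_iso_part:
  fixes x :: "'a::euclidean_space"
  assumes x: "norm x = 1" and t: "t > 0"
  shows "has_bochner_integral lborel (\<lambda>y. exp (- t * (norm (x - y))\<^sup>2) * iso_part p q x y)
    ((pi / t) powr (DIM('a) / 2) * ((p + q / 2) * (DIM('a) / (2 * t)) + q / 2 * (1 / (2 * t) - 1)))"
proof (rule has_bochner_integral_gaussian_translate)
  have xx: "x \<bullet> x = 1" using x by (simp add: dot_square_norm)
  have "has_bochner_integral lborel (\<lambda>z. exp (- t * (norm z)\<^sup>2) * iso_part p q x (x + z))
     ((pi / t) powr (DIM('a) / 2) * (- q / 2 + (q / 2 * (x \<bullet> x) + 0 * (x \<bullet> x) + (p + q / 2) * DIM('a)) / (2 * t)))"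
    by (rule gaussian_expectation_quadratic[OF t poly_growth_translate[OF poly_growth_iso_part]])
       (simp add: iso_part_def inner_simps xx inner_commute power2_eq_square algebra_simps)
  moreover have "- q / 2 + (q / 2 * (x \<bullet> x) + 0 * (x \<bullet> x) + (p + q / 2) * DIM('a)) / (2 * t) = (p + q / 2) * (DIM('a) / (2 * t)) + q / 2 * (1 / (2 * t) - 1)"
    using t by (simp add: xx field_simps)
  ultimately show "has_bochner_integral lborel (\<lambda>z. exp (- t * (norm z)\<^sup>2) * iso_part p q x (x + z))
    ((pi / t) powr (DIM('a) / 2) * ((p + q / 2) * (DIM('a) / (2 * t)) + q / 2 * (1 / (2 * t) - 1)))"
    by simp
qed

text \<open>In each case the numerator compensates the negative power: the total degree is 1 -
  \<delta> or 0, so the function is bounded near the origin.\<close>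

lemma poly_growth_singular:
  fixes x u :: "'a::euclidean_space"
  assumes "0 \<le> \<delta>" "\<delta> \<le> 1"
  shows "poly_growth (\<lambda>y. norm y powr (- \<delta>) * (y \<bullet> u))"
    and "poly_growth (\<lambda>y. norm y powr (- \<delta> - 2) * ((x \<bullet> y)\<^sup>2 * (y \<bullet> u)))"
    and "poly_growth (\<lambda>y. norm y powr (-2) * (x \<bullet> y)\<^sup>2)"
proof -
  have le: "norm y powr (1 - \<delta>) \<le> 1 + norm y" for y :: 'a
  proof (cases "norm y \<le> 1")
    case True
    then have "norm y powr (1 - \<delta>) \<le> 1" using assms by (intro powr_le1) auto
    then show ?thesis using norm_ge_zero[of y] by linarith
  next
    case False
    then have "norm y powr (1 - \<delta>) \<le> norm y powr 1" using assms by (intro powr_mono) auto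
    then show ?thesis by simp
  qed
  have pg: "poly_growth (\<lambda>y::'a. c * (1 + norm y))" for c by (intro poly_growth_intros)
  show "poly_growth (\<lambda>y. norm y powr (- \<delta>) * (y \<bullet> u))"
  proof (rule poly_growth_bound[OF pg[of "norm u"]])
    fix y :: 'a
    have "\<bar>norm y powr (- \<delta>) * (y \<bullet> u)\<bar> \<le> norm y powr (- \<delta>) * (norm y * norm u)"
      unfolding abs_mult by (intro mult_mono Cauchy_Schwarz_ineq2) auto
    also have "\<dots> = norm u * norm y powr (1 - \<delta>)"
      by (cases "y = 0") (simp_all add: powr_diff powr_minus field_simps)
    also have "\<dots> \<le> norm u * (1 + norm y)" using le by (intro mult_left_mono) auto
    finally show "\<bar>norm y powr (- \<delta>) * (y \<bullet> u)\<bar> \<le> \<bar>norm u * (1 + norm y)\<bar>" by simp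
  qed measurable
  have sq: "(x \<bullet> y)\<^sup>2 \<le> (norm x)\<^sup>2 * (norm y)\<^sup>2" for y
    using Cauchy_Schwarz_ineq[of x y] by (simp add: power2_norm_eq_inner)
  show "poly_growth (\<lambda>y. norm y powr (- \<delta> - 2) * ((x \<bullet> y)\<^sup>2 * (y \<bullet> u)))"
  proof (rule poly_growth_bound[OF pg[of "(norm x)\<^sup>2 * norm u"]])
    fix y :: 'a
    have "\<bar>norm y powr (- \<delta> - 2) * ((x \<bullet> y)\<^sup>2 * (y \<bullet> u))\<bar> \<le> norm y powr (- \<delta> - 2) * (((norm x)\<^sup>2 * (norm y)\<^sup>2) * (norm y * norm u))"
      unfolding abs_mult using sq by (intro mult_mono Cauchy_Schwarz_ineq2) auto
    also have "\<dots> = (norm x)\<^sup>2 * norm u * norm y powr (1 - \<delta>)"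
      by (cases "y = 0") (simp_all add: powr_diff powr_minus powr_numeral field_simps)
    also have "\<dots> \<le> (norm x)\<^sup>2 * norm u * (1 + norm y)" using le by (intro mult_left_mono) auto
    finally show "\<bar>norm y powr (- \<delta> - 2) * ((x \<bullet> y)\<^sup>2 * (y \<bullet> u))\<bar> \<le> \<bar>(norm x)\<^sup>2 * norm u * (1 + norm y)\<bar>"
      by (simp add: abs_mult)
  qed measurable
  show "poly_growth (\<lambda>y. norm y powr (-2) * (x \<bullet> y)\<^sup>2)"
  proof (rule poly_growth_bound[OF poly_growth_const[of "(norm x)\<^sup>2"]])
    fix y :: 'a
    have "\<bar>norm y powr (-2) * (x \<bullet> y)\<^sup>2\<bar> \<le> norm y powr (-2) * ((norm x)\<^sup>2 * (norm y)\<^sup>2)"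
      unfolding abs_mult using sq by (intro mult_mono) auto
    also have "\<dots> \<le> (norm x)\<^sup>2"
      by (cases "y = 0") (simp_all add: powr_minus powr_numeral field_simps)
    finally show "\<bar>norm y powr (-2) * (x \<bullet> y)\<^sup>2\<bar> \<le> \<bar>(norm x)\<^sup>2\<bar>" by simp
  qed measurable
qed

lemma gaussian_integral_radial_part:
  fixes x :: "'a::euclidean_space"
  assumes x: "norm x = 1" and t: "t > 0" and d: "DIM('a) \<ge> 2"
  shows "(LINT y|lborel. exp (- t * (norm (x - y))\<^sup>2) * (norm y powr (-2) * (x \<bullet> y)\<^sup>2)) =
    (pi / t) powr (DIM('a) / 2) * (t * kummer 0 (DIM('a) / 2) t + kummer 0 (DIM('a) / 2 - 1) t / 2)"
proof -
  have xx: "x \<bullet> x = 1" using x by (simp add: dot_square_norm)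
  let ?D = "DIM('a) / 2"
  \<comment> \<open>The mean of (x . y)^2 for the Gaussian of rate t/m about m x. The weight lemma
    is used with \<alpha> = 1, which is why the power -2 is written as -2 * 1.\<close>
  let ?E = "\<lambda>m::real. m\<^sup>2 + m / (2 * t)"
  have "(LINT y|lborel. exp (- t * (norm (x - y))\<^sup>2) * (norm y powr (- 2 * 1) * (x \<bullet> y)\<^sup>2)) =
    (pi / t) powr ?D * (t powr 1 / Gamma 1 * (kummer 0 ?D t + 1 / (2 * t) * kummer 0 (?D - 1) t))"
  proof (rule gaussian_negative_power_weight[OF x t])
    show "integrable lborel (\<lambda>y. exp (- t * (norm (x - y))\<^sup>2) * (norm y powr (- 2 * 1) * (x \<bullet> y)\<^sup>2))"
      using integrable_gaussian_translate[OF poly_growth_singular(3)[of 0] t] by simp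
    show "has_bochner_integral lborel (\<lambda>z. exp (- (t / m) * (norm z)\<^sup>2) * (x \<bullet> (m *\<^sub>R x + z))\<^sup>2) ((pi / (t / m)) powr ?D * ?E m)"
      if m: "0 < m" "m < 1" for m :: real
    proof -
      have "has_bochner_integral lborel (\<lambda>z. exp (- (t / m) * (norm z)\<^sup>2) * (x \<bullet> (m *\<^sub>R x + z))\<^sup>2)
        ((pi / (t / m)) powr ?D * (m\<^sup>2 + (1 * (x \<bullet> x) + 0 * (x \<bullet> x) + 0 * real DIM('a)) / (2 * (t / m))))"
      proof (rule gaussian_expectation_quadratic)
        show "poly_growth (\<lambda>z. (x \<bullet> (m *\<^sub>R x + z))\<^sup>2)"
          by (rule poly_growth_translate[of "\<lambda>y. (x \<bullet> y)\<^sup>2"]) (intro poly_growth_intros)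
      qed (use t m in \<open>auto simp: inner_simps xx inner_commute power2_eq_square algebra_simps\<close>)
      then show ?thesis using t m by (simp add: xx)
    qed
    have "has_bochner_integral lborel (\<lambda>n. indicator {0<..<1} n * (n powr 0 * (1 - n) powr ?D * exp (- (t * n)))
       + 1 / (2 * t) * (indicator {0<..<1} n * (n powr 0 * (1 - n) powr (?D - 1) * exp (- (t * n)))))
      (kummer 0 ?D t + 1 / (2 * t) * kummer 0 (?D - 1) t)"
      using d t by (intro has_bochner_integral_add has_bochner_integral_mult_right has_bochner_integral_kummer) auto
    moreover have "indicator {0<..<1} n * (n powr 0 * (1 - n) powr ?D * exp (- (t * n)))
       + 1 / (2 * t) * (indicator {0<..<1} n * (n powr 0 * (1 - n) powr (?D - 1) * exp (- (t * n))))
       = indicator {0<..<1} n * (n powr (1 - 1) * (1 - n) powr (?D - 1 - 1) * exp (- (t * n)) * ?E (1 - n))" for n :: real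
    proof (cases "n \<in> {0<..<1}")
      case True
      then have n: "1 - n > 0" by simp
      have a: "(1 - n) powr (?D - 1) = (1 - n) powr (?D - 1 - 1) * (1 - n) ^ 1" "(1 - n) powr ?D = (1 - n) powr (?D - 1 - 1) * (1 - n) ^ 2"
        by (rule powr_eq_mult_power[OF n]; simp)+
      show ?thesis unfolding a using True by (simp add: algebra_simps diff_divide_distrib add_divide_distrib)
    qed simp
    ultimately show "has_bochner_integral lborel (\<lambda>n. indicator {0<..<1} n * (n powr (1 - 1) * (1 - n) powr (?D - 1 - 1) * exp (- (t * n)) * ?E (1 - n)))
      (kummer 0 ?D t + 1 / (2 * t) * kummer 0 (?D - 1) t)"
      by (simp only: )
  qed auto
  moreover have "t powr 1 / Gamma 1 * (kummer 0 ?D t + 1 / (2 * t) * kummer 0 (?D - 1) t) = t * kummer 0 ?D t + kummer 0 (?D - 1) t / 2"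
    using t by (simp add: field_simps)
  ultimately show ?thesis by simp
qed

text \<open>The mean \<open>E m\<close> of the cubic numerator is divisible by m = 1 - n: it equals
  (x . u) (1-n) (k0 + k1 n + (p + q) n^2). The extra factor turns the weight exponent \<beta> - 1
  into \<beta>, and the three powers of n give three Kummer integrals with the same \<beta>.\<close>

lemma gaussian_integral_singular_iso_part:
  fixes x u :: "'a::euclidean_space" and t \<alpha> p q :: real
  assumes x: "norm x = 1" and t: "t > 0" and \<alpha>: "0 < \<alpha>" "2 * \<alpha> \<le> 1" and d: "DIM('a) \<ge> 2"
  defines "\<beta> \<equiv> DIM('a) / 2 - \<alpha>"
  shows "(LINT y|lborel. exp (- t * (norm (x - y))\<^sup>2) * (norm y powr (- 2 * \<alpha>) * ((y \<bullet> u) * iso_part p q x y))) =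
    (pi / t) powr (DIM('a) / 2) * (t powr \<alpha> / Gamma \<alpha> * ((x \<bullet> u) *
      ((p * real DIM('a) / (2 * t) + q / 2 * (-1 + (real DIM('a) + 1) / (2 * t))) * kummer (\<alpha> - 1) \<beta> t
       + (- (p * (real DIM('a) + 2) + q / 2 * (real DIM('a) + 5)) / (2 * t)) * kummer \<alpha> \<beta> t
       + (p + q) * kummer (\<alpha> + 1) \<beta> t)))"
proof -
  have xx: "x \<bullet> x = 1" using x by (simp add: dot_square_norm)
  let ?d = "real DIM('a)"
  define \<xi> where "\<xi> = x \<bullet> u"
  define E where "E m = \<xi> * m * (p * (1 - m)\<^sup>2 + q / 2 * (1 - 4 * m + 2 * m\<^sup>2) +
    (p * ((?d + 2) * m - 2) + q / 2 * ((?d + 5) * m - 4)) / (2 * t))" for m :: real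
  define k0 where "k0 = p * ?d / (2 * t) + q / 2 * (-1 + (?d + 1) / (2 * t))"
  define k1 where "k1 = - (p * (?d + 2) + q / 2 * (?d + 5)) / (2 * t)"
  have pg: "poly_growth (\<lambda>y. (y \<bullet> u) * iso_part p q x y)"
    by (intro poly_growth_intros poly_growth_iso_part)
  have \<beta>: "\<beta> > 0" using \<alpha> d by (simp add: \<beta>_def)
  have "(LINT y|lborel. exp (- t * (norm (x - y))\<^sup>2) * (norm y powr (- 2 * \<alpha>) * ((y \<bullet> u) * iso_part p q x y))) =
    (pi / t) powr (DIM('a) / 2) * (t powr \<alpha> / Gamma \<alpha> * (\<xi> * (k0 * kummer (\<alpha> - 1) \<beta> t + k1 * kummer \<alpha> \<beta> t + (p + q) * kummer (\<alpha> + 1) \<beta> t)))"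
  proof (rule gaussian_negative_power_weight[OF x t \<alpha>(1)])
    show "(\<lambda>y. (y \<bullet> u) * iso_part p q x y) \<in> borel_measurable borel"
      using pg by (simp add: poly_growth_def)
    have "poly_growth (\<lambda>y. (norm y powr (- (2 * \<alpha>)) * (y \<bullet> u)) * iso_part p q x y)"
      using \<alpha> by (intro poly_growth_mult poly_growth_singular poly_growth_iso_part) auto
    from integrable_gaussian_translate[OF this t, of x]
    show "integrable lborel (\<lambda>y. exp (- t * (norm (x - y))\<^sup>2) * (norm y powr (- 2 * \<alpha>) * ((y \<bullet> u) * iso_part p q x y)))"
      by (simp add: mult.assoc)
    show "has_bochner_integral lborel (\<lambda>z. exp (- (t / m) * (norm z)\<^sup>2) * (((m *\<^sub>R x + z) \<bullet> u) * iso_part p q x (m *\<^sub>R x + z)))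
        ((pi / (t / m)) powr (DIM('a) / 2) * E m)" if m: "0 < m" "m < 1" for m :: real
    proof -
      \<comment> \<open>Coefficients of the even part in z. The linear part of
        \<open>iso_part\<close> at m x + z is -2 (1-m) (p + q) (z . x), and its product with z . u
        gives \<open>c2\<close>.\<close>
      define c0 where "c0 = m * \<xi> * (p * (1 - m)\<^sup>2 + q / 2 * (1 - 4 * m + 2 * m\<^sup>2))"
      define c1 where "c1 = m * \<xi> * (q / 2)"
      define c2 where "c2 = - 2 * (1 - m) * (p + q)"
      define c3 where "c3 = m * \<xi> * (p + q / 2)"
      have "t / m > 0" using t m by simp
      moreover have "poly_growth (\<lambda>z. ((m *\<^sub>R x + z) \<bullet> u) * iso_part p q x (m *\<^sub>R x + z))"
        by (rule poly_growth_translate[OF pg])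
      moreover have "((m *\<^sub>R x + z) \<bullet> u) * iso_part p q x (m *\<^sub>R x + z) + ((m *\<^sub>R x + - z) \<bullet> u) * iso_part p q x (m *\<^sub>R x + - z)
          = 2 * (c0 + c1 * ((z \<bullet> x) * (z \<bullet> x)) + c2 * ((z \<bullet> x) * (z \<bullet> u)) + c3 * (z \<bullet> z))" for z
      proof -
        define \<zeta> where "\<zeta> = z \<bullet> x"
        define \<eta> where "\<eta> = z \<bullet> u"
        define N where "N = z \<bullet> z"
        have xz: "x \<bullet> z = \<zeta>" by (simp add: \<zeta>_def inner_commute)
        have a: "(m *\<^sub>R x + z) \<bullet> u = m * \<xi> + \<eta>" "(m *\<^sub>R x + - z) \<bullet> u = m * \<xi> - \<eta>"
          by (simp_all add: inner_simps \<xi>_def \<eta>_def)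
        have b: "iso_part p q x (m *\<^sub>R x + z) = p * ((1 - m)\<^sup>2 - 2 * (1 - m) * \<zeta> + N) + q / 2 * (((1 - m)\<^sup>2 - 2 * (1 - m) * \<zeta> + N) - 2 * (m + \<zeta>) + (m + \<zeta>)\<^sup>2)"
          "iso_part p q x (m *\<^sub>R x + - z) = p * ((1 - m)\<^sup>2 + 2 * (1 - m) * \<zeta> + N) + q / 2 * (((1 - m)\<^sup>2 + 2 * (1 - m) * \<zeta> + N) - 2 * (m - \<zeta>) + (m - \<zeta>)\<^sup>2)"
          unfolding iso_part_def
          by (simp_all add: inner_simps xx xz \<zeta>_def[symmetric] N_def[symmetric] power2_eq_square) (simp_all add: algebra_simps)
        show ?thesis
          unfolding a b c0_def c1_def c2_def c3_def \<zeta>_def[symmetric] \<eta>_def[symmetric] N_def[symmetric]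
          by (simp add: power2_eq_square field_simps)
      qed
      ultimately have "has_bochner_integral lborel (\<lambda>z. exp (- (t / m) * (norm z)\<^sup>2) * (((m *\<^sub>R x + z) \<bullet> u) * iso_part p q x (m *\<^sub>R x + z)))
        ((pi / (t / m)) powr (DIM('a) / 2) * (c0 + (c1 * (x \<bullet> x) + c2 * (x \<bullet> u) + c3 * DIM('a)) / (2 * (t / m))))"
        by (rule gaussian_expectation_quadratic)
      moreover have "c0 + (c1 * (x \<bullet> x) + c2 * (x \<bullet> u) + c3 * DIM('a)) / (2 * (t / m)) = E m"
        unfolding E_def c0_def c1_def c2_def c3_def \<xi>_def[symmetric] xx using t m by (simp add: field_simps)
      ultimately show ?thesis by simp
    qed
    have "has_bochner_integral lborel (\<lambda>n. \<xi> * (k0 * (indicator {0<..<1} n * (n powr (\<alpha> - 1) * (1 - n) powr \<beta> * exp (- (t * n))))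
        + k1 * (indicator {0<..<1} n * (n powr \<alpha> * (1 - n) powr \<beta> * exp (- (t * n))))
        + (p + q) * (indicator {0<..<1} n * (n powr (\<alpha> + 1) * (1 - n) powr \<beta> * exp (- (t * n))))))
      (\<xi> * (k0 * kummer (\<alpha> - 1) \<beta> t + k1 * kummer \<alpha> \<beta> t + (p + q) * kummer (\<alpha> + 1) \<beta> t))"
      using \<alpha> \<beta> t by (intro has_bochner_integral_add has_bochner_integral_mult_right has_bochner_integral_kummer) auto
    moreover have "\<xi> * (k0 * (indicator {0<..<1} n * (n powr (\<alpha> - 1) * (1 - n) powr \<beta> * exp (- (t * n))))
        + k1 * (indicator {0<..<1} n * (n powr \<alpha> * (1 - n) powr \<beta> * exp (- (t * n))))
        + (p + q) * (indicator {0<..<1} n * (n powr (\<alpha> + 1) * (1 - n) powr \<beta> * exp (- (t * n)))))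
      = indicator {0<..<1} n * (n powr (\<alpha> - 1) * (1 - n) powr (DIM('a) / 2 - \<alpha> - 1) * exp (- (t * n)) * E (1 - n))" for n
    proof (cases "n \<in> {0<..<1}")
      case True
      then have n: "n > 0" "1 - n > 0" by auto
      have 1: "n powr \<alpha> = n powr (\<alpha> - 1) * n ^ 1" "n powr (\<alpha> + 1) = n powr (\<alpha> - 1) * n ^ 2"
        by (rule powr_eq_mult_power[OF n(1)]; simp)+
      have 2: "(1 - n) powr \<beta> = (1 - n) powr (DIM('a) / 2 - \<alpha> - 1) * (1 - n) ^ 1"
        by (rule powr_eq_mult_power[OF n(2)]) (simp add: \<beta>_def)
      have 3: "E (1 - n) = \<xi> * (1 - n) * (k0 + k1 * n + (p + q) * n\<^sup>2)"
        unfolding E_def k0_def k1_def using t by (simp add: field_simps power2_eq_square)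
      show ?thesis unfolding 1 2 3 using True by (simp add: algebra_simps)
    qed simp
    ultimately show "has_bochner_integral lborel (\<lambda>n. indicator {0<..<1} n * (n powr (\<alpha> - 1) * (1 - n) powr (DIM('a) / 2 - \<alpha> - 1) * exp (- (t * n)) * E (1 - n)))
      (\<xi> * (k0 * kummer (\<alpha> - 1) \<beta> t + k1 * kummer \<alpha> \<beta> t + (p + q) * kummer (\<alpha> + 1) \<beta> t))"
      by (simp only: )
  qed
  then show ?thesis by (simp only: k0_def k1_def \<xi>_def)
qed

lemma gaussian_integral_singular_radial_part:
  fixes x u :: "'a::euclidean_space" and t \<alpha> p q :: real
  assumes x: "norm x = 1" and t: "t > 0" and \<alpha>: "0 < \<alpha>" "2 * \<alpha> \<le> 1" and d: "DIM('a) \<ge> 2"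
  defines "\<beta> \<equiv> DIM('a) / 2 - \<alpha>"
  shows "(LINT y|lborel. exp (- t * (norm (x - y))\<^sup>2) * (norm y powr (- 2 * (\<alpha> + 1)) * ((x \<bullet> y)\<^sup>2 * (y \<bullet> u)))) =
    (pi / t) powr (DIM('a) / 2) * (t powr (\<alpha> + 1) / Gamma (\<alpha> + 1) * ((x \<bullet> u) *
      (kummer \<alpha> (\<beta> + 1) t + 3 / (2 * t) * kummer \<alpha> \<beta> t)))"
proof -
  have xx: "x \<bullet> x = 1" using x by (simp add: dot_square_norm)
  define \<xi> where "\<xi> = x \<bullet> u"
  \<comment> \<open>The mean of (x . y)^2 (y . u) for the Gaussian about m x. Its divisibility by
    m^2 offsets the weight exponent d/2 - \<alpha> - 2, which alone would not be integrable for d =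
    2.\<close>
  define E where "E m = \<xi> * (m ^ 3 + 3 * m\<^sup>2 / (2 * t))" for m :: real
  have pg: "poly_growth (\<lambda>y. (x \<bullet> y)\<^sup>2 * (y \<bullet> u))"
    by (intro poly_growth_intros)
  have \<beta>: "\<beta> > 0" using \<alpha> d by (simp add: \<beta>_def)
  have \<alpha>1: "\<alpha> + 1 > 0" using \<alpha> by simp
  have "(LINT y|lborel. exp (- t * (norm (x - y))\<^sup>2) * (norm y powr (- 2 * (\<alpha> + 1)) * ((x \<bullet> y)\<^sup>2 * (y \<bullet> u)))) =
    (pi / t) powr (DIM('a) / 2) * (t powr (\<alpha> + 1) / Gamma (\<alpha> + 1) * (\<xi> * (kummer \<alpha> (\<beta> + 1) t + 3 / (2 * t) * kummer \<alpha> \<beta> t)))"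
  proof (rule gaussian_negative_power_weight[OF x t \<alpha>1])
    show "(\<lambda>y. (x \<bullet> y)\<^sup>2 * (y \<bullet> u)) \<in> borel_measurable borel"
      using pg by (simp add: poly_growth_def)
    have "poly_growth (\<lambda>y. norm y powr (- (2 * \<alpha>) - 2) * ((x \<bullet> y)\<^sup>2 * (y \<bullet> u)))"
      using \<alpha> by (intro poly_growth_singular) auto
    note * = integrable_gaussian_translate[OF this t, of x]
    show "integrable lborel (\<lambda>y. exp (- t * (norm (x - y))\<^sup>2) * (norm y powr (- 2 * (\<alpha> + 1)) * ((x \<bullet> y)\<^sup>2 * (y \<bullet> u))))"
    proof -
      have "- 2 * (\<alpha> + 1) = - (2 * \<alpha>) - 2" by simp
      then show ?thesis using * by (simp only: mult.assoc)
    qed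
    show "has_bochner_integral lborel (\<lambda>z. exp (- (t / m) * (norm z)\<^sup>2) * ((x \<bullet> (m *\<^sub>R x + z))\<^sup>2 * ((m *\<^sub>R x + z) \<bullet> u)))
        ((pi / (t / m)) powr (DIM('a) / 2) * E m)" if m: "0 < m" "m < 1" for m :: real
    proof -
      have "t / m > 0" using t m by simp
      moreover have "poly_growth (\<lambda>z. (x \<bullet> (m *\<^sub>R x + z))\<^sup>2 * ((m *\<^sub>R x + z) \<bullet> u))"
        by (rule poly_growth_translate[OF pg])
      moreover have "(x \<bullet> (m *\<^sub>R x + z))\<^sup>2 * ((m *\<^sub>R x + z) \<bullet> u) + (x \<bullet> (m *\<^sub>R x + - z))\<^sup>2 * ((m *\<^sub>R x + - z) \<bullet> u)
          = 2 * (m ^ 3 * \<xi> + m * \<xi> * ((z \<bullet> x) * (z \<bullet> x)) + 2 * m * ((z \<bullet> x) * (z \<bullet> u)) + 0 * (z \<bullet> z))" for z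
        by (simp add: inner_simps xx \<xi>_def[symmetric] inner_commute[of x z]) (simp add: power2_eq_square power3_eq_cube algebra_simps)
      ultimately have "has_bochner_integral lborel (\<lambda>z. exp (- (t / m) * (norm z)\<^sup>2) * ((x \<bullet> (m *\<^sub>R x + z))\<^sup>2 * ((m *\<^sub>R x + z) \<bullet> u)))
        ((pi / (t / m)) powr (DIM('a) / 2) * (m ^ 3 * \<xi> + (m * \<xi> * (x \<bullet> x) + 2 * m * (x \<bullet> u) + 0 * real DIM('a)) / (2 * (t / m))))"
        by (rule gaussian_expectation_quadratic)
      moreover have "m ^ 3 * \<xi> + (m * \<xi> * (x \<bullet> x) + 2 * m * (x \<bullet> u) + 0 * real DIM('a)) / (2 * (t / m)) = E m"
        unfolding E_def \<xi>_def[symmetric] xx using t m by (simp add: field_simps power2_eq_square)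
      ultimately show ?thesis by simp
    qed
    have "has_bochner_integral lborel (\<lambda>n. \<xi> * (indicator {0<..<1} n * (n powr \<alpha> * (1 - n) powr (\<beta> + 1) * exp (- (t * n)))
        + 3 / (2 * t) * (indicator {0<..<1} n * (n powr \<alpha> * (1 - n) powr \<beta> * exp (- (t * n))))))
      (\<xi> * (kummer \<alpha> (\<beta> + 1) t + 3 / (2 * t) * kummer \<alpha> \<beta> t))"
      using \<alpha> \<beta> t by (intro has_bochner_integral_add has_bochner_integral_mult_right has_bochner_integral_kummer) auto
    moreover have "\<xi> * (indicator {0<..<1} n * (n powr \<alpha> * (1 - n) powr (\<beta> + 1) * exp (- (t * n)))
        + 3 / (2 * t) * (indicator {0<..<1} n * (n powr \<alpha> * (1 - n) powr \<beta> * exp (- (t * n)))))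
      = indicator {0<..<1} n * (n powr (\<alpha> + 1 - 1) * (1 - n) powr (DIM('a) / 2 - (\<alpha> + 1) - 1) * exp (- (t * n)) * E (1 - n))" for n
    proof (cases "n \<in> {0<..<1}")
      case True
      then have n: "1 - n > 0" by auto
      have 2: "(1 - n) powr \<beta> = (1 - n) powr (DIM('a) / 2 - (\<alpha> + 1) - 1) * (1 - n) ^ 2"
        "(1 - n) powr (\<beta> + 1) = (1 - n) powr (DIM('a) / 2 - (\<alpha> + 1) - 1) * (1 - n) ^ 3"
        by (rule powr_eq_mult_power[OF n]; simp add: \<beta>_def)+
      show ?thesis unfolding 2 E_def using True by (simp add: algebra_simps)
    qed simp
    ultimately show "has_bochner_integral lborel (\<lambda>n. indicator {0<..<1} n * (n powr (\<alpha> + 1 - 1) * (1 - n) powr (DIM('a) / 2 - (\<alpha> + 1) - 1) * exp (- (t * n)) * E (1 - n)))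
      (\<xi> * (kummer \<alpha> (\<beta> + 1) t + 3 / (2 * t) * kummer \<alpha> \<beta> t))"
      by (simp only: )
  qed
  then show ?thesis by (simp only: \<xi>_def)
qed

text \<open>Arranged so that each summand times \<open>t\<^sup>s\<close> is integrable on \<open>(0, \<infinity>)\<close>.\<close>

definition averaged_defect :: "real \<Rightarrow> real \<Rightarrow> real \<Rightarrow> real \<Rightarrow> real \<Rightarrow> real" where
  "averaged_defect d \<alpha> p q t =
     (p * d + q / 2 * (d + 1)) / 2 * ((1 - kummer_ratio \<alpha> (d / 2 - \<alpha>) t) / t)
     - q * (d - 1) / 4 * ((1 - kummer_ratio (\<alpha> + 1) (d / 2 - \<alpha>) t) / t - (1 - kummer_ratio 1 (d / 2 - 1) t) / t)
     - (p + q) / Gamma \<alpha> * (t powr \<alpha> * kummer (\<alpha> + 1) (d / 2 - \<alpha>) t)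
     + (p * (d + 2) + q / 2 * (d + 5)) / (2 * Gamma \<alpha>) * (t powr \<alpha> * kummer \<alpha> (d / 2 - \<alpha>) t / t)"

text \<open>Expanding the product gives four integrals. The constant -q/2 of the isotropic one
  cancels against the boundary term 1 of \<open>kummer_by_parts_zero\<close>, and in the two
  singular ones the q/2 multiples of \<open>K0\<close> without a factor 1/t cancel through
  \<open>kummer_by_parts\<close>. What is left groups into the differences of
  \<open>averaged_defect\<close>.\<close>

lemma gaussian_integral_defect:
  fixes x u :: "'a::euclidean_space" and t \<alpha> p q :: real
  assumes x: "norm x = 1" and t: "t > 0" and \<alpha>: "0 < \<alpha>" "2 * \<alpha> \<le> 1" and d: "DIM('a) \<ge> 2"
  shows "has_bochner_integral lborel (\<lambda>y. exp (- t * (norm (x - y))\<^sup>2) *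
      ((iso_part p q x y + q / 2 * (norm y powr (-2) * (x \<bullet> y)\<^sup>2)) * (x \<bullet> u - norm y powr (- 2 * \<alpha>) * (y \<bullet> u))))
    ((pi / t) powr (DIM('a) / 2) * ((x \<bullet> u) * averaged_defect (DIM('a)) \<alpha> p q t))"
proof -
  let ?e = "\<lambda>y. exp (- t * (norm (x - y))\<^sup>2)"
  let ?P = "(pi / t) powr (DIM('a) / 2)"
  define d' where "d' = real DIM('a)"
  define \<beta> where "\<beta> = d' / 2 - \<alpha>"
  define \<xi> where "\<xi> = x \<bullet> u"
  have i1: "integrable lborel (\<lambda>y. ?e y * iso_part p q x y)"
    by (rule integrable_gaussian_translate[OF poly_growth_iso_part t])
  have v1: "(LINT y|lborel. ?e y * iso_part p q x y) = ?P * ((p + q / 2) * (d' / (2 * t)) + q / 2 * (1 / (2 * t) - 1))"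
    using gaussian_integral_iso_part[OF x t, of p q] by (simp add: has_bochner_integral_iff d'_def)
  have i2: "integrable lborel (\<lambda>y. ?e y * (norm y powr (-2) * (x \<bullet> y)\<^sup>2))"
    by (rule integrable_gaussian_translate[OF poly_growth_singular(3)[of 0] t]) auto
  note v2 = gaussian_integral_radial_part[OF x t d, folded d'_def]
  have "poly_growth (\<lambda>y. (norm y powr (- (2 * \<alpha>)) * (y \<bullet> u)) * iso_part p q x y)"
    using \<alpha> by (intro poly_growth_mult poly_growth_singular poly_growth_iso_part) auto
  from integrable_gaussian_translate[OF this t, of x]
  have i3: "integrable lborel (\<lambda>y. ?e y * (norm y powr (- 2 * \<alpha>) * ((y \<bullet> u) * iso_part p q x y)))"
    by (simp add: mult.assoc)
  note v3 = gaussian_integral_singular_iso_part[OF x t \<alpha> d, of u p q, folded d'_def, folded \<beta>_def \<xi>_def]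
  have "poly_growth (\<lambda>y. norm y powr (- (2 * \<alpha>) - 2) * ((x \<bullet> y)\<^sup>2 * (y \<bullet> u)))"
    using \<alpha> by (intro poly_growth_singular) auto
  note * = integrable_gaussian_translate[OF this t, of x]
  have e4: "- 2 * (\<alpha> + 1) = - (2 * \<alpha>) - 2" by simp
  have i4: "integrable lborel (\<lambda>y. ?e y * (norm y powr (- 2 * (\<alpha> + 1)) * ((x \<bullet> y)\<^sup>2 * (y \<bullet> u))))"
    unfolding e4 using * by (simp only: mult.assoc)
  note v4 = gaussian_integral_singular_radial_part[OF x t \<alpha> d, of u, folded d'_def, folded \<beta>_def \<xi>_def]
  have "has_bochner_integral lborel (\<lambda>y. \<xi> * (?e y * iso_part p q x y) + \<xi> * (q / 2) * (?e y * (norm y powr (-2) * (x \<bullet> y)\<^sup>2))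
      - ?e y * (norm y powr (- 2 * \<alpha>) * ((y \<bullet> u) * iso_part p q x y))
      - q / 2 * (?e y * (norm y powr (- 2 * (\<alpha> + 1)) * ((x \<bullet> y)\<^sup>2 * (y \<bullet> u)))))
    (\<xi> * (LINT y|lborel. ?e y * iso_part p q x y) + \<xi> * (q / 2) * (LINT y|lborel. ?e y * (norm y powr (-2) * (x \<bullet> y)\<^sup>2))
      - (LINT y|lborel. ?e y * (norm y powr (- 2 * \<alpha>) * ((y \<bullet> u) * iso_part p q x y)))
      - q / 2 * (LINT y|lborel. ?e y * (norm y powr (- 2 * (\<alpha> + 1)) * ((x \<bullet> y)\<^sup>2 * (y \<bullet> u)))))"
    by (intro has_bochner_integral_add has_bochner_integral_diff has_bochner_integral_mult_right has_bochner_integral_integrable i1 i2 i3 i4)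
  moreover have "\<xi> * (?e y * iso_part p q x y) + \<xi> * (q / 2) * (?e y * (norm y powr (-2) * (x \<bullet> y)\<^sup>2))
      - ?e y * (norm y powr (- 2 * \<alpha>) * ((y \<bullet> u) * iso_part p q x y))
      - q / 2 * (?e y * (norm y powr (- 2 * (\<alpha> + 1)) * ((x \<bullet> y)\<^sup>2 * (y \<bullet> u))))
    = ?e y * ((iso_part p q x y + q / 2 * (norm y powr (-2) * (x \<bullet> y)\<^sup>2)) * (x \<bullet> u - norm y powr (- 2 * \<alpha>) * (y \<bullet> u)))" for y
  proof -
    have "- 2 * (\<alpha> + 1) = -2 + - 2 * \<alpha>" by simp
    then have 1: "norm y powr (- 2 * (\<alpha> + 1)) = norm y powr (-2) * norm y powr (- 2 * \<alpha>)"
      by (simp only: powr_add)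
    show ?thesis unfolding 1 \<xi>_def by (simp only: ring_distribs) (simp only: algebra_simps)
  qed
  moreover have "\<xi> * (?P * ((p + q / 2) * (d' / (2 * t)) + q / 2 * (1 / (2 * t) - 1)))
      + \<xi> * (q / 2) * (?P * (t * kummer 0 (d' / 2) t + kummer 0 (d' / 2 - 1) t / 2))
      - ?P * (t powr \<alpha> / Gamma \<alpha> * (\<xi> *
      ((p * d' / (2 * t) + q / 2 * (-1 + (d' + 1) / (2 * t))) * kummer (\<alpha> - 1) \<beta> t
       + (- (p * (d' + 2) + q / 2 * (d' + 5)) / (2 * t)) * kummer \<alpha> \<beta> t
       + (p + q) * kummer (\<alpha> + 1) \<beta> t)))
      - q / 2 * (?P * (t powr (\<alpha> + 1) / Gamma (\<alpha> + 1) * (\<xi> * (kummer \<alpha> (\<beta> + 1) t + 3 / (2 * t) * kummer \<alpha> \<beta> t))))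
    = ?P * ((x \<bullet> u) * averaged_defect (DIM('a)) \<alpha> p q t)"
  proof -
    have dpos: "d' \<ge> 2" using d by (simp add: d'_def)
    have \<beta>: "\<beta> > 0" using dpos \<alpha> by (simp add: \<beta>_def)
    define K0 where "K0 = kummer (\<alpha> - 1) \<beta> t"
    define K1 where "K1 = kummer \<alpha> \<beta> t"
    define K2 where "K2 = kummer (\<alpha> + 1) \<beta> t"
    define M where "M = kummer 0 (d' / 2 - 1) t"
    define G where "G = Gamma \<alpha>"
    define \<tau> where "\<tau> = t powr \<alpha>"
    have G: "G > 0" unfolding G_def using \<alpha> by (intro Gamma_real_pos) auto
    have \<tau>: "\<tau> > 0" using t by (simp add: \<tau>_def)
    have G1: "Gamma (\<alpha> + 1) = \<alpha> * G"
      unfolding G_def by (rule Gamma_plus1) (use \<alpha> in \<open>auto elim!: nonpos_Ints_cases\<close>)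
    have \<tau>1: "t powr (\<alpha> + 1) = \<tau> * t" using t by (simp add: powr_add \<tau>_def)
    have M1: "t * kummer 0 (d' / 2) t = 1 - d' / 2 * M"
      unfolding M_def using dpos t by (intro kummer_by_parts_zero) auto
    \<comment> \<open>After the integration by parts, splitting off one factor 1 - n leaves only
      \<open>K0\<close> and \<open>K1\<close>.\<close>
    have K: "t * kummer \<alpha> (\<beta> + 1) t = \<alpha> * (K0 - K1) - (\<beta> + 1) * K1"
      using kummer_by_parts[of \<alpha> \<beta> t] kummer_split[of "\<alpha> - 1" \<beta> t] \<alpha> \<beta> t by (simp add: K0_def K1_def)
    have r0: "kummer_ratio \<alpha> \<beta> t = \<tau> * K0 / G" by (simp add: kummer_ratio_def \<tau>_def K0_def G_def)
    have r1: "kummer_ratio (\<alpha> + 1) \<beta> t = \<tau> * t * K1 / (\<alpha> * G)" by (simp add: kummer_ratio_def \<tau>1 K1_def G1)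
    have r2: "kummer_ratio 1 (d' / 2 - 1) t = t * M" using t by (simp add: kummer_ratio_def M_def)
    have k4: "kummer \<alpha> (\<beta> + 1) t = (\<alpha> * (K0 - K1) - (\<beta> + 1) * K1) / t" using K t by (simp add: field_simps)
    have "((p + q / 2) * (d' / (2 * t)) + q / 2 * (1 / (2 * t) - 1)) + q / 2 * ((1 - d' / 2 * M) + M / 2)
      - \<tau> / G * ((p * d' / (2 * t) + q / 2 * (-1 + (d' + 1) / (2 * t))) * K0 + (- (p * (d' + 2) + q / 2 * (d' + 5)) / (2 * t)) * K1 + (p + q) * K2)
      - q / 2 * (\<tau> * t / (\<alpha> * G) * ((\<alpha> * (K0 - K1) - (\<beta> + 1) * K1) / t + 3 / (2 * t) * K1))
      = averaged_defect d' \<alpha> p q t"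
      unfolding averaged_defect_def \<beta>_def[symmetric] r0 r1 r2 K1_def[symmetric] K2_def[symmetric] G_def[symmetric] \<tau>_def[symmetric]
      using t G \<alpha> by (simp add: \<beta>_def field_simps)
    then show ?thesis
      unfolding M1 \<tau>1 G1 k4 K0_def[symmetric] K1_def[symmetric] K2_def[symmetric] M_def[symmetric] \<tau>_def[symmetric] G_def[symmetric] d'_def[symmetric] \<xi>_def[symmetric]
      using t G \<alpha> by (simp only: flip: \<open>_ = averaged_defect d' \<alpha> p q t\<close>) (simp add: field_simps)
  qed
  ultimately show ?thesis unfolding v1 v2 v3 v4 by (simp only: d'_def)
qed

lemma has_bochner_integral_averaged_defect:
  fixes d s \<alpha> p q :: real
  assumes s: "0 < s" "s < 1" and \<alpha>: "0 < \<alpha>" "2 * \<alpha> \<le> 1" and d: "d \<ge> 2"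
  defines "\<beta> \<equiv> d / 2 - \<alpha>"
  shows "has_bochner_integral lborel (\<lambda>t. indicator {0<..} t * (t powr s * averaged_defect d \<alpha> p q t))
    ((p * d + q / 2 * (d + 1)) / 2 * (Gamma (s + \<alpha>) / Gamma \<alpha> * (Gamma (1 - s) * Gamma (\<beta> + 1) / (s * Gamma (\<beta> + 1 - s))))
     - q * (d - 1) / 4 * (Gamma (s + (\<alpha> + 1)) / Gamma (\<alpha> + 1) * (Gamma (1 - s) * Gamma (\<beta> + 1) / (s * Gamma (\<beta> + 1 - s)))
        - Gamma (s + 1) / Gamma 1 * (Gamma (1 - s) * Gamma (d / 2 - 1 + 1) / (s * Gamma (d / 2 - 1 + 1 - s))))
     - (p + q) / Gamma \<alpha> * (Gamma (s + \<alpha> + 1) * Beta (\<alpha> + 1 - (s + \<alpha> + 1) + 1) (\<beta> + 1))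
     + (p * (d + 2) + q / 2 * (d + 5)) / (2 * Gamma \<alpha>) * (Gamma (s + \<alpha>) * Beta (\<alpha> - (s + \<alpha>) + 1) (\<beta> + 1)))"
  (is "has_bochner_integral lborel _ ?v")
proof -
  have \<beta>: "\<beta> > 0" using \<alpha> d by (simp add: \<beta>_def)
  let ?i = "\<lambda>t::real. indicator {0<..} t :: real"
  \<comment> \<open>Each summand now has a known integral. The assumption d \<ge> 2 makes d/2 - 1,
    the second parameter of the last ratio, nonnegative.\<close>
  have "has_bochner_integral lborel (\<lambda>t.
     (p * d + q / 2 * (d + 1)) / 2 * (?i t * (t powr (s - 1) * (1 - kummer_ratio \<alpha> \<beta> t)))
     - q * (d - 1) / 4 * (?i t * (t powr (s - 1) * (1 - kummer_ratio (\<alpha> + 1) \<beta> t)) - ?i t * (t powr (s - 1) * (1 - kummer_ratio 1 (d / 2 - 1) t)))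
     - (p + q) / Gamma \<alpha> * (?i t * (t powr (s + \<alpha> + 1 - 1) * kummer (\<alpha> + 1) \<beta> t))
     + (p * (d + 2) + q / 2 * (d + 5)) / (2 * Gamma \<alpha>) * (?i t * (t powr (s + \<alpha> - 1) * kummer \<alpha> \<beta> t))) ?v"
    using s \<alpha> \<beta> d
    by (intro has_bochner_integral_add has_bochner_integral_diff has_bochner_integral_mult_right
        has_bochner_integral_kummer_ratio_defect has_bochner_integral_powr_kummer) auto
  moreover have "(p * d + q / 2 * (d + 1)) / 2 * (?i t * (t powr (s - 1) * (1 - kummer_ratio \<alpha> \<beta> t)))
     - q * (d - 1) / 4 * (?i t * (t powr (s - 1) * (1 - kummer_ratio (\<alpha> + 1) \<beta> t)) - ?i t * (t powr (s - 1) * (1 - kummer_ratio 1 (d / 2 - 1) t)))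
     - (p + q) / Gamma \<alpha> * (?i t * (t powr (s + \<alpha> + 1 - 1) * kummer (\<alpha> + 1) \<beta> t))
     + (p * (d + 2) + q / 2 * (d + 5)) / (2 * Gamma \<alpha>) * (?i t * (t powr (s + \<alpha> - 1) * kummer \<alpha> \<beta> t))
    = ?i t * (t powr s * averaged_defect d \<alpha> p q t)" for t
  proof (cases "t > 0")
    case True
    define \<sigma> where "\<sigma> = t powr s"
    define \<tau> where "\<tau> = t powr \<alpha>"
    have 1: "t powr (s - 1) = \<sigma> / t" "t powr (s + \<alpha> + 1 - 1) = \<sigma> * \<tau>" "t powr (s + \<alpha> - 1) = \<sigma> * \<tau> / t"
      using True by (simp_all add: \<sigma>_def \<tau>_def powr_add powr_diff)
    show ?thesis
      unfolding averaged_defect_def 1 \<beta>_def[symmetric] \<sigma>_def[symmetric] \<tau>_def[symmetric]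
      using True by (simp add: field_simps)
  qed simp
  ultimately show ?thesis by (simp only: )
qed

text \<open>The recurrence of Gamma leaves one common factor times a polynomial in the parameters,
  apart from the term from \<open>kummer_ratio 1\<close>, which becomes a multiple of
  \<open>X\<close>. The stated relation is exactly the vanishing of this bracket.\<close>

lemma averaged_defect_integral_eq_zero:
  fixes d s \<epsilon> \<delta> :: real
  assumes s: "0 < s" "s < 1" and \<delta>: "0 < \<delta>" "\<delta> \<le> 1" and d: "d \<ge> 2"
  defines "X \<equiv> (Gamma (d / 2) * Gamma (s + 1) * Gamma (d / 2 - s - \<delta> / 2 + 2) * Gamma (1 + \<delta> / 2)) /
        (Gamma (d / 2 - s) * Gamma (d / 2 - \<delta> / 2 + 1) * Gamma (\<delta> / 2 + s))"
  assumes rel: "\<epsilon> * ((d - 1) * s * (d - 2 * s + 2) - 2 * (d - 1) * X) = 2 * (d - 2 * s + 2 - \<delta>) * \<delta>"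
  shows "has_bochner_integral lborel (\<lambda>t. indicator {0<..} t * (t powr s * averaged_defect d (\<delta> / 2)
    (1 - (1 + 2 * s) / 2 * \<epsilon>) ((d + 2 * s) / 2 * \<epsilon>) t)) 0"
proof -
  define p where "p = 1 - (1 + 2 * s) / 2 * \<epsilon>"
  define q where "q = (d + 2 * s) / 2 * \<epsilon>"
  define \<alpha> where "\<alpha> = \<delta> / 2"
  define \<beta> where "\<beta> = d / 2 - \<alpha>"
  define w where "w = \<beta> + 1 - s"
  have \<alpha>: "0 < \<alpha>" "2 * \<alpha> \<le> 1" using \<delta> by (simp_all add: \<alpha>_def)
  have \<beta>: "\<beta> > 0" using \<alpha> d by (simp add: \<beta>_def)
  have w: "w > 0" using \<beta> s by (simp add: w_def)
  define GA where "GA = Gamma (s + \<alpha>)"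
  define GB where "GB = Gamma \<alpha>"
  define GC where "GC = Gamma (\<beta> + 1)"
  define GE where "GE = Gamma w"
  define Gs where "Gs = Gamma (1 - s)"
  define K0 where "K0 = Gamma (s + 1) * Gamma (d / 2) / Gamma (d / 2 - s)"
  have pos: "GA > 0" "GB > 0" "GC > 0" "GE > 0" "Gs > 0"
    using \<alpha> \<beta> s w by (auto simp: GA_def GB_def GC_def GE_def Gs_def intro!: Gamma_real_pos)
  have G1: "Gamma (s + \<alpha> + 1) = (s + \<alpha>) * GA" "Gamma (\<alpha> + 1) = \<alpha> * GB" "Gamma (w + 1) = w * GE"
    unfolding GA_def GB_def GE_def
    by (rule Gamma_plus1; use s \<alpha> w in \<open>auto elim!: nonpos_Ints_cases\<close>)+
  have X: "X = K0 * (w * GE) * (\<alpha> * GB) / (GC * GA)"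
  proof -
    have "Gamma (d / 2 - s - \<delta> / 2 + 2) = w * GE" "Gamma (1 + \<delta> / 2) = \<alpha> * GB"
      using G1(2,3) by (simp_all add: w_def \<beta>_def \<alpha>_def algebra_simps)
    moreover have "Gamma (d / 2 - \<delta> / 2 + 1) = GC" "Gamma (\<delta> / 2 + s) = GA"
      by (simp_all add: GC_def GA_def \<beta>_def \<alpha>_def add.commute)
    ultimately show ?thesis by (simp add: X_def K0_def mult_ac)
  qed
  have \<delta>2: "\<delta> = 2 * \<alpha>" by (simp add: \<alpha>_def)
  \<comment> \<open>Eliminating d in favour of w makes the next identity polynomial in w, \<alpha>,
    s, \<epsilon> and X.\<close>
  have d2: "d = 2 * (w + \<alpha> - 1 + s)" by (simp add: w_def \<beta>_def)
  have poly: "(p * d + q / 2 * (d + 1)) / 2 * \<alpha> * w - q * (d - 1) / 4 * (s + \<alpha>) * w + q * (d - 1) / 4 * X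
     - (p + q) * (s + \<alpha>) * s * \<alpha> + (p * (d + 2) + q / 2 * (d + 5)) / 2 * s * \<alpha> = 0"
  proof -
    \<comment> \<open>The factor d + 2s is present in q, and the part free of \<epsilon> factorises
      as (d/2 + s) w \<alpha>, where d - 2s + 2 - \<delta> = 2w and \<delta> = 2 \<alpha>.\<close>
    have *: "(p * d + q / 2 * (d + 1)) / 2 * \<alpha> * w - q * (d - 1) / 4 * (s + \<alpha>) * w + q * (d - 1) / 4 * X
       - (p + q) * (s + \<alpha>) * s * \<alpha> + (p * (d + 2) + q / 2 * (d + 5)) / 2 * s * \<alpha>
      = (d + 2 * s) / 16 * (2 * (d - 2 * s + 2 - \<delta>) * \<delta> - \<epsilon> * ((d - 1) * s * (d - 2 * s + 2) - 2 * (d - 1) * X))"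
      unfolding p_def q_def \<delta>2 d2 by (simp add: field_simps)
    show ?thesis unfolding * by (simp only: rel diff_self mult_zero_right)
  qed
  have Be: "Beta (\<alpha> + 1 - (s + \<alpha> + 1) + 1) (\<beta> + 1) = Gs * GC / (w * GE)" "Beta (\<alpha> - (s + \<alpha>) + 1) (\<beta> + 1) = Gs * GC / (w * GE)"
    using G1(3) by (simp_all add: Beta_def Gs_def GC_def w_def algebra_simps)
  have K: "Gamma (s + 1) / Gamma 1 * (Gs * Gamma (d / 2 - 1 + 1) / (s * Gamma (d / 2 - 1 + 1 - s))) = Gs * K0 / s"
    by (simp add: K0_def mult_ac)
  have "(p * d + q / 2 * (d + 1)) / 2 * (GA / GB * (Gs * GC / (s * GE)))
     - q * (d - 1) / 4 * ((s + \<alpha>) * GA / (\<alpha> * GB) * (Gs * GC / (s * GE)) - Gs * K0 / s)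
     - (p + q) / GB * ((s + \<alpha>) * GA * (Gs * GC / (w * GE)))
     + (p * (d + 2) + q / 2 * (d + 5)) / (2 * GB) * (GA * (Gs * GC / (w * GE)))
    = Gs * GA * GC / (s * \<alpha> * GB * w * GE) * ((p * d + q / 2 * (d + 1)) / 2 * \<alpha> * w - q * (d - 1) / 4 * (s + \<alpha>) * w + q * (d - 1) / 4 * X
     - (p + q) * (s + \<alpha>) * s * \<alpha> + (p * (d + 2) + q / 2 * (d + 5)) / 2 * s * \<alpha>)"
    unfolding X using pos w \<alpha> s by (simp add: field_simps)
  also have "\<dots> = 0" by (simp only: poly mult_zero_right)
  finally have "(p * d + q / 2 * (d + 1)) / 2 * (GA / GB * (Gs * GC / (s * GE)))
     - q * (d - 1) / 4 * ((s + \<alpha>) * GA / (\<alpha> * GB) * (Gs * GC / (s * GE)) - Gs * K0 / s)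
     - (p + q) / GB * ((s + \<alpha>) * GA * (Gs * GC / (w * GE)))
     + (p * (d + 2) + q / 2 * (d + 5)) / (2 * GB) * (GA * (Gs * GC / (w * GE))) = 0" .
  moreover have "s + (\<alpha> + 1) = s + \<alpha> + 1" by simp
  ultimately show ?thesis
    using has_bochner_integral_averaged_defect[OF s \<alpha> d, of p q, folded \<beta>_def, folded Gs_def, unfolded K Be]
    by (simp only: G1 GA_def[symmetric] GB_def[symmetric] GC_def[symmetric] w_def[symmetric] GE_def[symmetric] p_def[symmetric] q_def[symmetric] \<alpha>_def[symmetric])
qed

subsection \<open>The symmetrised integrand\<close>

text \<open>Write the power as a Gamma integral of Gaussians and integrate over h first; t^(s-1) exp
  (-t) remains. The function serves as majorant for large h.\<close>

lemma integrable_inverse_quadratic_powr: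
  assumes s: "s > 0"
  shows "integrable lborel (\<lambda>h::'a::euclidean_space. (1 + (norm h)\<^sup>2) powr (- (DIM('a) / 2 + s)))"
proof -
  let ?D = "DIM('a) / 2"
  let ?P = "?D + s"
  have P: "?P > 0" using s by (simp add: add_nonneg_pos)
  define W where "W h t = indicator {0<..} t * (t powr (?P - 1) * exp (- (t * (1 + (norm h)\<^sup>2))))" for h :: 'a and t :: real
  have pos: "1 + (norm h)\<^sup>2 > 0" for h :: 'a by (simp add: add_pos_nonneg)
  have "has_bochner_integral lborel (\<lambda>h::'a. Gamma ?P / (1 + (norm h)\<^sup>2) powr ?P) (pi powr ?D * (Gamma s / 1 powr s))"
  proof (rule lborel_tonelli_swap[where W = W and g = "\<lambda>t. pi powr ?D * (indicator {0<..} t * (t powr (s - 1) * exp (- (t * 1))))"])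
    show "case_prod W \<in> borel_measurable (lborel \<Otimes>\<^sub>M lborel)"
      unfolding W_def by measurable
    show "0 \<le> W h t" for h t by (simp add: W_def)
    show "has_bochner_integral lborel (\<lambda>t. pi powr ?D * (indicator {0<..} t * (t powr (s - 1) * exp (- (t * 1))))) (pi powr ?D * (Gamma s / 1 powr s))"
      by (intro has_bochner_integral_mult_right has_bochner_integral_Gamma s) simp
    show "has_bochner_integral lborel (\<lambda>t. W h t) (Gamma ?P / (1 + (norm h)\<^sup>2) powr ?P)" for h
      unfolding W_def by (rule has_bochner_integral_Gamma[OF P pos])
    show "has_bochner_integral lborel (\<lambda>h. W h t) (pi powr ?D * (indicator {0<..} t * (t powr (s - 1) * exp (- (t * 1)))))" for t
    proof (cases "t > 0")
      case True
      have "has_bochner_integral lborel (\<lambda>h::'a. t powr (?P - 1) * exp (- t) * exp (- t * (norm h)\<^sup>2)) (t powr (?P - 1) * exp (- t) * (pi / t) powr ?D)"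
        by (intro has_bochner_integral_mult_right gaussian_integral True)
      moreover have "t powr (?P - 1) * exp (- t) * exp (- t * (norm h)\<^sup>2) = W h t" for h
        using True by (simp add: W_def mult.assoc exp_add[symmetric] algebra_simps)
      moreover have "t powr (?P - 1) * exp (- t) * (pi / t) powr ?D = pi powr ?D * (indicator {0<..} t * (t powr (s - 1) * exp (- (t * 1))))"
      proof -
        have "?P - 1 = ?D + (s - 1)" by simp
        then have "t powr (?P - 1) = t powr ?D * t powr (s - 1)" by (simp only: powr_add)
        then show ?thesis using True by (simp add: powr_divide)
      qed
      ultimately show ?thesis by (simp only: )
    next
      case False
      then have "W h t = 0" for h by (simp add: W_def)
      then show ?thesis using False by (simp add: has_bochner_integral_zero)
    qed
  qed
  from integrable.intros[OF this]
  have 1: "integrable lborel (\<lambda>h::'a. (1 / Gamma ?P) * (Gamma ?P / (1 + (norm h)\<^sup>2) powr ?P))"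
    by (rule integrable_mult_right)
  have 2: "(1 / Gamma ?P) * (Gamma ?P / (1 + (norm h)\<^sup>2) powr ?P) = (1 + (norm h)\<^sup>2) powr (- ?P)" for h :: 'a
  proof -
    have "Gamma ?P \<noteq> 0" using Gamma_real_pos[OF P] by simp
    then show ?thesis unfolding powr_minus_divide by simp
  qed
  show ?thesis using 1 unfolding 2 .
qed

lemma integrable_norm_powr_ball:
  fixes a :: real
  assumes "a + DIM('a::euclidean_space) > 0"
  shows "integrable lborel (\<lambda>h::'a. indicator (ball 0 r) h * norm h powr a)"
proof (rule integrableI_bounded)
  have [measurable]: "ball (0::'a) r \<in> sets borel" by simp
  show "(\<lambda>h::'a. indicator (ball 0 r) h * norm h powr a) \<in> borel_measurable lborel" by measurable
  have "(\<integral>\<^sup>+h. ennreal (norm (indicator (ball 0 r) h * norm h powr a)) \<partial>(lborel :: 'a measure)) = (\<integral>\<^sup>+h\<in>ball (0::'a) r. ennreal (norm h powr a) \<partial>lborel)"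
    by (rule nn_integral_cong) (simp add: indicator_def)
  also have "\<dots> < \<infinity>" by (rule nn_integral_norm_powr_ball[OF assms])
  finally show "(\<integral>\<^sup>+h. ennreal (norm (indicator (ball 0 r) h * norm h powr a)) \<partial>(lborel :: 'a measure)) < \<infinity>" .
qed

lemma norm_sgn_diff_le: "norm a * norm (sgn a - sgn b) \<le> 2 * norm (a - b :: 'a::real_normed_vector)"
proof -
  have 1: "norm c *\<^sub>R sgn c = c" for c :: 'a by (cases "c = 0") (simp_all add: sgn_div_norm)
  have "norm a *\<^sub>R (sgn a - sgn b) = (a - b) + (norm b - norm a) *\<^sub>R sgn b"
    using 1[of a] 1[of b] by (simp add: algebra_simps)
  then have "norm a * norm (sgn a - sgn b) = norm ((a - b) + (norm b - norm a) *\<^sub>R sgn b)"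
    by (metis abs_norm_cancel norm_scaleR)
  also have "\<dots> \<le> norm (a - b) + \<bar>norm b - norm a\<bar> * norm (sgn b)"
    by (rule norm_triangle_le) simp
  also have "\<dots> \<le> norm (a - b) + \<bar>norm b - norm a\<bar> * 1"
    by (intro add_left_mono mult_left_mono) (auto simp: norm_sgn)
  also have "\<bar>norm b - norm a\<bar> \<le> norm (a - b)"
    using norm_triangle_ineq3[of b a] by (simp add: norm_minus_commute)
  finally show ?thesis by simp
qed

text \<open>Both bounds come from a weighted mean inequality, applied to 1 + z and to 1 / (1 + z).
  The range 9/16 fits |x \<plusminus> h|^2 = 1 + z with |h| \<le> 1/4, where |z| \<le> 9/4
  |h|.\<close>

lemma powr_second_order_bounds:
  fixes a z :: real
  assumes a: "0 \<le> a" "a \<le> 1" and z: "\<bar>z\<bar> \<le> 9/16"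
  shows "0 \<le> (1 + z) powr (- a) - 1 + a * z" "(1 + z) powr (- a) - 1 + a * z \<le> 3 * z\<^sup>2"
proof -
  have z1: "1 + z > 0" "1 + z \<ge> 7/16" using z by auto
  have "(1 + z) powr a * 1 powr (1 - a) \<le> a * (1 + z) + (1 - a) * 1"
    using a z1 by (intro Youngs_inequality_0) auto
  then have le: "(1 + z) powr a \<le> 1 + a * z" by (simp add: algebra_simps)
  moreover have "(1 + z) powr a > 0" using z1 by simp
  ultimately have az: "1 + a * z > 0" by linarith
  have "1 - a * z \<le> 1 / (1 + a * z)"
    using az a by (simp add: field_simps)
  also have "\<dots> \<le> 1 / (1 + z) powr a"
    using le z1 by (intro divide_left_mono) (auto intro!: mult_pos_pos az)
  finally show "0 \<le> (1 + z) powr (- a) - 1 + a * z" by (simp add: powr_minus_divide)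
  have "(1 / (1 + z)) powr a * 1 powr (1 - a) \<le> a * (1 / (1 + z)) + (1 - a) * 1"
    using a z1 by (intro Youngs_inequality_0) auto
  then have "(1 + z) powr (- a) - 1 + a * z \<le> a * (1 / (1 + z) - 1 + z)"
    using z1 by (simp add: powr_divide powr_minus_divide algebra_simps)
  also have "1 / (1 + z) - 1 + z = z\<^sup>2 / (1 + z)" using z1 by (simp add: field_simps power2_eq_square)
  also have "a * (z\<^sup>2 / (1 + z)) \<le> 1 * (z\<^sup>2 / (7/16))"
    using a z1 by (intro mult_mono divide_left_mono) auto
  also have "\<dots> \<le> 3 * z\<^sup>2" by simp
  finally show "(1 + z) powr (- a) - 1 + a * z \<le> 3 * z\<^sup>2" .
qed

definition aniso_weight :: "real \<Rightarrow> real \<Rightarrow> real ^ 'n \<Rightarrow> real ^ 'n \<Rightarrow> real" where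
  "aniso_weight p q x h = p + q / 2 * ((sgn x \<bullet> sgn h)\<^sup>2 + (sgn (x + h) \<bullet> sgn h)\<^sup>2)"

definition aniso_integrand :: "real \<Rightarrow> 'n::finite \<Rightarrow> real \<Rightarrow> real \<Rightarrow> real \<Rightarrow> real ^ 'n \<Rightarrow> real ^ 'n \<Rightarrow> real" where
  "aniso_integrand s i \<delta> p q x h = norm h powr (- real CARD('n) - 2 * s) * aniso_weight p q x h * (u_sol i \<delta> x - u_sol i \<delta> (x + h))"

lemma nonlocal_integrand_A_coeff:
  "nonlocal_integrand (A_coeff s \<epsilon>) s (u_sol i \<delta>) x h =
    aniso_integrand s i \<delta> (1 - (1 + 2 * s) / 2 * \<epsilon>) ((real CARD('n) + 2 * s) / 2 * \<epsilon>) x (h :: real ^ 'n::finite)"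
proof (cases "h = 0")
  case True
  then show ?thesis by (simp add: nonlocal_integrand_def aniso_integrand_def kernel_def)
next
  case False
  then have 1: "sgn h \<bullet> sgn h = 1" by (simp add: dot_square_norm norm_sgn)
  have "(((1 / 2) *\<^sub>R (A_coeff s \<epsilon> x + A_coeff s \<epsilon> (x + h))) *v sgn h) \<bullet> sgn h
    = 1 / 2 * ((A_coeff s \<epsilon> x *v sgn h) \<bullet> sgn h + (A_coeff s \<epsilon> (x + h) *v sgn h) \<bullet> sgn h)"
    by (simp add: scaleR_matrix_mult_vec matrix_vector_mult_add_rdistrib inner_simps)
  then have "(((1 / 2) *\<^sub>R (A_coeff s \<epsilon> x + A_coeff s \<epsilon> (x + h))) *v sgn h) \<bullet> sgn h
     = aniso_weight (1 - (1 + 2 * s) / 2 * \<epsilon>) ((real CARD('n) + 2 * s) / 2 * \<epsilon>) x h"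
    unfolding A_coeff_quadratic_form aniso_weight_def 1 by (simp add: field_simps)
  moreover have "x - (x + h) = - h" by simp
  moreover have "M *v (- v) = - (M *v v)" for M :: "real ^ 'n ^ 'n" and v
    using matrix_vector_mult_scaleR[of M "-1" v] by simp
  ultimately show ?thesis
    by (simp add: nonlocal_integrand_def aniso_integrand_def kernel_def sgn_minus)
qed

lemma borel_measurable_sgn_euclidean [measurable]: "(sgn :: 'a::euclidean_space \<Rightarrow> 'a) \<in> borel_measurable borel"
  unfolding sgn_div_norm[abs_def] by measurable

lemma borel_measurable_aniso_integrand [measurable]: "aniso_integrand s i \<delta> p q x \<in> borel_measurable borel"
  unfolding aniso_integrand_def[abs_def] aniso_weight_def by measurable

lemma aniso_weight_scale: "c > 0 \<Longrightarrow> aniso_weight p q (c *\<^sub>R x) (c *\<^sub>R h) = aniso_weight p q x h"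
  by (simp add: aniso_weight_def sgn_scaleR flip: scaleR_add_right)

lemma aniso_integrand_scale:
  fixes x :: "real ^ 'n::finite"
  assumes c: "c > 0"
  shows "aniso_integrand s i \<delta> p q (c *\<^sub>R x) (c *\<^sub>R h) = c powr (1 - \<delta> - real CARD('n) - 2 * s) * aniso_integrand s i \<delta> p q x h"
proof -
  have "u_sol i \<delta> (c *\<^sub>R x) - u_sol i \<delta> (c *\<^sub>R x + c *\<^sub>R h) = c powr (1 - \<delta>) * (u_sol i \<delta> x - u_sol i \<delta> (x + h))"
    using c by (simp add: u_sol_scale right_diff_distrib flip: scaleR_add_right)
  moreover have "1 - \<delta> - real CARD('n) - 2 * s = (1 - \<delta>) + (- real CARD('n) - 2 * s)" by simp
  then have "c powr (1 - \<delta> - real CARD('n) - 2 * s) = c powr (1 - \<delta>) * c powr (- real CARD('n) - 2 * s)"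
    by (simp only: powr_add)
  ultimately show ?thesis
    using c by (simp add: aniso_integrand_def aniso_weight_scale powr_mult)
qed

lemma sgn_inner_sgn_le: "\<bar>sgn a \<bullet> sgn b\<bar> \<le> 1"
proof -
  have "\<bar>sgn a \<bullet> sgn b\<bar> \<le> norm (sgn a) * norm (sgn b)" by (rule Cauchy_Schwarz_ineq2)
  also have "\<dots> \<le> 1 * 1" by (intro mult_mono) (auto simp: norm_sgn)
  finally show ?thesis by simp
qed

lemma aniso_weight_le: "\<bar>aniso_weight p q x h\<bar> \<le> \<bar>p\<bar> + \<bar>q\<bar>"
proof -
  have "(sgn x \<bullet> sgn h)\<^sup>2 \<le> 1" "(sgn (x + h) \<bullet> sgn h)\<^sup>2 \<le> 1"
    using sgn_inner_sgn_le by (auto simp: abs_square_le_1)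
  then have "\<bar>q / 2\<bar> * ((sgn x \<bullet> sgn h)\<^sup>2 + (sgn (x + h) \<bullet> sgn h)\<^sup>2) \<le> \<bar>q / 2\<bar> * 2"
    by (intro mult_left_mono) auto
  moreover have "\<bar>q / 2 * ((sgn x \<bullet> sgn h)\<^sup>2 + (sgn (x + h) \<bullet> sgn h)\<^sup>2)\<bar> = \<bar>q / 2\<bar> * ((sgn x \<bullet> sgn h)\<^sup>2 + (sgn (x + h) \<bullet> sgn h)\<^sup>2)"
    by (simp add: abs_mult)
  ultimately show ?thesis unfolding aniso_weight_def by (intro abs_triangle_ineq[THEN order_trans]) simp
qed

lemma u_sol_minus: "u_sol i \<delta> (- y) = - u_sol i \<delta> y"
  by (simp add: u_sol_def)

lemma abs_u_sol_le: "\<bar>u_sol i \<delta> y\<bar> \<le> norm y powr (1 - \<delta>)"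
proof -
  have "\<bar>u_sol i \<delta> y\<bar> \<le> norm y powr (1 - \<delta>) * 1"
    unfolding u_sol_def abs_mult using component_le_norm_cart[of y i]
    by (intro mult_mono) (auto simp: divide_le_eq)
  then show ?thesis by simp
qed

definition symm_integrand :: "real \<Rightarrow> 'n::finite \<Rightarrow> real \<Rightarrow> real \<Rightarrow> real \<Rightarrow> real ^ 'n \<Rightarrow> real ^ 'n \<Rightarrow> real" where
  "symm_integrand s i \<delta> p q x h = aniso_integrand s i \<delta> p q x h + aniso_integrand s i \<delta> p q x (- h)"

text \<open>Symmetrising gives mean weight times second difference of u plus half the weight
  difference times first difference. Near 0 both products are of order |h|^2. Far away the second
  difference stays bounded because u is odd, and the weight difference decays like 1/|h| while the
  first difference grows at most like |h|.\<close>

lemma symm_integrand_bounds: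
  fixes x :: "real ^ 'n::finite"
  assumes x: "norm x = 1" and \<delta>: "0 \<le> \<delta>" "\<delta> \<le> 1"
  shows "norm h \<ge> 1/4 \<Longrightarrow> \<bar>symm_integrand s i \<delta> p q x h\<bar> \<le> 26 * (\<bar>p\<bar> + \<bar>q\<bar>) * norm h powr (- real CARD('n) - 2 * s)"
    and "norm h \<le> 1/4 \<Longrightarrow> \<bar>symm_integrand s i \<delta> p q x h\<bar> \<le> 200 * (\<bar>p\<bar> + \<bar>q\<bar>) * (norm h)\<^sup>2 * norm h powr (- real CARD('n) - 2 * s)"
proof -
  let ?\<rho> = "norm h"
  let ?K = "?\<rho> powr (- real CARD('n) - 2 * s)"
  let ?u = "u_sol i \<delta>"
  define Qp Qm where "Qp = aniso_weight p q x h" and "Qm = aniso_weight p q x (- h)"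
  define D2 D1 where "D2 = 2 * ?u x - ?u (x + h) - ?u (x - h)" and "D1 = ?u (x - h) - ?u (x + h)"
  let ?C = "\<bar>p\<bar> + \<bar>q\<bar>"
  have S: "symm_integrand s i \<delta> p q x h = ?K * ((Qp + Qm) / 2 * D2 + (Qp - Qm) / 2 * D1)"
    by (simp add: symm_integrand_def aniso_integrand_def Qp_def Qm_def D2_def D1_def field_simps)
  have Qsum: "\<bar>(Qp + Qm) / 2\<bar> \<le> ?C"
    using aniso_weight_le[of p q x h] aniso_weight_le[of p q x "- h"] by (simp add: Qp_def Qm_def)
  let ?y = "sgn (x + h)" and ?z = "sgn (x - h)" and ?e = "sgn h"
  have Qdiff: "\<bar>(Qp - Qm) / 2\<bar> \<le> \<bar>q\<bar> / 4 * (norm (?y - ?z) * norm (?y + ?z))"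
  proof -
    \<comment> \<open>A difference of squares: the factor with \<open>?y - ?z\<close> is small for
      small h, the factor with \<open>?y + ?z\<close> for large h.\<close>
    have eq: "(Qp - Qm) / 2 = q / 4 * ((?e \<bullet> (?y - ?z)) * (?e \<bullet> (?y + ?z)))"
      by (simp add: Qp_def Qm_def aniso_weight_def sgn_minus inner_simps inner_commute power2_eq_square field_simps)
    have "\<bar>?e \<bullet> w\<bar> \<le> norm w" for w
    proof -
      have "\<bar>?e \<bullet> w\<bar> \<le> norm ?e * norm w" by (rule Cauchy_Schwarz_ineq2)
      also have "\<dots> \<le> 1 * norm w" by (intro mult_right_mono) (auto simp: norm_sgn)
      finally show ?thesis by simp
    qed
    then have "\<bar>(?e \<bullet> (?y - ?z)) * (?e \<bullet> (?y + ?z))\<bar> \<le> norm (?y - ?z) * norm (?y + ?z)"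
      unfolding abs_mult by (intro mult_mono) auto
    then have "\<bar>q / 4\<bar> * \<bar>(?e \<bullet> (?y - ?z)) * (?e \<bullet> (?y + ?z))\<bar> \<le> \<bar>q / 4\<bar> * (norm (?y - ?z) * norm (?y + ?z))"
      by (intro mult_left_mono) auto
    then show ?thesis unfolding eq abs_mult[of "q / 4"] by simp
  qed
  \<comment> \<open>All estimates use the longer of x + h and x - h, whose norm is at least 1 and at
    least |h|. So it does not matter that the shorter one may vanish.\<close>
  define m where "m = max (norm (x + h)) (norm (x - h))"
  have m1: "m \<ge> 1"
  proof -
    have e: "(x + h) + (x - h) = 2 *\<^sub>R x" by (simp add: scaleR_2)
    have "norm ((x + h) + (x - h)) = 2 * norm x" unfolding e by simp
    then have "2 * norm x \<le> norm (x + h) + norm (x - h)" using norm_triangle_ineq[of "x + h" "x - h"] by simp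
    then show ?thesis using x by (simp add: m_def max_def split: if_splits)
  qed
  have m2: "m \<ge> ?\<rho>"
  proof -
    have e: "(x + h) - (x - h) = 2 *\<^sub>R h" by (simp add: scaleR_2)
    have "norm ((x + h) - (x - h)) = 2 * norm h" unfolding e by simp
    then have "2 * norm h \<le> norm (x + h) + norm (x - h)" using norm_triangle_ineq4[of "x + h" "x - h"] by simp
    then show ?thesis by (simp add: m_def max_def split: if_splits)
  qed
  have mpow: "m powr (- \<delta>) \<le> 1" using m1 \<delta> powr_mono2'[of "- \<delta>" 1 m] by simp
  have D1: "\<bar>D1\<bar> \<le> 4 * ?\<rho>"
  proof -
    have "\<bar>D1\<bar> \<le> (1 + \<delta>) * norm ((x - h) - (x + h)) * max (norm (x - h)) (norm (x + h)) powr (- \<delta>)"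
      unfolding D1_def by (rule u_sol_diff_le[OF \<delta>])
    also have "norm ((x - h) - (x + h)) = 2 * ?\<rho>"
    proof -
      have e: "(x - h) - (x + h) = (-2) *\<^sub>R h" by (simp add: scaleR_2)
      show ?thesis unfolding e by simp
    qed
    also have "(1 + \<delta>) * (2 * ?\<rho>) * max (norm (x - h)) (norm (x + h)) powr (- \<delta>) \<le> 2 * (2 * ?\<rho>) * 1"
      using mpow \<delta> by (intro mult_mono) (auto simp: m_def max.commute)
    finally show ?thesis by simp
  qed
  have norm_sum: "norm (?y + ?z) \<le> 2" "norm (?y - ?z) \<le> 2"
    using norm_triangle_ineq[of ?y ?z] norm_triangle_ineq4[of ?y ?z] by (auto simp: norm_sgn split: if_splits)
  have msgn: "m * norm (sgn (x + h) - sgn c) \<le> 2 * norm ((x + h) - c)"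
    if "norm c = norm (x - h)" for c
    using norm_sgn_diff_le[of "x + h" c] norm_sgn_diff_le[of c "x + h"] that
    by (auto simp: m_def max_def norm_minus_commute)
  have main: "\<bar>symm_integrand s i \<delta> p q x h\<bar> \<le> ?K * (?C * \<bar>D2\<bar> + \<bar>q\<bar> / 4 * (norm (?y - ?z) * norm (?y + ?z)) * (4 * ?\<rho>))"
  proof -
    have "\<bar>(Qp + Qm) / 2 * D2 + (Qp - Qm) / 2 * D1\<bar> \<le> \<bar>(Qp + Qm) / 2\<bar> * \<bar>D2\<bar> + \<bar>(Qp - Qm) / 2\<bar> * \<bar>D1\<bar>"
      by (intro abs_triangle_ineq[THEN order_trans]) (simp only: abs_mult order_refl)
    also have "\<dots> \<le> ?C * \<bar>D2\<bar> + \<bar>q\<bar> / 4 * (norm (?y - ?z) * norm (?y + ?z)) * (4 * ?\<rho>)"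
      using Qsum Qdiff D1 by (intro add_mono mult_mono) auto
    finally show ?thesis unfolding S abs_mult by (simp add: mult_left_mono)
  qed
  have q: "\<bar>q\<bar> \<le> ?C" by simp
  show "\<bar>symm_integrand s i \<delta> p q x h\<bar> \<le> 26 * ?C * ?K" if far: "?\<rho> \<ge> 1/4"
  proof -
    \<comment> \<open>By oddness u (x + h) + u (x - h) = u (x + h) - u (h - x), a difference over
      the fixed distance 2.\<close>
    have "\<bar>?u (x + h) - ?u (h - x)\<bar> \<le> (1 + \<delta>) * norm ((x + h) - (h - x)) * max (norm (x + h)) (norm (h - x)) powr (- \<delta>)"
      by (rule u_sol_diff_le[OF \<delta>])
    also have "norm ((x + h) - (h - x)) = 2"
    proof -
      have e: "(x + h) - (h - x) = 2 *\<^sub>R x" by (simp add: scaleR_2)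
      show ?thesis unfolding e using x by simp
    qed
    also have "(1 + \<delta>) * 2 * max (norm (x + h)) (norm (h - x)) powr (- \<delta>) \<le> 2 * 2 * 1"
      using mpow \<delta> by (intro mult_mono) (auto simp: m_def norm_minus_commute)
    finally have "\<bar>?u (x + h) + ?u (x - h)\<bar> \<le> 4"
      using u_sol_minus[of i \<delta> "x - h"] by simp
    moreover have "\<bar>?u x\<bar> \<le> 1" using abs_u_sol_le[of i \<delta> x] x by simp
    ultimately have D2: "\<bar>D2\<bar> \<le> 6" by (simp add: D2_def)
    have "m * norm (?y + ?z) \<le> 4"
    proof -
      have e: "(x + h) - (h - x) = 2 *\<^sub>R x" by (simp add: scaleR_2)
      have "norm ((x + h) - (h - x)) = 2" unfolding e using x by simp
      moreover have "sgn (h - x) = - ?z" using sgn_minus[of "x - h"] by simp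
      ultimately show ?thesis using msgn[of "h - x"] by (simp add: norm_minus_commute)
    qed
    then have "?\<rho> * norm (?y + ?z) \<le> 4" using m2 mult_right_mono[OF m2, of "norm (?y + ?z)"] by simp
    then have 1: "norm (?y - ?z) * (?\<rho> * norm (?y + ?z)) \<le> 2 * 4"
      using norm_sum by (intro mult_mono) auto
    have "\<bar>q\<bar> * (norm (?y - ?z) * (?\<rho> * norm (?y + ?z))) \<le> ?C * (2 * 4)"
      by (rule mult_mono[OF q 1]) auto
    then have 2: "\<bar>q\<bar> / 4 * (norm (?y - ?z) * norm (?y + ?z)) * (4 * ?\<rho>) \<le> ?C * 8" by (simp add: mult_ac)
    have "?C * \<bar>D2\<bar> \<le> ?C * 6" using D2 by (intro mult_left_mono) auto
    note add_mono[OF this 2]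
    also have "?C * 6 + ?C * 8 \<le> 26 * ?C" by simp
    finally have "?C * \<bar>D2\<bar> + \<bar>q\<bar> / 4 * (norm (?y - ?z) * norm (?y + ?z)) * (4 * ?\<rho>) \<le> 26 * ?C" .
    then have "?K * (?C * \<bar>D2\<bar> + \<bar>q\<bar> / 4 * (norm (?y - ?z) * norm (?y + ?z)) * (4 * ?\<rho>)) \<le> ?K * (26 * ?C)"
      by (intro mult_left_mono) auto
    with main show ?thesis by (simp add: mult_ac)
  qed
  show "\<bar>symm_integrand s i \<delta> p q x h\<bar> \<le> 200 * ?C * ?\<rho>\<^sup>2 * ?K" if near: "?\<rho> \<le> 1/4"
  proof -
    define a where "a = \<delta> / 2"
    have a: "0 \<le> a" "a \<le> 1" using \<delta> by (auto simp: a_def)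
    define v where "v z = (1 + z) powr (- a)" for z :: real
    \<comment> \<open>These satisfy |x + h|^2 = 1 + \<open>zp\<close> and |x - h|^2 = 1 +
      \<open>zm\<close>, so u near x is governed by (1 + z)^(-\<delta>/2).\<close>
    define zp zm where "zp = 2 * (x \<bullet> h) + ?\<rho>\<^sup>2" and "zm = - 2 * (x \<bullet> h) + ?\<rho>\<^sup>2"
    have xh: "\<bar>x \<bullet> h\<bar> \<le> ?\<rho>" using Cauchy_Schwarz_ineq2[of x h] x by simp
    have rr: "?\<rho>\<^sup>2 \<le> ?\<rho> / 4" using near mult_right_mono[OF near, of ?\<rho>] by (simp add: power2_eq_square)
    have zle: "\<bar>zp\<bar> \<le> 9/4 * ?\<rho>" "\<bar>zm\<bar> \<le> 9/4 * ?\<rho>"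
      using xh rr zero_le_power2[of ?\<rho>] unfolding zp_def zm_def by linarith+
    then have z16: "\<bar>zp\<bar> \<le> 9/16" "\<bar>zm\<bar> \<le> 9/16" using near by linarith+
    have zsq: "z\<^sup>2 \<le> 6 * ?\<rho>\<^sup>2" if "\<bar>z\<bar> \<le> 9/4 * ?\<rho>" for z
    proof -
      have "z\<^sup>2 \<le> (9/4 * ?\<rho>)\<^sup>2" using power_mono[OF that, of 2] by simp
      also have "\<dots> \<le> 6 * ?\<rho>\<^sup>2" unfolding power_mult_distrib by (intro mult_right_mono) (auto simp: power2_eq_square)
      finally show ?thesis .
    qed
    have vp: "0 \<le> v zp - 1 + a * zp" "v zp - 1 + a * zp \<le> 18 * ?\<rho>\<^sup>2"
      and vm: "0 \<le> v zm - 1 + a * zm" "v zm - 1 + a * zm \<le> 18 * ?\<rho>\<^sup>2"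
      using powr_second_order_bounds[OF a z16(1)] powr_second_order_bounds[OF a z16(2)] zsq[OF zle(1)] zsq[OF zle(2)]
      by (auto simp: v_def)
    have azz: "a * zp + a * zm = 2 * a * ?\<rho>\<^sup>2" "a * zp - a * zm = 4 * a * (x \<bullet> h)"
      by (simp_all add: zp_def zm_def algebra_simps)
    have ar: "a * ?\<rho>\<^sup>2 \<le> ?\<rho>\<^sup>2" "0 \<le> a * ?\<rho>\<^sup>2" using a by (auto intro: mult_left_le_one_le)
    \<comment> \<open>38 = 18 + 18 + 2: two second-order remainders and the sum of the linear terms,
      which is itself of order |h|^2.\<close>
    have sum: "\<bar>2 - v zp - v zm\<bar> \<le> 38 * ?\<rho>\<^sup>2"
      using vp vm azz(1) ar by (simp add: abs_le_iff)
    have axh: "\<bar>4 * a * (x \<bullet> h)\<bar> \<le> 4 * ?\<rho>"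
    proof -
      have "a * \<bar>x \<bullet> h\<bar> \<le> 1 * ?\<rho>" using a xh by (intro mult_mono) auto
      then show ?thesis using a by (simp add: abs_mult)
    qed
    \<comment> \<open>The linear terms give 4 |h|, and a remainder of 18 |h|^2 is at most 9/2 |h|
      for |h| \<le> 1/4.\<close>
    have dif: "\<bar>v zp - v zm\<bar> \<le> 9 * ?\<rho>"
      using vp vm azz(2) axh rr by (simp add: abs_le_iff)
    have np: "norm (x + h) powr (- \<delta>) = v zp" "norm (x - h) powr (- \<delta>) = v zm"
    proof -
      have *: "norm y powr (- \<delta>) = ((norm y)\<^sup>2) powr (- a)" for y :: "real ^ 'n"
        by (cases "y = 0") (simp_all add: a_def powr_powr flip: powr_numeral)
      have xx: "x \<bullet> x = 1" using x by (simp add: dot_square_norm)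
      have "(norm (x + h))\<^sup>2 = 1 + zp" "(norm (x - h))\<^sup>2 = 1 + zm"
        by (simp_all add: zp_def zm_def power2_norm_eq_inner inner_simps inner_commute xx)
      then show "norm (x + h) powr (- \<delta>) = v zp" "norm (x - h) powr (- \<delta>) = v zm"
        by (simp_all only: * v_def)
    qed
    have "D2 = x $ i * (2 - v zp - v zm) - h $ i * (v zp - v zm)"
      unfolding D2_def u_sol_alt np using x by (simp add: algebra_simps)
    also have "\<bar>\<dots>\<bar> \<le> \<bar>x $ i\<bar> * \<bar>2 - v zp - v zm\<bar> + \<bar>h $ i\<bar> * \<bar>v zp - v zm\<bar>"
      by (intro abs_triangle_ineq4[THEN order_trans]) (simp only: abs_mult order_refl)
    also have "\<dots> \<le> 1 * (38 * ?\<rho>\<^sup>2) + ?\<rho> * (9 * ?\<rho>)"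
      using sum dif component_le_norm_cart[of x i] component_le_norm_cart[of h i] x by (intro add_mono mult_mono) auto
    finally have D2: "\<bar>D2\<bar> \<le> 47 * ?\<rho>\<^sup>2" by (simp add: power2_eq_square)
    have "m * norm (?y - ?z) \<le> 4 * ?\<rho>"
    proof -
      have e: "(x + h) - (x - h) = 2 *\<^sub>R h" by (simp add: scaleR_2)
      have "norm ((x + h) - (x - h)) = 2 * ?\<rho>" unfolding e by simp
      then show ?thesis using msgn[of "x - h"] by simp
    qed
    then have "norm (?y - ?z) \<le> 4 * ?\<rho>" using mult_right_mono[OF m1, of "norm (?y - ?z)"] by simp
    then have 1: "norm (?y - ?z) * norm (?y + ?z) \<le> (4 * ?\<rho>) * 2"
      using norm_sum by (intro mult_mono) auto
    have "\<bar>q\<bar> * (norm (?y - ?z) * norm (?y + ?z)) \<le> ?C * ((4 * ?\<rho>) * 2)"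
      by (rule mult_mono[OF q 1]) auto
    then have "\<bar>q\<bar> * (norm (?y - ?z) * norm (?y + ?z)) * ?\<rho> \<le> ?C * ((4 * ?\<rho>) * 2) * ?\<rho>"
      by (intro mult_right_mono) auto
    then have "\<bar>q\<bar> / 4 * (norm (?y - ?z) * norm (?y + ?z)) * (4 * ?\<rho>) \<le> 8 * (?C * ?\<rho>\<^sup>2)"
      by (simp add: power2_eq_square mult_ac)
    moreover have "?C * \<bar>D2\<bar> \<le> ?C * (47 * ?\<rho>\<^sup>2)" using D2 by (intro mult_left_mono) auto
    moreover have "0 \<le> ?C * ?\<rho>\<^sup>2" by simp
    ultimately have "?C * \<bar>D2\<bar> + \<bar>q\<bar> / 4 * (norm (?y - ?z) * norm (?y + ?z)) * (4 * ?\<rho>) \<le> 200 * (?C * ?\<rho>\<^sup>2)" by linarith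
    then have "?K * (?C * \<bar>D2\<bar> + \<bar>q\<bar> / 4 * (norm (?y - ?z) * norm (?y + ?z)) * (4 * ?\<rho>)) \<le> ?K * (200 * (?C * ?\<rho>\<^sup>2))"
      by (intro mult_left_mono) auto
    from order_trans[OF main this] show ?thesis by (simp only: mult_ac)
  qed
qed

lemma integrable_symm_integrand_unit:
  fixes x :: "real ^ 'n::finite"
  assumes x: "norm x = 1" and \<delta>: "0 \<le> \<delta>" "\<delta> \<le> 1" and s: "0 < s" "s < 1"
  shows "integrable lborel (symm_integrand s i \<delta> p q x)"
proof -
  let ?d = "real CARD('n)"
  let ?C = "\<bar>p\<bar> + \<bar>q\<bar>"
  let ?P = "DIM(real ^ 'n) / 2 + s"
  \<comment> \<open>The majorant adds a term for small h, integrable because 2 - 2s > 0, and one for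
    large h, integrable because s > 0.\<close>
  let ?w = "\<lambda>h::real ^ 'n. 200 * ?C * (indicator (ball 0 1) h * norm h powr (2 - ?d - 2 * s)) + 26 * ?C * 17 powr ?P * (1 + (norm h)\<^sup>2) powr (- ?P)"
  have "integrable lborel ?w"
    using s by (intro Bochner_Integration.integrable_add integrable_mult_right integrable_norm_powr_ball integrable_inverse_quadratic_powr) auto
  then show ?thesis
  proof (rule Bochner_Integration.integrable_bound)
    show "symm_integrand s i \<delta> p q x \<in> borel_measurable lborel"
      unfolding symm_integrand_def[abs_def] by measurable
    have "\<bar>symm_integrand s i \<delta> p q x h\<bar> \<le> ?w h" if h: "h \<noteq> 0" for h
    proof (cases "norm h \<le> 1/4")
      case True
      have "2 - ?d - 2 * s = 2 + (- ?d - 2 * s)" by simp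
      then have "norm h powr (2 - ?d - 2 * s) = norm h powr 2 * norm h powr (- ?d - 2 * s)" by (simp only: powr_add)
      then have eq: "norm h powr (2 - ?d - 2 * s) = (norm h)\<^sup>2 * norm h powr (- ?d - 2 * s)" using h by (simp add: powr_numeral)
      have "0 \<le> 26 * ?C * 17 powr ?P * (1 + (norm h)\<^sup>2) powr (- ?P)" by simp
      moreover have "indicator (ball 0 1) h = (1::real)" using True by simp
      moreover note symm_integrand_bounds(2)[OF x \<delta> True, of s i p q]
      ultimately show ?thesis unfolding eq by (simp only: mult.assoc mult_1)
    next
      case False
      \<comment> \<open>Here 1 \<le> 16 |h|^2, whence the constant 17.\<close>
      have "1 + (norm h)\<^sup>2 \<le> 17 * (norm h)\<^sup>2"
      proof -
        have "(1/4)\<^sup>2 \<le> (norm h)\<^sup>2" using False by (intro power_mono) auto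
        then show ?thesis by (simp add: power2_eq_square)
      qed
      then have "(17 * (norm h)\<^sup>2) powr (- ?P) \<le> (1 + (norm h)\<^sup>2) powr (- ?P)"
        using s by (intro powr_mono2') (auto simp: add_pos_nonneg)
      moreover have "(17 * (norm h)\<^sup>2) powr (- ?P) = 17 powr (- ?P) * norm h powr (- ?d - 2 * s)"
      proof -
        have "((norm h)\<^sup>2) powr (- ?P) = norm h powr (2 * - ?P)"
          using h by (simp add: powr_powr flip: powr_numeral)
        moreover have "2 * - ?P = - ?d - 2 * s" by simp
        ultimately have "((norm h)\<^sup>2) powr (- ?P) = norm h powr (- ?d - 2 * s)" by (simp only: )
        then show ?thesis by (simp add: powr_mult)
      qed
      ultimately have 1: "17 powr ?P * (17 powr (- ?P) * norm h powr (- ?d - 2 * s)) \<le> 17 powr ?P * (1 + (norm h)\<^sup>2) powr (- ?P)"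
        by (intro mult_left_mono) auto
      have one: "(17::real) powr ?P * 17 powr (- ?P) = 1" by (simp add: powr_add[symmetric])
      have "norm h powr (- ?d - 2 * s) \<le> 17 powr ?P * (1 + (norm h)\<^sup>2) powr (- ?P)"
        using 1 by (simp only: mult.assoc[symmetric] one mult_1)
      then have "26 * ?C * norm h powr (- ?d - 2 * s) \<le> 26 * ?C * (17 powr ?P * (1 + (norm h)\<^sup>2) powr (- ?P))"
        by (intro mult_left_mono) auto
      moreover have "0 \<le> 200 * ?C * (indicator (ball 0 1) h * norm h powr (2 - ?d - 2 * s))" by simp
      moreover have "1/4 \<le> norm h" using False by simp
      note symm_integrand_bounds(1)[OF x \<delta> this, of s i p q]
      ultimately show ?thesis unfolding mult.assoc by linarith
    qed
    then show "AE h in lborel. norm (symm_integrand s i \<delta> p q x h) \<le> norm (?w h)"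
      using AE_lborel_singleton[of "0::real ^ 'n"] by (auto elim!: eventually_mono)
  qed
qed

lemma aniso_weight_unit:
  fixes x h :: "real ^ 'n::finite"
  assumes x: "norm x = 1"
  shows "(norm h)\<^sup>2 * aniso_weight p q x h = iso_part p q x (x + h) + q / 2 * (norm (x + h) powr (-2) * (x \<bullet> (x + h))\<^sup>2)"
proof -
  have xx: "x \<bullet> x = 1" using x by (simp add: dot_square_norm)
  define c where "c = x \<bullet> h"
  define r where "r = norm h"
  have hh: "h \<bullet> h = r\<^sup>2" by (simp add: r_def power2_norm_eq_inner)
  have 1: "r\<^sup>2 * (v \<bullet> sgn h)\<^sup>2 = (v \<bullet> h)\<^sup>2" for v
    by (cases "h = 0") (simp_all add: r_def sgn_div_norm power_mult_distrib power_inverse field_simps)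
  have 2: "(sgn (x + h) \<bullet> h)\<^sup>2 = norm (x + h) powr (-2) * (c + r\<^sup>2)\<^sup>2"
  proof (cases "x + h = 0")
    case False
    have "(sgn (x + h) \<bullet> h)\<^sup>2 = (((x + h) \<bullet> h) / norm (x + h))\<^sup>2"
      by (simp add: sgn_div_norm divide_inverse mult.commute)
    also have "(x + h) \<bullet> h = c + r\<^sup>2" by (simp add: inner_add_left c_def hh)
    also have "((c + r\<^sup>2) / norm (x + h))\<^sup>2 = norm (x + h) powr (-2) * (c + r\<^sup>2)\<^sup>2"
      using False by (simp add: powr_minus powr_numeral field_simps)
    finally show ?thesis .
  qed simp
  have n2: "(norm (x + h))\<^sup>2 = 1 + 2 * c + r\<^sup>2"
    by (simp add: power2_norm_eq_inner inner_simps xx hh c_def inner_commute)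
  \<comment> \<open>Division of (c + r^2)^2 by |x + h|^2 = 1 + 2c + r^2 with quotient r^2 - 1 and
    remainder (1 + c)^2. At x + h = 0 both sides are 0, as r = 1 and \<open>0 powr (-2)\<close> is
    0.\<close>
  have 3: "norm (x + h) powr (-2) * (c + r\<^sup>2)\<^sup>2 = r\<^sup>2 - 1 + norm (x + h) powr (-2) * (1 + c)\<^sup>2"
  proof (cases "x + h = 0")
    case True
    then have "h = - x" by (simp add: eq_neg_iff_add_eq_0 add.commute)
    then show ?thesis using True x by (simp add: r_def)
  next
    case False
    have inv: "norm (x + h) powr (-2) * (1 + 2 * c + r\<^sup>2) = 1"
      using False unfolding n2[symmetric] by (simp add: powr_minus powr_numeral)
    have e: "(c + r\<^sup>2)\<^sup>2 = (1 + 2 * c + r\<^sup>2) * (r\<^sup>2 - 1) + (1 + c)\<^sup>2"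
      by (simp add: power2_eq_square algebra_simps)
    have "norm (x + h) powr (-2) * (c + r\<^sup>2)\<^sup>2 = (norm (x + h) powr (-2) * (1 + 2 * c + r\<^sup>2)) * (r\<^sup>2 - 1) + norm (x + h) powr (-2) * (1 + c)\<^sup>2"
      unfolding e by (simp add: algebra_simps)
    then show ?thesis unfolding inv by simp
  qed
  have s: "sgn x = x" using x by (simp add: sgn_div_norm)
  have "(norm h)\<^sup>2 * aniso_weight p q x h = p * r\<^sup>2 + q / 2 * (r\<^sup>2 * (x \<bullet> sgn h)\<^sup>2 + r\<^sup>2 * (sgn (x + h) \<bullet> sgn h)\<^sup>2)"
    unfolding aniso_weight_def r_def[symmetric] s by (simp add: algebra_simps)
  also have "\<dots> = p * r\<^sup>2 + q / 2 * (c\<^sup>2 + (r\<^sup>2 - 1 + norm (x + h) powr (-2) * (1 + c)\<^sup>2))"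
    unfolding 1 2 3 c_def[symmetric] ..
  also have "\<dots> = iso_part p q x (x + h) + q / 2 * (norm (x + h) powr (-2) * (x \<bullet> (x + h))\<^sup>2)"
  proof -
    have "x \<bullet> (x + h) = 1 + c" by (simp add: inner_simps xx c_def)
    moreover have "(x - (x + h)) \<bullet> (x - (x + h)) = r\<^sup>2" by (simp add: hh)
    ultimately show ?thesis
      unfolding iso_part_def by (simp add: power2_eq_square field_simps)
  qed
  finally show ?thesis .
qed

text \<open>The Gaussian parameter t and the variable h are exchanged. Fubini needs absolute
  integrability, which is only available for the symmetrised integrand; so the kernel is expanded
  against \<open>M\<close>, the symmetrisation of \<open>N\<close>.\<close>

lemma integral_symm_integrand_unit:
  fixes x :: "real ^ 'n::finite"
  assumes x: "norm x = 1" and \<delta>: "0 < \<delta>" "\<delta> \<le> 1" and s: "0 < s" "s < 1" and d: "CARD('n) \<ge> 2"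
    and zero: "has_bochner_integral lborel (\<lambda>t. indicator {0<..} t * (t powr s * averaged_defect (real CARD('n)) (\<delta> / 2) p q t)) 0"
  shows "(LINT h|lborel. symm_integrand s i \<delta> p q x h) = 0"
proof -
  let ?d = "real CARD('n)"
  \<comment> \<open>2 \<open>?P\<close> = d + 2s + 2: the exponent after |h|^2 has been moved into
    \<open>N\<close>.\<close>
  let ?P = "?d / 2 + s + 1"
  have P: "?P > 0" using s by (simp add: add_nonneg_pos)
  define u where "u = axis i (1::real)"
  have xu: "v \<bullet> u = v $ i" for v by (simp add: u_def inner_axis)
  define N where "N h = (norm h)\<^sup>2 * aniso_weight p q x h * (u_sol i \<delta> x - u_sol i \<delta> (x + h))" for h
  define M where "M h = N h + N (- h)" for h
  have [measurable]: "M \<in> borel_measurable borel"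
    unfolding M_def[abs_def] N_def aniso_weight_def by measurable
  have SM: "symm_integrand s i \<delta> p q x h = M h / norm h powr (2 * ?P)" if "h \<noteq> 0" for h
  proof -
    have "- ?d - 2 * s = 2 + - (2 * ?P)" by simp
    then have "norm h powr (- ?d - 2 * s) = norm h powr 2 * norm h powr (- (2 * ?P))" by (simp only: powr_add)
    then have "norm h powr (- ?d - 2 * s) = (norm h)\<^sup>2 / norm h powr (2 * ?P)"
      using that by (simp only: powr_minus_divide) (simp add: powr_numeral)
    then show ?thesis
      by (simp only: symm_integrand_def aniso_integrand_def M_def N_def norm_minus_cancel) (simp add: add_divide_distrib)
  qed
  define W where "W t h = indicator {0<..} t * (t powr (?P - 1) * exp (- (t * (norm h)\<^sup>2))) * M h" for t h
  have meas: "case_prod W \<in> borel_measurable (lborel \<Otimes>\<^sub>M lborel)"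
    unfolding W_def by measurable
  have Wt: "has_bochner_integral lborel (\<lambda>t. W t h) (Gamma ?P * symm_integrand s i \<delta> p q x h)" if h: "h \<noteq> 0" for h
  proof -
    have "has_bochner_integral lborel (\<lambda>t. W t h) (Gamma ?P / ((norm h)\<^sup>2) powr ?P * M h)"
      unfolding W_def by (rule has_bochner_integral_mult_left) (rule has_bochner_integral_Gamma[OF P], use h in simp)
    moreover have "((norm h)\<^sup>2) powr ?P = norm h powr (2 * ?P)"
      using h by (simp add: powr_powr flip: powr_numeral)
    ultimately show ?thesis using SM[OF h] by simp
  qed
  have Wabs: "(LINT t|lborel. \<bar>W t h\<bar>) = Gamma ?P * \<bar>symm_integrand s i \<delta> p q x h\<bar>" if h: "h \<noteq> 0" for h
  proof -
    \<comment> \<open>The factor in front of \<open>M h\<close> is nonnegative, so the absolute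
      value only multiplies by the sign of \<open>M h\<close>, which is constant in t.\<close>
    have "\<bar>W t h\<bar> = W t h * sgn (M h)" for t
      unfolding W_def abs_mult[of _ "M h"] abs_sgn[of "M h"] by (simp add: abs_mult)
    then have "(LINT t|lborel. \<bar>W t h\<bar>) = Gamma ?P * (symm_integrand s i \<delta> p q x h * sgn (M h))"
      using has_bochner_integral_mult_left[OF Wt[OF h], of "sgn (M h)"] by (simp add: has_bochner_integral_iff mult.assoc)
    also have "symm_integrand s i \<delta> p q x h * sgn (M h) = \<bar>symm_integrand s i \<delta> p q x h\<bar>"
      unfolding SM[OF h] abs_divide by (simp add: abs_sgn[of "M h"])
    finally show ?thesis .
  qed
  have ae: "AE h in lborel. h \<noteq> (0 :: real ^ 'n)" by (rule AE_lborel_singleton)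
  have aeint: "AE h in lborel. integrable lborel (\<lambda>t. W t h)"
    using ae by (rule eventually_mono) (use Wt in \<open>auto simp: has_bochner_integral_iff\<close>)
  have absint: "integrable lborel (\<lambda>h. LINT t|lborel. \<bar>W t h\<bar>)"
  proof (rule integrable_cong_AE_imp)
    show "integrable lborel (\<lambda>h. Gamma ?P * \<bar>symm_integrand s i \<delta> p q x h\<bar>)"
      using integrable_symm_integrand_unit[OF x _ \<delta>(2) s, of i p q] \<delta> by simp
    show "(\<lambda>h. LINT t|lborel. \<bar>W t h\<bar>) \<in> borel_measurable lborel"
      by (intro lborel.borel_measurable_lebesgue_integral) (simp add: W_def)
    show "AE h in lborel. Gamma ?P * \<bar>symm_integrand s i \<delta> p q x h\<bar> = (LINT t|lborel. \<bar>W t h\<bar>)"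
      using ae by (rule eventually_mono) (use Wabs in auto)
  qed
  have Wh: "(LINT h|lborel. W t h) = 2 * pi powr (?d / 2) * (x \<bullet> u) * (indicator {0<..} t * (t powr s * averaged_defect ?d (\<delta> / 2) p q t))" for t
  proof (cases "t > 0")
    case True
    let ?v = "(pi / t) powr (?d / 2) * ((x \<bullet> u) * averaged_defect ?d (\<delta> / 2) p q t)"
    have "has_bochner_integral lborel (\<lambda>y. exp (- t * (norm (x - y))\<^sup>2) *
      ((iso_part p q x y + q / 2 * (norm y powr (-2) * (x \<bullet> y)\<^sup>2)) * (x \<bullet> u - norm y powr (- 2 * (\<delta> / 2)) * (y \<bullet> u)))) ?v"
      using gaussian_integral_defect[OF x True, of "\<delta> / 2" p q u] \<delta> d by simp
    from has_bochner_integral_lborel_translate[OF this, of x]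
    have "has_bochner_integral lborel (\<lambda>h. exp (- t * (norm h)\<^sup>2) * N h) ?v"
      using x by (simp add: N_def aniso_weight_unit[OF x] u_sol_alt xu)
    from has_bochner_integral_add[OF this has_bochner_integral_lborel_uminus[OF this]]
    have "has_bochner_integral lborel (\<lambda>h. t powr (?P - 1) * (exp (- t * (norm h)\<^sup>2) * N h + exp (- t * (norm (- h))\<^sup>2) * N (- h))) (t powr (?P - 1) * (?v + ?v))"
      by (rule has_bochner_integral_mult_right)
    moreover have "t powr (?P - 1) * (exp (- t * (norm h)\<^sup>2) * N h + exp (- t * (norm (- h))\<^sup>2) * N (- h)) = W t h" for h
      using True by (simp add: W_def M_def algebra_simps)
    \<comment> \<open>The Gaussian mass takes t^(d/2) away from t^(d/2 + s), leaving the weight t^s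
      of the hypothesis \<open>zero\<close>.\<close>
    moreover have "t powr (?P - 1) * (pi / t) powr (?d / 2) = pi powr (?d / 2) * t powr s"
    proof -
      have "t powr (?P - 1) = t powr (?d / 2) * t powr s" by (simp add: powr_add[symmetric])
      then show ?thesis using True by (simp add: powr_divide)
    qed
    then have "t powr (?P - 1) * (?v + ?v) = 2 * pi powr (?d / 2) * (x \<bullet> u) * (indicator {0<..} t * (t powr s * averaged_defect ?d (\<delta> / 2) p q t))"
      using True by (simp add: mult.assoc[symmetric] distrib_left[symmetric])
    ultimately show ?thesis by (simp only: has_bochner_integral_iff)
  next
    case False
    then show ?thesis by (simp add: W_def)
  qed
  have "(LINT h|lborel. LINT t|lborel. W t h) = (LINT h|lborel. Gamma ?P * symm_integrand s i \<delta> p q x h)"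
  proof (rule integral_cong_AE)
    show "(\<lambda>h. LINT t|lborel. W t h) \<in> borel_measurable lborel"
      by (intro lborel.borel_measurable_lebesgue_integral) (simp add: W_def)
    show "(\<lambda>h. Gamma ?P * symm_integrand s i \<delta> p q x h) \<in> borel_measurable lborel"
      unfolding symm_integrand_def by measurable
    show "AE h in lborel. (LINT t|lborel. W t h) = Gamma ?P * symm_integrand s i \<delta> p q x h"
      using ae by (rule eventually_mono) (use Wt in \<open>auto simp: has_bochner_integral_iff\<close>)
  qed
  also have "\<dots> = Gamma ?P * (LINT h|lborel. symm_integrand s i \<delta> p q x h)"
    by (rule integral_mult_right_zero)
  finally have "Gamma ?P * (LINT h|lborel. symm_integrand s i \<delta> p q x h) = (LINT t|lborel. LINT h|lborel. W t h)"
    using lborel_fubini_swap(2)[OF meas aeint absint] by simp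
  also have "\<dots> = 2 * pi powr (?d / 2) * (x \<bullet> u) * 0"
    unfolding Wh using has_bochner_integral_mult_right[OF zero, of "2 * pi powr (?d / 2) * (x \<bullet> u)"]
    by (simp add: has_bochner_integral_iff)
  finally show ?thesis using Gamma_real_pos[OF P] by simp
qed

subsection \<open>The limit of the truncated integrals\<close>

lemma has_bochner_integral_lborel_scaleR:
  fixes f :: "'a::euclidean_space \<Rightarrow> real"
  assumes f: "has_bochner_integral lborel f v" and k: "k > 0"
  shows "has_bochner_integral lborel (\<lambda>h. f (k *\<^sub>R h)) (v / k ^ DIM('a))"
proof -
  have [measurable]: "f \<in> borel_measurable borel"
    using borel_measurable_has_bochner_integral[OF f] by simp
  let ?M = "density (distr lborel borel (\<lambda>x::'a. 0 + k *\<^sub>R x)) (\<lambda>_. ennreal (\<bar>k\<bar> ^ DIM('a)))"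
  have L: "?M = lborel" by (rule lborel_affine[symmetric]) (use k in simp)
  have "integrable ?M f" "integral\<^sup>L ?M f = v" unfolding L using f by (simp_all add: has_bochner_integral_iff)
  moreover have "integrable ?M f \<longleftrightarrow> integrable lborel (\<lambda>h. k ^ DIM('a) * f (k *\<^sub>R h))"
    using k by (subst integrable_density) (simp_all add: integrable_distr_eq)
  moreover have "integral\<^sup>L ?M f = (LINT h|lborel. k ^ DIM('a) * f (k *\<^sub>R h))"
    using k by (subst integral_density) (simp_all add: integral_distr)
  ultimately have "has_bochner_integral lborel (\<lambda>h. k ^ DIM('a) * f (k *\<^sub>R h)) v"
    by (simp only: has_bochner_integral_iff)
  then have "has_bochner_integral lborel (\<lambda>h. k ^ DIM('a) * f (k *\<^sub>R h) / k ^ DIM('a)) (v / k ^ DIM('a))"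
    by (rule has_bochner_integral_divide_zero)
  then show ?thesis using k by simp
qed

lemma symm_integrand_scale:
  fixes x :: "real ^ 'n::finite"
  assumes "c > 0"
  shows "symm_integrand s i \<delta> p q (c *\<^sub>R x) (c *\<^sub>R h) = c powr (1 - \<delta> - real CARD('n) - 2 * s) * symm_integrand s i \<delta> p q x h"
  using aniso_integrand_scale[OF assms, of s i \<delta> p q x h] aniso_integrand_scale[OF assms, of s i \<delta> p q x "- h"]
  by (simp add: symm_integrand_def distrib_left)

lemma has_bochner_integral_symm_integrand:
  fixes x :: "real ^ 'n::finite"
  assumes x: "x \<noteq> 0" and unit: "has_bochner_integral lborel (symm_integrand s i \<delta> p q (sgn x)) 0"
  shows "has_bochner_integral lborel (symm_integrand s i \<delta> p q x) 0"
proof -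
  define c where "c = norm x"
  have c: "c > 0" using x by (simp add: c_def)
  let ?e = "c powr (1 - \<delta> - real CARD('n) - 2 * s)"
  have xc: "x = c *\<^sub>R sgn x" using x by (simp add: c_def sgn_div_norm)
  have "has_bochner_integral lborel (\<lambda>h. ?e * symm_integrand s i \<delta> p q (sgn x) ((1 / c) *\<^sub>R h)) (?e * (0 / (1 / c) ^ DIM(real ^ 'n)))"
    by (intro has_bochner_integral_mult_right has_bochner_integral_lborel_scaleR unit) (use c in simp)
  moreover have "?e * symm_integrand s i \<delta> p q (sgn x) ((1 / c) *\<^sub>R h) = symm_integrand s i \<delta> p q x h" for h
    using symm_integrand_scale[OF c, of s i \<delta> p q "sgn x" "(1 / c) *\<^sub>R h"] c by (simp add: xc[symmetric])
  ultimately show ?thesis by simp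
qed

definition annulus :: "real \<Rightarrow> (real ^ 'n) set" where
  "annulus R = {h. 1 / R \<le> norm h \<and> norm h \<le> R}"

lemma annulus_borel [measurable]: "annulus R \<in> sets borel"
  unfolding annulus_def by measurable

lemma set_integrable_aniso_integrand:
  fixes x :: "real ^ 'n::finite"
  assumes \<delta>: "0 \<le> \<delta>" "\<delta> \<le> 1" and s: "0 < s" and R: "R > 0"
  shows "set_integrable lborel (annulus R) (aniso_integrand s i \<delta> p q x)"
proof -
  let ?B = "(1 / R) powr (- real CARD('n) - 2 * s) * (\<bar>p\<bar> + \<bar>q\<bar>) * (\<bar>u_sol i \<delta> x\<bar> + (1 + norm x + R))"
  have "integrable lborel (\<lambda>h::real ^ 'n. indicator (cball 0 R) h * ?B)"
    using emeasure_bounded_finite[OF bounded_cball[of "0::real ^ 'n" R]]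
    by (intro integrable_mult_left integrable_real_indicator) auto
  then show ?thesis
    unfolding set_integrable_def
  proof (rule Bochner_Integration.integrable_bound)
    show "AE h in lborel. norm (indicator (annulus R) h *\<^sub>R aniso_integrand s i \<delta> p q x h) \<le> norm (indicator (cball (0::real ^ 'n) R) h * ?B)"
    proof (rule AE_I2)
      fix h :: "real ^ 'n"
      show "norm (indicator (annulus R) h *\<^sub>R aniso_integrand s i \<delta> p q x h) \<le> norm (indicator (cball 0 R) h * ?B)"
      proof (cases "h \<in> annulus R")
        case True
        then have h: "1 / R \<le> norm h" "norm h \<le> R" by (auto simp: annulus_def)
        have "norm h powr (- real CARD('n) - 2 * s) \<le> (1 / R) powr (- real CARD('n) - 2 * s)"
          using h R s by (intro powr_mono2') auto
        moreover have "\<bar>u_sol i \<delta> (x + h)\<bar> \<le> 1 + norm x + R"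
        proof -
          have "norm (x + h) powr (1 - \<delta>) \<le> 1 + norm (x + h)"
          proof (cases "norm (x + h) \<le> 1")
            case True
            then have "norm (x + h) powr (1 - \<delta>) \<le> 1" using \<delta> by (intro powr_le1) auto
            then show ?thesis using norm_ge_zero[of "x + h"] by linarith
          next
            case False
            then have "norm (x + h) powr (1 - \<delta>) \<le> norm (x + h) powr 1" using \<delta> by (intro powr_mono) auto
            then show ?thesis by simp
          qed
          then show ?thesis
            using abs_u_sol_le[of i \<delta> "x + h"] norm_triangle_ineq[of x h] h by linarith
        qed
        then have "\<bar>u_sol i \<delta> x - u_sol i \<delta> (x + h)\<bar> \<le> \<bar>u_sol i \<delta> x\<bar> + (1 + norm x + R)"
          by linarith
        ultimately have "\<bar>aniso_integrand s i \<delta> p q x h\<bar> \<le> ?B"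
          unfolding aniso_integrand_def abs_mult
          by (intro mult_mono aniso_weight_le) auto
        then show ?thesis using True h R by (simp add: indicator_def abs_mult)
      qed simp
    qed
  qed measurable
qed

lemma set_integral_reflect:
  fixes f :: "'a::euclidean_space \<Rightarrow> real"
  assumes f: "set_integrable lborel A f" and A: "\<And>h. - h \<in> A \<longleftrightarrow> h \<in> A"
  shows "set_integrable lborel A (\<lambda>h. f (- h))" "(LINT h:A|lborel. f (- h)) = (LINT h:A|lborel. f h)"
proof -
  have "has_bochner_integral lborel (\<lambda>h. indicator A h *\<^sub>R f h) (LINT h:A|lborel. f h)"
    using f by (simp add: set_integrable_def set_lebesgue_integral_def has_bochner_integral_iff)
  from has_bochner_integral_lborel_uminus[OF this] A
  have "has_bochner_integral lborel (\<lambda>h. indicator A h *\<^sub>R f (- h)) (LINT h:A|lborel. f h)"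
    by (simp add: indicator_def)
  then show "set_integrable lborel A (\<lambda>h. f (- h))" "(LINT h:A|lborel. f (- h)) = (LINT h:A|lborel. f h)"
    by (simp_all add: set_integrable_def set_lebesgue_integral_def has_bochner_integral_iff)
qed

text \<open>The annuli are invariant under h \<mapsto> -h, so each truncated integral is half that
  of the symmetrised integrand. The latter is its own integrable majorant, and dominated convergence
  yields both existence and value of the limit.\<close>

lemma nonlocal_op_eq_zero:
  fixes x :: "real ^ 'n::finite"
  assumes \<delta>: "0 \<le> \<delta>" "\<delta> \<le> 1" and s: "0 < s"
    and S: "has_bochner_integral lborel (symm_integrand s i \<delta> (1 - (1 + 2 * s) / 2 * \<epsilon>) ((real CARD('n) + 2 * s) / 2 * \<epsilon>) x) 0"
  shows "nonlocal_op_exists (A_coeff s \<epsilon>) s (u_sol i \<delta>) x" "nonlocal_op (A_coeff s \<epsilon>) s (u_sol i \<delta>) x = 0"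
proof -
  define p where "p = 1 - (1 + 2 * s) / 2 * \<epsilon>"
  define q where "q = (real CARD('n) + 2 * s) / 2 * \<epsilon>"
  let ?I = "aniso_integrand s i \<delta> p q x" and ?S = "symm_integrand s i \<delta> p q x"
  have I: "nonlocal_integrand (A_coeff s \<epsilon>) s (u_sol i \<delta>) x = ?I"
    by (simp add: fun_eq_iff nonlocal_integrand_A_coeff p_def q_def)
  have S0: "integrable lborel ?S" "integral\<^sup>L lborel ?S = 0"
    using S by (simp_all add: has_bochner_integral_iff p_def q_def)
  have trunc: "truncated_integral (A_coeff s \<epsilon>) s (u_sol i \<delta>) x R = (LINT h|lborel. indicator (annulus R) h * ?S h) / 2"
    if R: "R > 0" for R
  proof -
    have int: "set_integrable lborel (annulus R) ?I"
      by (rule set_integrable_aniso_integrand[OF \<delta> s R])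
    have sym: "- h \<in> annulus R \<longleftrightarrow> h \<in> annulus R" for h :: "real ^ 'n" by (simp add: annulus_def)
    have "(LINT h|lborel. indicator (annulus R) h * ?S h) = (LINT h:annulus R|lborel. ?I h + ?I (- h))"
      by (simp add: set_lebesgue_integral_def symm_integrand_def)
    also have "\<dots> = 2 * (LINT h:annulus R|lborel. ?I h)"
      using set_integral_reflect[OF int sym] int by (simp add: set_integral_add)
    finally show ?thesis by (simp add: truncated_integral_def I annulus_def)
  qed
  have [measurable]: "?S \<in> borel_measurable lborel" using S0(1) by (rule borel_measurable_integrable)
  have "((\<lambda>R. LINT h|lborel. indicator (annulus R) h * ?S h) \<longlongrightarrow> integral\<^sup>L lborel ?S) at_top"
  proof (rule integral_dominated_convergence_at_top[where w = "\<lambda>h. \<bar>?S h\<bar>"])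
    show "integrable lborel (\<lambda>h. \<bar>?S h\<bar>)" using S0(1) by simp
    show "AE h in lborel. ((\<lambda>R. indicator (annulus R) h * ?S h) \<longlongrightarrow> ?S h) at_top"
      using AE_lborel_singleton[of "0::real ^ 'n"]
    proof (rule eventually_mono)
      fix h :: "real ^ 'n" assume h: "h \<noteq> 0"
      have "\<forall>\<^sub>F R in at_top. indicator (annulus R) h * ?S h = ?S h"
        using eventually_ge_at_top[of "max (norm h) (1 / norm h)"]
      proof (rule eventually_mono)
        fix R assume R: "max (norm h) (1 / norm h) \<le> R"
        have nh: "norm h > 0" using h by simp
        then have "R > 0" using R by linarith
        then have "h \<in> annulus R" using R nh by (auto simp: annulus_def field_simps)
        then show "indicator (annulus R) h * ?S h = ?S h" by simp
      qed
      then show "((\<lambda>R. indicator (annulus R) h * ?S h) \<longlongrightarrow> ?S h) at_top"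
        by (rule tendsto_eventually)
    qed
    show "\<forall>\<^sub>F R in at_top. AE h in lborel. norm (indicator (annulus R) h * ?S h) \<le> \<bar>?S h\<bar>"
      by (intro always_eventually allI AE_I2) (simp add: indicator_def)
  qed measurable
  then have "((\<lambda>R. (LINT h|lborel. indicator (annulus R) h * ?S h) / 2) \<longlongrightarrow> 0 / 2) at_top"
    unfolding S0(2) by (intro tendsto_divide tendsto_const) auto
  moreover have "\<forall>\<^sub>F R in at_top. (LINT h|lborel. indicator (annulus R) h * ?S h) / 2 = truncated_integral (A_coeff s \<epsilon>) s (u_sol i \<delta>) x R"
    using eventually_gt_at_top[of 0] by (rule eventually_mono) (simp add: trunc)
  ultimately have lim: "(truncated_integral (A_coeff s \<epsilon>) s (u_sol i \<delta>) x \<longlongrightarrow> 0) at_top"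
    by (simp add: filterlim_cong[OF refl refl])
  then show "nonlocal_op_exists (A_coeff s \<epsilon>) s (u_sol i \<delta>) x"
    unfolding nonlocal_op_exists_def I using set_integrable_aniso_integrand[OF \<delta> s] by (auto simp: annulus_def)
  have "Lim at_top (truncated_integral (A_coeff s \<epsilon>) s (u_sol i \<delta>) x) = 0"
    by (rule tendsto_Lim[OF _ lim]) simp
  then show "nonlocal_op (A_coeff s \<epsilon>) s (u_sol i \<delta>) x = 0"
    by (simp add: nonlocal_op_def)
qed

text \<open>For \<epsilon> = \<delta> = 0 the function u is a coordinate and the weight is 1, so the
  integrand is odd in h.\<close>

lemma symm_integrand_linear: "symm_integrand s i 0 1 0 x h = 0"
proof -
  have "u_sol i 0 y = y $ i" for y :: "real ^ 'a" by (cases "y = 0") (simp_all add: u_sol_alt)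
  then show ?thesis by (simp add: symm_integrand_def aniso_integrand_def aniso_weight_def algebra_simps)
qed

subsection \<open>The relation between the two parameters\<close>

text \<open>Concavity in increment form: the derivative in v of the increment over a fixed step is a
  difference of values of \<open>Polygamma 1\<close>, which is decreasing on the positive
  axis.\<close>

lemma Digamma_increment_antimono:
  fixes c y z :: real
  assumes "0 < z" "z \<le> y" "0 \<le> c"
  shows "Digamma (y + c) - Digamma y \<le> Digamma (z + c) - Digamma z"
proof (rule DERIV_nonpos_imp_nonincreasing[OF assms(2)])
  fix v assume v: "z \<le> v" "v \<le> y"
  then have pos: "v > 0" "v + c > 0" using assms by auto
  have "((\<lambda>v. Digamma (v + c) - Digamma v) has_real_derivative Polygamma 1 (v + c) - Polygamma 1 v) (at v)"
    using pos by (auto intro!: derivative_eq_intros elim!: nonpos_Ints_cases)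
  moreover have "Polygamma 1 (v + c) \<le> Polygamma 1 v"
    using pos assms Polygamma_real_strict_antimono[of v "v + c" 1] by (cases "c = 0") auto
  ultimately show "\<exists>D. ((\<lambda>v. Digamma (v + c) - Digamma v) has_real_derivative D) (at v) \<and> D \<le> 0"
    by (intro exI[of _ "Polygamma 1 (v + c) - Polygamma 1 v"]) auto
qed

text \<open>\<open>F\<close> is the logarithm of the part of the Gamma quotient that depends on
  \<delta>. Its derivative is half the difference of two Digamma increments over the same step 1 -
  s, taken at z = \<delta>/2 + s and at y = d/2 - \<delta>/2 + 1, and z \<le> y.\<close>

lemma eps_denominator_antimono:
  fixes d :: nat and s :: real
  assumes d: "d \<ge> 2" and s: "0 < s" "s < 1" and t: "0 \<le> t" "t \<le> 1"
  shows "eps_denominator d s t \<le> eps_denominator d s 0"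
proof -
  let ?d = "real d"
  define F where "F \<delta> = ln_Gamma (?d / 2 - s - \<delta> / 2 + 2) + ln_Gamma (1 + \<delta> / 2) - ln_Gamma (?d / 2 - \<delta> / 2 + 1) - ln_Gamma (\<delta> / 2 + s)" for \<delta>
  have dpos: "?d \<ge> 2" using d by simp
  have F: "F 0 \<le> F t"
  proof (rule DERIV_nonneg_imp_nondecreasing[OF t(1)])
    fix \<delta> assume \<delta>: "0 \<le> \<delta>" "\<delta> \<le> t"
    define z where "z = \<delta> / 2 + s"
    define y where "y = ?d / 2 - \<delta> / 2 + 1"
    have zy: "0 < z" "z \<le> y" using \<delta> s t dpos by (auto simp: z_def y_def)
    have args: "?d / 2 - s - \<delta> / 2 + 2 > 0" "1 + \<delta> / 2 > 0" "?d / 2 - \<delta> / 2 + 1 > 0" "\<delta> / 2 + s > 0"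
      using \<delta> s t dpos by auto
    let ?D = "(- Digamma (?d / 2 - s - \<delta> / 2 + 2) + Digamma (1 + \<delta> / 2) + Digamma (?d / 2 - \<delta> / 2 + 1) - Digamma (\<delta> / 2 + s)) / 2"
    have "(F has_real_derivative ?D) (at \<delta>)"
      unfolding F_def using args
      by (auto intro!: derivative_eq_intros simp: field_simps)
    moreover have "Digamma (y + (1 - s)) - Digamma y \<le> Digamma (z + (1 - s)) - Digamma z"
      using zy s by (intro Digamma_increment_antimono) auto
    then have "?D \<ge> 0" by (simp add: y_def z_def algebra_simps)
    ultimately show "\<exists>D. (F has_real_derivative D) (at \<delta>) \<and> 0 \<le> D" by blast
  qed
  have X: "(Gamma (?d / 2) * Gamma (s + 1) * Gamma (?d / 2 - s - \<delta> / 2 + 2) * Gamma (1 + \<delta> / 2)) /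
        (Gamma (?d / 2 - s) * Gamma (?d / 2 - \<delta> / 2 + 1) * Gamma (\<delta> / 2 + s))
      = Gamma (?d / 2) * Gamma (s + 1) / Gamma (?d / 2 - s) * exp (F \<delta>)" if "0 \<le> \<delta>" "\<delta> \<le> 1" for \<delta>
  proof -
    have "?d / 2 - s - \<delta> / 2 + 2 > 0" "1 + \<delta> / 2 > 0" "?d / 2 - \<delta> / 2 + 1 > 0" "\<delta> / 2 + s > 0"
      using that s dpos by auto
    then show ?thesis by (simp add: F_def exp_add exp_diff Gamma_real_pos_exp)
  qed
  have "Gamma (?d / 2) * Gamma (s + 1) / Gamma (?d / 2 - s) \<ge> 0"
    using dpos s by (intro divide_nonneg_nonneg mult_nonneg_nonneg less_imp_le[OF Gamma_real_pos]) auto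
  then have main: "Gamma (?d / 2) * Gamma (s + 1) / Gamma (?d / 2 - s) * exp (F 0) \<le> Gamma (?d / 2) * Gamma (s + 1) / Gamma (?d / 2 - s) * exp (F t)"
    using F by (intro mult_left_mono) auto
  show ?thesis
    unfolding eps_denominator_def X[OF order_refl zero_le_one] X[OF t]
    by (rule diff_left_mono, rule mult_left_mono[OF main]) (use dpos in auto)
qed

text \<open>At \<delta> = 0 the recurrence collapses the Gamma quotient to 2 s w (w + 1) / d with w
  = d/2 - s. The factored form shows that the value is positive.\<close>

lemma eps_denominator_zero:
  fixes d :: nat and s :: real
  assumes d: "d \<ge> 2" and s: "0 < s" "s < 1"
  shows "eps_denominator d s 0 = (real d - 1) * s * (real d - 2 * s + 2) * (2 * s / real d)"
proof -
  let ?d = "real d"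
  have dpos: "?d \<ge> 2" using d by simp
  define w where "w = ?d / 2 - s"
  have w: "w > 0" using dpos s by (simp add: w_def)
  have G: "Gamma (s + 1) = s * Gamma s" "Gamma (?d / 2 + 1) = ?d / 2 * Gamma (?d / 2)" "Gamma (w + 1) = w * Gamma w" "Gamma (w + 1 + 1) = (w + 1) * Gamma (w + 1)"
    by (rule Gamma_plus1; use s dpos w in \<open>auto elim!: nonpos_Ints_cases\<close>)+
  have pos: "Gamma s > 0" "Gamma (?d / 2) > 0" "Gamma w > 0" using s dpos w by (simp_all add: Gamma_real_pos)
  have w2: "w - 0 / 2 + 2 = w + 1 + 1" "?d / 2 - 0 / 2 + 1 = ?d / 2 + 1" "1 + 0 / 2 = (1::real)" "0 / 2 + s = s" "?d / 2 - s = w"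
    by (simp_all add: w_def)
  have G1: "Gamma 1 = (1::real)" by simp
  have A: "a * (s * b) * ((w + 1) * (w * c)) * 1 / (c * (?d / 2 * a) * b) = s * ((w + 1) * w) / (?d / 2)"
    if "a > 0" "b > 0" "c > 0" for a b c :: real
    using that dpos by (simp add: field_simps)
  have "eps_denominator d s 0 = (?d - 1) * s * (?d - 2 * s + 2) - 2 * (?d - 1) * (s * ((w + 1) * w) / (?d / 2))"
    unfolding eps_denominator_def w2 G G1 A[OF pos(2,1,3)] ..
  also have "\<dots> = (?d - 1) * s * (?d - 2 * s + 2) * (2 * s / ?d)"
    unfolding w_def using dpos by (simp add: field_simps)
  finally show ?thesis .
qed

text \<open>This is the sign needed at the right end \<delta> = 1/2 of the intermediate value
  argument in the extreme case \<epsilon> = 1/2.\<close>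

lemma eps_denominator_half_le:
  fixes d :: nat and s :: real
  assumes d: "d \<ge> 2" and s: "0 < s" "s < 1"
  shows "eps_denominator d s (1/2) \<le> 2 * (real d - 2 * s + 2 - 1/2)"
proof -
  let ?d = "real d"
  have dpos: "?d \<ge> 2" using d by simp
  have "eps_denominator d s (1/2) \<le> eps_denominator d s 0"
    by (rule eps_denominator_antimono[OF d s]) auto
  also have "\<dots> = 2 * s\<^sup>2 * ((?d - 1) / ?d * (?d - 2 * s + 2))"
    unfolding eps_denominator_zero[OF d s] by (simp add: power2_eq_square)
  also have "\<dots> \<le> 2 * s\<^sup>2 * (?d - 2 * s + 1)"
  proof (rule mult_left_mono)
    \<comment> \<open>Equivalent to (d - 2s + 2) / d \<ge> 1, which is s \<le> 1.\<close>
    show "(?d - 1) / ?d * (?d - 2 * s + 2) \<le> ?d - 2 * s + 1"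
      using dpos s by (simp add: field_simps)
  qed simp
  also have "2 * s\<^sup>2 * (?d - 2 * s + 1) \<le> 2 * 1 * (?d - 2 * s + 1)"
    using dpos s by (intro mult_right_mono mult_left_mono) (auto simp: power2_eq_square mult_le_one)
  also have "\<dots> \<le> 2 * (?d - 2 * s + 2 - 1/2)" by simp
  finally show ?thesis by simp
qed

lemma continuous_on_eps_denominator:
  fixes d :: nat and s :: real
  assumes d: "d \<ge> 2" and s: "0 < s" "s < 1"
  shows "continuous_on {0..1/2} (eps_denominator d s)"
proof -
  have dpos: "real d \<ge> 2" using d by simp
  have c: "continuous_on {0..1/2} (\<lambda>\<delta>. Gamma (f \<delta>))"
    if "continuous_on {0..1/2} f" "\<And>\<delta>. \<delta> \<in> {0..1/2} \<Longrightarrow> f \<delta> > 0" for f :: "real \<Rightarrow> real"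
  proof (rule continuous_on_compose2[OF continuous_on_Gamma[of "{0<..}"] that(1)])
    show "{0<..} \<inter> \<int>\<^sub>\<le>\<^sub>0 = ({} :: real set)" by (auto elim!: nonpos_Ints_cases)
  qed (use that(2) in auto)
  have c1: "continuous_on {0..1/2} (\<lambda>\<delta>. Gamma (real d / 2 - s - \<delta> / 2 + 2))"
    "continuous_on {0..1/2} (\<lambda>\<delta>::real. Gamma (1 + \<delta> / 2))"
    "continuous_on {0..1/2} (\<lambda>\<delta>. Gamma (real d / 2 - \<delta> / 2 + 1))"
    "continuous_on {0..1/2} (\<lambda>\<delta>. Gamma (\<delta> / 2 + s))"
    by (intro c continuous_on_add continuous_on_diff continuous_on_divide continuous_on_const continuous_on_id; use dpos s in auto)+
  have nz: "Gamma (real d / 2 - s) * Gamma (real d / 2 - \<delta> / 2 + 1) * Gamma (\<delta> / 2 + s) \<noteq> 0" if "\<delta> \<in> {0..1/2}" for \<delta>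
  proof -
    have "real d / 2 - s > 0" "real d / 2 - \<delta> / 2 + 1 > 0" "\<delta> / 2 + s > 0" using that dpos s by auto
    from this[THEN Gamma_real_pos] show ?thesis by simp
  qed
  show ?thesis
    unfolding eps_denominator_def
    by (intro continuous_on_diff continuous_on_mult continuous_on_divide continuous_on_const c1) (use nz in blast)
qed

lemma exists_delta:
  fixes d :: nat and s \<epsilon> :: real
  assumes d: "d \<ge> 2" and s: "0 < s" "s < 1" and \<epsilon>: "0 < \<epsilon>" "\<epsilon> \<le> 1/2"
  obtains \<delta> where "0 < \<delta>" "\<delta> \<le> 1/2" "\<epsilon> * eps_denominator d s \<delta> = 2 * (real d - 2 * s + 2 - \<delta>) * \<delta>" "eps_denominator d s \<delta> > 0"
proof -
  let ?d = "real d" and ?E = "eps_denominator d s"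
  have dpos: "?d \<ge> 2" using d by simp
  define G where "G \<delta> = \<epsilon> * ?E \<delta> - 2 * (?d - 2 * s + 2 - \<delta>) * \<delta>" for \<delta>
  have E0: "?E 0 > 0" unfolding eps_denominator_zero[OF d s] using dpos s by simp
  then have G0: "G 0 > 0" using \<epsilon> by (simp add: G_def)
  have "\<epsilon> * ?E (1/2) \<le> ?d - 2 * s + 2 - 1/2"
  proof (cases "?E (1/2) \<le> 0")
    case True
    then have "\<epsilon> * ?E (1/2) \<le> 0" using \<epsilon> by (simp add: mult_nonneg_nonpos)
    then show ?thesis using dpos s by linarith
  next
    case False
    then have "\<epsilon> * ?E (1/2) \<le> 1/2 * ?E (1/2)" using \<epsilon> by (intro mult_right_mono) auto
    then show ?thesis using eps_denominator_half_le[OF d s] by simp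
  qed
  then have G1: "G (1/2) \<le> 0" by (simp add: G_def)
  have "continuous_on {0..1/2} G"
    unfolding G_def by (intro continuous_intros continuous_on_eps_denominator[OF d s])
  then obtain \<delta> where \<delta>: "0 \<le> \<delta>" "\<delta> \<le> 1/2" "G \<delta> = 0"
    using IVT2'[of G "1/2" 0 0] G0 G1 by auto
  then have \<delta>0: "\<delta> > 0" using G0 by (cases "\<delta> = 0") auto
  have eq: "\<epsilon> * ?E \<delta> = 2 * (?d - 2 * s + 2 - \<delta>) * \<delta>" using \<delta>(3) by (simp add: G_def)
  \<comment> \<open>Positivity of the denominator at the root is read off from the relation itself,
    whose right side and \<epsilon> are positive.\<close>
  have "2 * (?d - 2 * s + 2 - \<delta>) * \<delta> > 0" using \<delta>0 \<delta>(2) dpos s by (intro mult_pos_pos) auto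
  then have "?E \<delta> > 0" using eq \<epsilon> by (metis zero_less_mult_pos)
  with \<delta>0 \<delta>(2) eq that show ?thesis by blast
qed

text \<open>For small \<delta> the denominator stays above half its positive value at 0, so the
  relation bounds \<epsilon> linearly; for \<delta> \<ge> \<eta> it suffices that \<epsilon> \<le>
  1/2 \<le> \<delta> / (2 \<eta>). The two summands of \<open>C\<close> belong to these two
  cases.\<close>

lemma eps_le_const_delta:
  fixes d :: nat and s :: real
  assumes d: "d \<ge> 2" and s: "0 < s" "s < 1"
  obtains C where "C \<ge> 0" "\<And>\<epsilon> \<delta>. 0 \<le> \<epsilon> \<Longrightarrow> \<epsilon> \<le> 1/2 \<Longrightarrow> 0 \<le> \<delta> \<Longrightarrow> \<delta> \<le> 1/2 \<Longrightarrow>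
    \<epsilon> * eps_denominator d s \<delta> = 2 * (real d - 2 * s + 2 - \<delta>) * \<delta> \<Longrightarrow> \<epsilon> \<le> C * \<delta>"
proof -
  let ?d = "real d" and ?E = "eps_denominator d s"
  have dpos: "?d \<ge> 2" using d by simp
  have E0: "?E 0 > 0" unfolding eps_denominator_zero[OF d s] using dpos s by simp
  have "\<exists>\<eta>>0. \<forall>\<delta>\<in>{0..1/2}. dist \<delta> 0 < \<eta> \<longrightarrow> dist (?E \<delta>) (?E 0) < ?E 0 / 2"
    by (rule bspec[OF continuous_on_eps_denominator[OF d s, unfolded continuous_on_iff], of 0, THEN spec, THEN mp])
      (use E0 in auto)
  then obtain \<eta> where \<eta>: "\<eta> > 0" "\<And>\<delta>. \<delta> \<in> {0..1/2} \<Longrightarrow> dist \<delta> 0 < \<eta> \<Longrightarrow> dist (?E \<delta>) (?E 0) < ?E 0 / 2" by blast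
  define C where "C = 4 * (?d + 2) / ?E 0 + 1 / (2 * \<eta>)"
  have C: "4 * (?d + 2) / ?E 0 \<le> C" "1 / (2 * \<eta>) \<le> C" "C \<ge> 0"
    using \<eta>(1) E0 by (auto simp: C_def)
  show ?thesis
  proof (rule that[OF C(3)])
    fix \<epsilon> \<delta> :: real
    assume \<epsilon>: "0 \<le> \<epsilon>" "\<epsilon> \<le> 1/2" and \<delta>: "0 \<le> \<delta>" "\<delta> \<le> 1/2" and eq: "\<epsilon> * ?E \<delta> = 2 * (?d - 2 * s + 2 - \<delta>) * \<delta>"
    show "\<epsilon> \<le> C * \<delta>"
    proof (cases "\<delta> < \<eta>")
      case True
      then have "?E 0 / 2 \<le> ?E \<delta>" using \<eta>(2)[of \<delta>] \<delta> by (simp add: dist_real_def abs_if split: if_splits)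
      then have "\<epsilon> * (?E 0 / 2) \<le> \<epsilon> * ?E \<delta>" using \<epsilon> by (intro mult_left_mono) auto
      also have "\<dots> \<le> 2 * (?d + 2) * \<delta>" unfolding eq using \<delta> s by (intro mult_right_mono) auto
      finally have "\<epsilon> \<le> 4 * (?d + 2) / ?E 0 * \<delta>" using E0 by (simp add: field_simps)
      also have "\<dots> \<le> C * \<delta>" using C \<delta> by (intro mult_right_mono) auto
      finally show ?thesis .
    next
      case False
      then have "1/2 \<le> 1 / (2 * \<eta>) * \<delta>" using \<eta>(1) by (simp add: field_simps)
      also have "\<dots> \<le> C * \<delta>" using C \<delta> by (intro mult_right_mono) auto
      finally show ?thesis using \<epsilon> by simp
    qed
  qed
qed

theorem theorem4p1:
  fixes d :: nat and s :: real
  assumes "CARD('n::finite) = d" and "2 \<le> d" and "0 < s" and "s < 1"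
  shows
    "(\<forall>\<delta>\<in>{0..1/2}. \<forall>i::'n. \<forall>t\<in>{0<..<1}. \<forall>q>1.
        u_sol i \<delta> \<in> frac_sobolev_loc t q (ball 0 1) \<longleftrightarrow> 1 - \<delta> > t - real d / q)
   \<and> (\<forall>\<epsilon>\<in>{0..1/2}.
        (uniformly_elliptic_on (- {0}) (A_coeff s \<epsilon> :: real ^ 'n \<Rightarrow> real ^ 'n ^ 'n) \<and>
         (\<forall>x::real ^ 'n. x \<noteq> 0 \<longrightarrow>
            eigenvalues (A_coeff s \<epsilon> x) \<subseteq> {1 - (1 + 2 * s) / 2 * \<epsilon> .. 1 + (real d - 1) / 2 * \<epsilon>}) \<and>
         {1 - (1 + 2 * s) / 2 * \<epsilon> .. 1 + (real d - 1) / 2 * \<epsilon>} \<subseteq> {1 / 4 .. 1 + (real d - 1) / 4}) \<and>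
        esssup lborel (\<lambda>x::real ^ 'n. ereal (spectral_norm (matrix_log (A_coeff s \<epsilon> x))))
          \<le> ereal ((1 + real d + 4 * s) / 2 * \<epsilon>))
   \<and> (\<exists>\<delta>\<^sub>0\<in>{0..1/2}. \<exists>C::real. \<forall>\<epsilon>\<in>{0..1/2}. \<exists>\<delta>\<in>{0..\<delta>\<^sub>0}.
        \<epsilon> \<le> C * \<delta> \<and>
        (\<forall>i::'n. \<forall>x\<in>ball 0 1 - {0}.
           nonlocal_op_exists (A_coeff s \<epsilon>) s (u_sol i \<delta>) x \<and>
           nonlocal_op (A_coeff s \<epsilon>) s (u_sol i \<delta>) x = 0) \<and>
        eps_denominator d s \<delta> \<noteq> 0 \<and>
        \<epsilon> = 2 * (real d - 2 * s + 2 - \<delta>) * \<delta> / eps_denominator d s \<delta>)"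
proof (intro conjI)
  note card = assms(1) and d = assms(2) and s = assms(3,4)
  show "\<forall>\<delta>\<in>{0..1/2}. \<forall>i::'n. \<forall>t\<in>{0<..<1}. \<forall>q>1.
        u_sol i \<delta> \<in> frac_sobolev_loc t q (ball 0 1) \<longleftrightarrow> 1 - \<delta> > t - real d / q"
  proof (intro ballI allI impI)
    fix \<delta> t q :: real and i :: 'n
    assume "\<delta> \<in> {0..1/2}" "t \<in> {0<..<1}" "q > 1"
    then show "u_sol i \<delta> \<in> frac_sobolev_loc t q (ball 0 1) \<longleftrightarrow> 1 - \<delta> > t - real d / q"
      using u_sol_frac_sobolev_loc_iff[of \<delta> t q i] card by simp
  qed
  show "\<forall>\<epsilon>\<in>{0..1/2}.
        (uniformly_elliptic_on (- {0}) (A_coeff s \<epsilon> :: real ^ 'n \<Rightarrow> real ^ 'n ^ 'n) \<and>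
         (\<forall>x::real ^ 'n. x \<noteq> 0 \<longrightarrow>
            eigenvalues (A_coeff s \<epsilon> x) \<subseteq> {1 - (1 + 2 * s) / 2 * \<epsilon> .. 1 + (real d - 1) / 2 * \<epsilon>}) \<and>
         {1 - (1 + 2 * s) / 2 * \<epsilon> .. 1 + (real d - 1) / 2 * \<epsilon>} \<subseteq> {1 / 4 .. 1 + (real d - 1) / 4}) \<and>
        esssup lborel (\<lambda>x::real ^ 'n. ereal (spectral_norm (matrix_log (A_coeff s \<epsilon> x))))
          \<le> ereal ((1 + real d + 4 * s) / 2 * \<epsilon>)"
  proof (intro ballI conjI allI impI)
    fix \<epsilon> :: real assume "\<epsilon> \<in> {0..1/2}"
    then have \<epsilon>: "0 \<le> \<epsilon>" "\<epsilon> \<le> 1/2" by auto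
    have le: "(1 + 2 * s) / 2 * \<epsilon> \<le> 3/4"
      using mult_mono[of "(1 + 2 * s) / 2" "3/2" \<epsilon> "1/2"] s \<epsilon> by simp
    show "uniformly_elliptic_on (- {0}) (A_coeff s \<epsilon> :: real ^ 'n \<Rightarrow> real ^ 'n ^ 'n)"
      by (rule uniformly_elliptic_A_coeff[OF s(1) \<epsilon>(1)]) (use le in linarith)
    show "eigenvalues (A_coeff s \<epsilon> x) \<subseteq> {1 - (1 + 2 * s) / 2 * \<epsilon> .. 1 + (real d - 1) / 2 * \<epsilon>}" for x :: "real ^ 'n"
      using eigenvalues_A_coeff[OF s(1) \<epsilon>(1), of x] card by simp
    have "(real d - 1) / 2 * \<epsilon> \<le> (real d - 1) / 2 * (1/2)"
      using \<epsilon> d by (intro mult_left_mono) auto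
    then show "{1 - (1 + 2 * s) / 2 * \<epsilon> .. 1 + (real d - 1) / 2 * \<epsilon>} \<subseteq> {1 / 4 .. 1 + (real d - 1) / 4}"
      using le by (intro atLeastatMost_subset_iff[THEN iffD2] disjI2 conjI) linarith+
    show "esssup lborel (\<lambda>x::real ^ 'n. ereal (spectral_norm (matrix_log (A_coeff s \<epsilon> x)))) \<le> ereal ((1 + real d + 4 * s) / 2 * \<epsilon>)"
      using esssup_log_A_coeff_le[where 'n = 'n, OF s \<epsilon>] card d by simp
  qed
  obtain C where C: "C \<ge> 0" "\<And>\<epsilon> \<delta>. 0 \<le> \<epsilon> \<Longrightarrow> \<epsilon> \<le> 1/2 \<Longrightarrow> 0 \<le> \<delta> \<Longrightarrow> \<delta> \<le> 1/2 \<Longrightarrow>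
    \<epsilon> * eps_denominator d s \<delta> = 2 * (real d - 2 * s + 2 - \<delta>) * \<delta> \<Longrightarrow> \<epsilon> \<le> C * \<delta>"
    using eps_le_const_delta[OF d s] by blast
  show "\<exists>\<delta>\<^sub>0\<in>{0..1/2}. \<exists>C::real. \<forall>\<epsilon>\<in>{0..1/2}. \<exists>\<delta>\<in>{0..\<delta>\<^sub>0}.
        \<epsilon> \<le> C * \<delta> \<and>
        (\<forall>i::'n. \<forall>x\<in>ball 0 1 - {0}.
           nonlocal_op_exists (A_coeff s \<epsilon>) s (u_sol i \<delta>) x \<and>
           nonlocal_op (A_coeff s \<epsilon>) s (u_sol i \<delta>) x = 0) \<and>
        eps_denominator d s \<delta> \<noteq> 0 \<and>
        \<epsilon> = 2 * (real d - 2 * s + 2 - \<delta>) * \<delta> / eps_denominator d s \<delta>"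
  proof (rule bexI[of _ "1/2"], rule exI[of _ C], rule ballI)
    fix \<epsilon> :: real assume "\<epsilon> \<in> {0..1/2}"
    then have \<epsilon>: "0 \<le> \<epsilon>" "\<epsilon> \<le> 1/2" by auto
    let ?p = "1 - (1 + 2 * s) / 2 * \<epsilon>" and ?q = "(real CARD('n) + 2 * s) / 2 * \<epsilon>"
    obtain \<delta> where \<delta>: "0 \<le> \<delta>" "\<delta> \<le> 1/2"
      and rel: "\<epsilon> * eps_denominator d s \<delta> = 2 * (real d - 2 * s + 2 - \<delta>) * \<delta>" "eps_denominator d s \<delta> > 0"
      and S: "\<And>i (x :: real ^ 'n). norm x = 1 \<Longrightarrow> has_bochner_integral lborel (symm_integrand s i \<delta> ?p ?q x) 0"
    proof (cases "\<epsilon> = 0")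
      case True
      have "eps_denominator d s 0 > 0" unfolding eps_denominator_zero[OF d s] using d s by simp
      moreover have "has_bochner_integral lborel (symm_integrand s i 0 ?p ?q x) 0" for i and x :: "real ^ 'n"
        using True by (simp add: symm_integrand_linear[abs_def] has_bochner_integral_zero)
      ultimately show ?thesis using that[of 0] True by simp
    next
      case False
      then obtain \<delta> where \<delta>: "0 < \<delta>" "\<delta> \<le> 1/2"
        and rel: "\<epsilon> * eps_denominator d s \<delta> = 2 * (real d - 2 * s + 2 - \<delta>) * \<delta>" "eps_denominator d s \<delta> > 0"
        using exists_delta[OF d s, of \<epsilon>] \<epsilon> by auto
      have \<delta>1: "\<delta> \<le> 1" and dr: "real d \<ge> 2" using \<delta> d by auto
      note zero = averaged_defect_integral_eq_zero[OF s \<delta>(1) \<delta>1 dr rel(1)[unfolded eps_denominator_def]]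
      have "has_bochner_integral lborel (symm_integrand s i \<delta> ?p ?q x) 0" if x: "norm x = 1" for i and x :: "real ^ 'n"
        using integral_symm_integrand_unit[OF x \<delta>(1) \<delta>1 s, of ?p ?q i] zero
          integrable_symm_integrand_unit[OF x _ \<delta>1 s, of i ?p ?q] \<delta> card d
        by (simp add: has_bochner_integral_iff)
      then show ?thesis using that[of \<delta>] \<delta> rel by simp
    qed
    show "\<exists>\<delta>\<in>{0..1/2}. \<epsilon> \<le> C * \<delta> \<and>
        (\<forall>i::'n. \<forall>x\<in>ball 0 1 - {0}.
           nonlocal_op_exists (A_coeff s \<epsilon>) s (u_sol i \<delta>) x \<and>
           nonlocal_op (A_coeff s \<epsilon>) s (u_sol i \<delta>) x = 0) \<and>
        eps_denominator d s \<delta> \<noteq> 0 \<and>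
        \<epsilon> = 2 * (real d - 2 * s + 2 - \<delta>) * \<delta> / eps_denominator d s \<delta>"
    proof (rule bexI[of _ \<delta>], intro conjI allI ballI)
      show "\<epsilon> \<le> C * \<delta>" by (rule C(2)[OF \<epsilon> \<delta> rel(1)])
      show "eps_denominator d s \<delta> \<noteq> 0" using rel(2) by simp
      then show "\<epsilon> = 2 * (real d - 2 * s + 2 - \<delta>) * \<delta> / eps_denominator d s \<delta>"
        using rel(1) by (simp add: nonzero_eq_divide_eq)
      fix i :: 'n and x :: "real ^ 'n" assume "x \<in> ball 0 1 - {0}"
      then have x: "x \<noteq> 0" by simp
      have "has_bochner_integral lborel (symm_integrand s i \<delta> ?p ?q x) 0"
        by (rule has_bochner_integral_symm_integrand[OF x S]) (use x in \<open>simp add: norm_sgn\<close>)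
      from nonlocal_op_eq_zero[OF \<delta>(1) _ s(1) this] \<delta>
      show "nonlocal_op_exists (A_coeff s \<epsilon>) s (u_sol i \<delta>) x" "nonlocal_op (A_coeff s \<epsilon>) s (u_sol i \<delta>) x = 0"
        by auto
    qed (use \<delta> in auto)
  qed simp
qed

end
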